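(* There is a constant $D_0$ such that the following holds. Let $\dim\in\{3,4,5\}$, let $R(\mathbb{Z})$ be as in the context, and suppose $R(\mathbb{Z})$ has a normalized covering vector $u$ and $|\mathrm{disc}(R(\mathbb{Z}))|>D_0$. Then $\mathrm{nrm}(u)>3$ (so that $\mathcal{A}_{R(\mathbb{Z}),u}$ is defined), $E(\mathbb{Z})$ is an infinite-index subgroup of $G(\mathbb{Z})$, and $\delta(\mathcal{A}_{R(\mathbb{Z}),u})<1$. Furthermore, ranging only over such pairs $(R(\mathbb{Z}),u)$, $\delta(\mathcal{A}_{R(\mathbb{Z}),u})\to 0$ as $|\mathrm{disc}(R(\mathbb{Z}))|\to\infty$.
   Context: Setup. Fix $\dim\in\{3,4,5\}$. If $\dim=3$, $R(\mathbb{Q})$ is an imaginary quadratic field and $R(\mathbb{Z})$ its ring of integers. If $\dim=4$, $R(\mathbb{Q})=\left(\frac{a,b}{\mathbb{Q}}\right)$ is a rational definite quaternion algebra ($i^2=a<0$, $j^2=b<0$, $ij=-ji$) with the orthogonal involution $(x+yi+zj+tij)^\ddagger=x+yi+zj-tij$, and $R(\mathbb{Z})$ is a maximal $\ddagger$-order (an order $\mathcal{O}$ with $\mathcal{O}^\ddagger=\mathcal{O}$, maximal among such). If $\dim=5$, $R(\mathbb{Q})$ is a rational definite quaternion algebra and $R(\mathbb{Z})$ a maximal order. $\overline{\cdot}$ is the standard conjugation, $\mathrm{nrm}(\alpha)=\alpha\bar\alpha$, $\mathrm{tr}(\alpha)=\alpha+\bar\alpha$. $R(\mathbb{Z})^+$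 is the set of $\ddagger$-fixed elements if $\dim=4$ and $R(\mathbb{Z})$ itself otherwise; $R(\mathbb{R})=R(\mathbb{Z})\otimes\mathbb{R}$ and $R(\mathbb{R})^+$ similarly; $R(\mathbb{R})^+$ is identified with Euclidean $\mathbb{R}^{\dim-1}$ with inner product $\mathrm{tr}(x\bar y)/2$, the first coordinate being the real part. $\mathrm{disc}(R(\mathbb{Z}))$ is the integer $\det(\mathrm{tr}(e_k\bar e_l))$ for a $\mathbb{Z}$-basis $(e_k)$ of $R(\mathbb{Z})$. $G(\mathbb{Z})=SL(2,R(\mathbb{Z}))$ if $\dim=3,5$ (for quaternions: matrices over $R(\mathbb{Z})$ of determinant $1$ when viewed as $4\times4$ complex matrices via an embedding of the Hamilton quaternions into $\mathrm{Mat}(2,\mathbb{C})$), and $G(\mathbb{Z})=SL^\ddagger(2,R(\mathbb{Z}))=\{M:\hat\ddagger(M)M=M\hat\ddagger(M)=I\}$ if $\dim=4$, where $\hat\ddagger\begin{pmatrix}a&b\\c&d\end{pmatrix}=\begin{pmatrix}d^\ddagger&-b^\ddagger\\-c^\ddagger&a^\ddagger\end{pmatrix}$. $E(\mathbb{Z})$ is the subgroup of $G(\mathbb{Z})$ generated by its upper and lower triangular matrices. Matrices act on $R(\mathbb{R})^+\cup\{\infty\}$ by $\rho\mapsto(a\rho+b)(c\rho+d)^{-1}$, and Möbius transformations act on oriented spheres. Covering vectors. For nonzero $u\in R(\mathbb{R})^+$, $S_u$ is the hyperplane through $0$ orthogonal to $u$, oriented so its interior is the open half-space containing $u$; $-S$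 denotes $S$ with opposite orientation. A nonzero $u$ with real part $0$ is a covering vector if open unit balls centered at the points of $S_u\cap R(\mathbb{Z})$ cover $S_u$; it is normalized if moreover $u\in R(\mathbb{Z})^+$ and $u/k\notin R(\mathbb{Z})$ for every integer $k>1$. Packing. For a normalized covering vector $u$ with $\mathrm{nrm}(u)>3$, choose $\tau\in R(\mathbb{Z})^+$ in the interior of $S_u$ such that $S_u\cap R(\mathbb{Z})^+$ and $\tau$ generate $R(\mathbb{Z})^+$. $\Gamma_u$ is the group generated by the translations $z\mapsto z+\omega$, $\omega\in R(\mathbb{Z})^+\cap S_u$, and the inversions in unit spheres centered at points of $R(\mathbb{Z})^+\cap S_u$ and of $R(\mathbb{Z})^+\cap(S_u+\tau)$. $\mathcal{A}_{R(\mathbb{Z}),u}$ is the union of the $\Gamma_u$-orbits of the oriented spheres $S_u$ and $-S_u+\tau$. Its density is $\delta(\mathcal{A}_{R(\mathbb{Z}),u})=\frac{1}{\mathrm{vol}(R(\mathbb{R})^+/R(\mathbb{Z})^+)}\sum\mathrm{vol}(\mathrm{Int}(S))$, summing over orbits $S$ of $\mathcal{A}_{R(\mathbb{Z}),u}$ under translation by $R(\mathbb{Z})^+\cap S_u$ with $S\neq S_u,-S_u+\tau$, where $\mathrm{Int}(S)$ is the interior and vol is Lebesgue measure on $\mathbb{R}^{\dim-1}$.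
   Formalization: The packing is generated by -S_u and S_u+τ (which are also the two spheres excluded from the density sum) instead of S_u and -S_u+τ; with the stated orientation the inversion at τ sends S_u to a sphere with unbounded interior, so the density would always be infinite. *)

theory Defs
  imports "HOL-Analysis.Analysis" "HOL-Algebra.Bij" "HOL-Algebra.Generated_Groups"
begin

section \<open>Hamilton quaternions\<close>

text \<open>\<open>Quat x y z t\<close> is $x + yi + zj + tk$ with $k = ij$. All three families of rings
  are realised as subrings of the Hamilton quaternions.\<close>

datatype quat = Quat (qRe: real) (qI: real) (qJ: real) (qK: real)

lemma quat_eq_iff: "x = y \<longleftrightarrow> qRe x = qRe y \<and> qI x = qI y \<and> qJ x = qJ y \<and> qK x = qK y"
  by (cases x; cases y) auto

instantiation quat :: real_algebra_1
begin

definition "0 = Quat 0 0 0 0"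
definition "1 = Quat 1 0 0 0"
definition "x + y = Quat (qRe x + qRe y) (qI x + qI y) (qJ x + qJ y) (qK x + qK y)"
definition "x - y = Quat (qRe x - qRe y) (qI x - qI y) (qJ x - qJ y) (qK x - qK y)"
definition "- x = Quat (- qRe x) (- qI x) (- qJ x) (- qK x)"
definition "r *\<^sub>R x = Quat (r * qRe x) (r * qI x) (r * qJ x) (r * qK x)"
definition "x * y = Quat
  (qRe x * qRe y - qI x * qI y - qJ x * qJ y - qK x * qK y)
  (qRe x * qI y + qI x * qRe y + qJ x * qK y - qK x * qJ y)
  (qRe x * qJ y - qI x * qK y + qJ x * qRe y + qK x * qI y)
  (qRe x * qK y + qI x * qJ y - qJ x * qI y + qK x * qRe y)"

instance
  by standard (simp_all add: quat_eq_iff zero_quat_def one_quat_def plus_quat_def minus_quat_def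
      uminus_quat_def scaleR_quat_def times_quat_def algebra_simps)

end

lemmas quat_ops = zero_quat_def one_quat_def plus_quat_def minus_quat_def
  uminus_quat_def scaleR_quat_def times_quat_def

instantiation quat :: real_inner
begin

definition "inner x y = qRe x * qRe y + qI x * qI y + qJ x * qJ y + qK x * qK y"
definition "norm (x :: quat) = sqrt (inner x x)"
definition "sgn (x :: quat) = x /\<^sub>R norm x"
definition "dist (x :: quat) y = norm (x - y)"
definition [code del]:
  "(uniformity :: (quat \<times> quat) filter) = (INF e\<in>{0 <..}. principal {(x, y). dist x y < e})"
definition [code del]:
  "open (U :: quat set) \<longleftrightarrow> (\<forall>x\<in>U. eventually (\<lambda>(x', y). x' = x \<longrightarrow> y \<in> U) uniformity)"

instance
proof
  fix x y z :: quat and r :: real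
  show "inner x y = inner y x"
    by (simp add: inner_quat_def algebra_simps)
  show "inner (x + y) z = inner x z + inner y z"
    by (simp add: inner_quat_def quat_ops algebra_simps)
  show "inner (r *\<^sub>R x) y = r * inner x y"
    by (simp add: inner_quat_def quat_ops algebra_simps)
  show "0 \<le> inner x x"
    by (simp add: inner_quat_def)
  show "inner x x = 0 \<longleftrightarrow> x = 0"
  proof
    assume "inner x x = 0"
    then have s: "qRe x * qRe x + qI x * qI x + qJ x * qJ x + qK x * qK x = 0"
      by (simp add: inner_quat_def)
    have "0 \<le> qRe x * qRe x" "0 \<le> qI x * qI x" "0 \<le> qJ x * qJ x" "0 \<le> qK x * qK x"
      by simp_all
    with s have "qRe x * qRe x = 0" "qI x * qI x = 0" "qJ x * qJ x = 0" "qK x * qK x = 0"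
      by linarith+
    then show "x = 0" by (simp add: quat_eq_iff quat_ops)
  qed (simp add: inner_quat_def quat_ops)
qed (simp_all add: norm_quat_def sgn_quat_def dist_quat_def uniformity_quat_def open_quat_def)

end

instantiation quat :: euclidean_space
begin

definition "Basis = {Quat 1 0 0 0, Quat 0 1 0 0, Quat 0 0 1 0, Quat 0 0 0 1}"

instance
proof
  fix x u v :: quat
  show "(Basis :: quat set) \<noteq> {}" "finite (Basis :: quat set)"
    by (simp_all add: Basis_quat_def)
  show "inner u v = (if u = v then 1 else 0)" if "u \<in> Basis" "v \<in> Basis"
    using that unfolding Basis_quat_def by (elim insertE emptyE) (simp_all add: inner_quat_def)
  show "(\<forall>u\<in>Basis. inner x u = 0) \<longleftrightarrow> x = 0"
    by (cases x) (simp add: Basis_quat_def inner_quat_def zero_quat_def)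
qed

end

definition qcnj :: "quat \<Rightarrow> quat" where
  "qcnj x = Quat (qRe x) (- qI x) (- qJ x) (- qK x)"

definition nrm :: "quat \<Rightarrow> real" where
  "nrm x = qRe (x * qcnj x)"

definition tr :: "quat \<Rightarrow> real" where
  "tr x = qRe (x + qcnj x)"

definition ddag :: "quat \<Rightarrow> quat" where
  "ddag x = Quat (qRe x) (qI x) (qJ x) (- qK x)"

lemma nrm_eq: "of_real (nrm x) = x * qcnj x"
  by (simp add: nrm_def qcnj_def of_real_def quat_eq_iff quat_ops)

lemma tr_eq: "of_real (tr x) = x + qcnj x"
  by (simp add: tr_def qcnj_def of_real_def quat_eq_iff quat_ops)

lemma inner_eq_tr: "inner x y = tr (x * qcnj y) / 2"
  by (simp add: inner_quat_def tr_def qcnj_def quat_ops)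

lemma nrm_eq_norm: "nrm x = (norm x)\<^sup>2"
  by (simp add: nrm_def norm_quat_def inner_quat_def qcnj_def quat_ops)


section \<open>Lattices, the rings, and the discriminant\<close>

definition zspan :: "quat set \<Rightarrow> quat set" where
  "zspan B = {\<Sum>b\<in>T. of_int (c b) * b | T (c :: quat \<Rightarrow> int). finite T \<and> T \<subseteq> B}"

definition zbasis :: "quat set \<Rightarrow> quat set \<Rightarrow> bool" where
  "zbasis B L \<longleftrightarrow> finite B \<and> L = zspan B \<and>
     (\<forall>c :: quat \<Rightarrow> int. (\<Sum>b\<in>B. of_int (c b) * b) = 0 \<longrightarrow> (\<forall>b\<in>B. c b = 0))"

text \<open>The algebra $(a,b/\mathbb{Q})$, for $a, b < 0$, with its generators scaled into the
  Hamilton quaternions: $i \mapsto \sqrt{-a}\,i$, $j \mapsto \sqrt{-b}\,j$, so that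
  $ij \mapsto \sqrt{ab}\,k$ and the given orthogonal involution becomes \<open>ddag\<close>.\<close>

definition quat_alg :: "rat \<Rightarrow> rat \<Rightarrow> quat set" where
  "quat_alg a b = {Quat (of_rat x) (of_rat y * sqrt (- of_rat a)) (of_rat z * sqrt (- of_rat b))
                        (of_rat t * sqrt (of_rat a * of_rat b)) | x y z t. True}"

definition is_order :: "quat set \<Rightarrow> quat set \<Rightarrow> bool" where
  "is_order A R \<longleftrightarrow> R \<subseteq> A \<and> 1 \<in> R \<and> (\<forall>x\<in>R. \<forall>y\<in>R. x - y \<in> R \<and> x * y \<in> R) \<and>
     (\<exists>F. finite F \<and> R = zspan F) \<and> (\<forall>x\<in>A. \<exists>m::nat. m > 0 \<and> of_nat m * x \<in> R)"

definition maximal_order :: "quat set \<Rightarrow> quat set \<Rightarrow> bool" where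
  "maximal_order A R \<longleftrightarrow> is_order A R \<and> (\<forall>R'. is_order A R' \<and> R \<subseteq> R' \<longrightarrow> R' = R)"

definition ddag_order :: "quat set \<Rightarrow> quat set \<Rightarrow> bool" where
  "ddag_order A R \<longleftrightarrow> is_order A R \<and> ddag ` R = R"

definition maximal_ddag_order :: "quat set \<Rightarrow> quat set \<Rightarrow> bool" where
  "maximal_ddag_order A R \<longleftrightarrow> ddag_order A R \<and> (\<forall>R'. ddag_order A R' \<and> R \<subseteq> R' \<longrightarrow> R' = R)"

text \<open>The field $\mathbb{Q}(\sqrt{-d})$.\<close>

definition imag_quad_field :: "rat \<Rightarrow> complex set" where
  "imag_quad_field d = {Complex (of_rat x) (of_rat y * sqrt (of_rat d)) | x y. True}"

definition quat_of_complex :: "complex \<Rightarrow> quat" where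
  "quat_of_complex z = Quat (Re z) (Im z) 0 0"

definition complex_of_quat :: "quat \<Rightarrow> complex" where
  "complex_of_quat x = Complex (qRe x) (qI x)"

text \<open>\<open>is_RZ n R\<close>: the set \<open>R\<close> is one of the rings $R(\mathbb{Z})$ attached to dimension \<open>n\<close>.\<close>

definition is_RZ :: "nat \<Rightarrow> quat set \<Rightarrow> bool" where
  "is_RZ n R \<longleftrightarrow>
     n = 3 \<and> (\<exists>d>0. R = quat_of_complex ` {z \<in> imag_quad_field d. algebraic_int z}) \<or>
     n = 4 \<and> (\<exists>a b. a < 0 \<and> b < 0 \<and> maximal_ddag_order (quat_alg a b) R) \<or>
     n = 5 \<and> (\<exists>a b. a < 0 \<and> b < 0 \<and> maximal_order (quat_alg a b) R)"

definition RZ_plus :: "nat \<Rightarrow> quat set \<Rightarrow> quat set" where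
  "RZ_plus n R = (if n = 4 then {x \<in> R. ddag x = x} else R)"

text \<open>An orthonormal basis of $R(\mathbb{R})^+$, of size \<open>n - 1\<close>.\<close>

definition plus_basis :: "nat \<Rightarrow> quat set" where
  "plus_basis n = (if n = 3 then {Quat 1 0 0 0, Quat 0 1 0 0}
     else if n = 4 then {Quat 1 0 0 0, Quat 0 1 0 0, Quat 0 0 1 0}
     else {Quat 1 0 0 0, Quat 0 1 0 0, Quat 0 0 1 0, Quat 0 0 0 1})"

definition RR_plus :: "nat \<Rightarrow> quat set" where
  "RR_plus n = span (plus_basis n)"

text \<open>The Leibniz formula for $\det(\mathrm{tr}(e_k \overline{e_l}))$, with rows and columns
  indexed by the basis itself; its value depends neither on an ordering nor on the basis.\<close>

definition gram_det :: "quat set \<Rightarrow> real" where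
  "gram_det B = (\<Sum>p | p permutes B. of_int (sign p) * (\<Prod>e\<in>B. tr (e * qcnj (p e))))"

definition disc :: "quat set \<Rightarrow> real" where
  "disc R = gram_det (SOME B. zbasis B R)"


section \<open>The groups\<close>

definition mat_over :: "quat set \<Rightarrow> (quat^2^2) set" where
  "mat_over R = {M. \<forall>i j. M $ i $ j \<in> R}"

definition quat_to_mat :: "quat \<Rightarrow> complex^2^2" where
  "quat_to_mat x = vector [vector [Complex (qRe x) (qI x), Complex (qJ x) (qK x)],
                           vector [Complex (- qJ x) (qK x), Complex (qRe x) (- qI x)]]"

lemma quat_to_mat_mult: "quat_to_mat (x * y) = quat_to_mat x ** quat_to_mat y"
  unfolding vec_eq_iff forall_2 matrix_matrix_mult_def
  by (simp add: quat_to_mat_def sum_2 times_quat_def complex_eq_iff)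

lemma quat_to_mat_one: "quat_to_mat 1 = mat 1"
  unfolding vec_eq_iff forall_2
  by (simp add: quat_to_mat_def mat_def one_quat_def complex_eq_iff)

text \<open>The block matrix of a quaternionic matrix; \<open>2 \<times> 2\<close> is the four-element index type
  (block, position inside the block).\<close>

definition block_mat :: "quat^2^2 \<Rightarrow> complex^(2 \<times> 2)^(2 \<times> 2)" where
  "block_mat M = (\<chi> r c. quat_to_mat (M $ fst r $ fst c) $ snd r $ snd c)"

definition ddag_hat :: "quat^2^2 \<Rightarrow> quat^2^2" where
  "ddag_hat M = vector [vector [ddag (M $ 2 $ 2), - ddag (M $ 1 $ 2)],
                        vector [- ddag (M $ 2 $ 1), ddag (M $ 1 $ 1)]]"

definition GZ_set :: "nat \<Rightarrow> quat set \<Rightarrow> (quat^2^2) set" where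
  "GZ_set n R =
     (if n = 3 then {M \<in> mat_over R. det ((\<chi> i j. complex_of_quat (M $ i $ j)) :: complex^2^2) = 1}
      else if n = 4 then {M \<in> mat_over R. ddag_hat M ** M = mat 1 \<and> M ** ddag_hat M = mat 1}
      else {M \<in> mat_over R. det (block_mat M) = 1})"

definition GZ :: "nat \<Rightarrow> quat set \<Rightarrow> (quat^2^2) monoid" where
  "GZ n R = \<lparr>carrier = GZ_set n R, mult = (**), one = mat 1\<rparr>"

definition EZ :: "nat \<Rightarrow> quat set \<Rightarrow> (quat^2^2) set" where
  "EZ n R = generate (GZ n R) {M \<in> GZ_set n R. M $ 2 $ 1 = 0 \<or> M $ 1 $ 2 = 0}"


section \<open>Covering vectors\<close>

definition hyp :: "nat \<Rightarrow> quat \<Rightarrow> quat set" where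
  "hyp n u = {x \<in> RR_plus n. inner u x = 0}"

definition covering_vector :: "nat \<Rightarrow> quat set \<Rightarrow> quat \<Rightarrow> bool" where
  "covering_vector n R u \<longleftrightarrow> u \<in> RR_plus n \<and> u \<noteq> 0 \<and> qRe u = 0 \<and>
     hyp n u \<subseteq> (\<Union>p \<in> hyp n u \<inter> R. ball p 1)"

definition normalized_covering_vector :: "nat \<Rightarrow> quat set \<Rightarrow> quat \<Rightarrow> bool" where
  "normalized_covering_vector n R u \<longleftrightarrow> covering_vector n R u \<and> u \<in> RZ_plus n R \<and>
     (\<forall>k::int. k > 1 \<longrightarrow> (1 / of_int k) *\<^sub>R u \<notin> R)"


section \<open>Oriented spheres\<close>

text \<open>The point \<open>None\<close> is $\infty$. An oriented sphere is given by its underlying set of points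
  and its interior, both subsets of $R(\mathbb{R})^+ \cup \{\infty\}$. A Moebius
  transformation acts by taking the image of both.\<close>

type_synonym osphere = "quat option set \<times> quat option set"

definition ext_space :: "nat \<Rightarrow> quat option set" where
  "ext_space n = insert None (Some ` RR_plus n)"

definition S_plane :: "nat \<Rightarrow> quat \<Rightarrow> osphere" where
  "S_plane n u = (insert None (Some ` hyp n u), Some ` {x \<in> RR_plus n. inner u x > 0})"

definition op_sphere :: "nat \<Rightarrow> osphere \<Rightarrow> osphere" where
  "op_sphere n S = (fst S, ext_space n - fst S - snd S)"

definition act :: "(quat option \<Rightarrow> quat option) \<Rightarrow> osphere \<Rightarrow> osphere" where
  "act g S = (g ` fst S, g ` snd S)"

definition Int_sphere :: "osphere \<Rightarrow> quat set" where
  "Int_sphere S = {x. Some x \<in> snd S}"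

definition translation :: "quat \<Rightarrow> quat option \<Rightarrow> quat option" where
  "translation w = map_option (\<lambda>x. x + w)"

definition inversion :: "quat \<Rightarrow> quat option \<Rightarrow> quat option" where
  "inversion p z = (case z of None \<Rightarrow> Some p
     | Some x \<Rightarrow> if x = p then None else Some (p + (1 / (norm (x - p))\<^sup>2) *\<^sub>R (x - p)))"


section \<open>The packing and its density\<close>

definition plane_lattice :: "nat \<Rightarrow> quat set \<Rightarrow> quat \<Rightarrow> quat set" where
  "plane_lattice n R u = RZ_plus n R \<inter> hyp n u"

text \<open>The admissible choices of $\tau$.\<close>

definition packing_shift :: "nat \<Rightarrow> quat set \<Rightarrow> quat \<Rightarrow> quat \<Rightarrow> bool" where
  "packing_shift n R u \<tau> \<longleftrightarrow> \<tau> \<in> RZ_plus n R \<and> \<tau> \<in> Int_sphere (S_plane n u) \<and>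
     zspan (insert \<tau> (plane_lattice n R u)) = RZ_plus n R"

text \<open>The group is realised as a group of bijections of the one-point compactification of the
  full space of quaternions; every generator preserves $R(\mathbb{R})^+ \cup \{\infty\}$.\<close>

definition Gamma :: "nat \<Rightarrow> quat set \<Rightarrow> quat \<Rightarrow> quat \<Rightarrow> (quat option \<Rightarrow> quat option) set" where
  "Gamma n R u \<tau> = generate (BijGroup UNIV)
     (translation ` plane_lattice n R u \<union>
      inversion ` {p \<in> RZ_plus n R. p \<in> hyp n u \<or> p - \<tau> \<in> hyp n u})"

text \<open>The two bounding planes of the packing, $-S_u$ and $S_u + \tau$. Their interiors are the
  two half-spaces outside the strip between the planes. This is opposite to the orientation
  obtained by reading the names $S_u$ and $-S_u + \tau$ with $\tau$ in the interior of $S_u$: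
  with that reading the interiors of the two planes overlap in the strip, and the interior of
  every other sphere of the orbits is the unbounded side (the inversion at $\tau$, say, takes
  the interior of $S_u$, which contains $\tau$, to a neighbourhood of $\infty$), so that the
  density would be infinite. Since the group commutes with reversal of orientation, the
  choice made here just reverses every sphere of the packing.\<close>

definition base_planes :: "nat \<Rightarrow> quat \<Rightarrow> quat \<Rightarrow> osphere set" where
  "base_planes n u \<tau> = {op_sphere n (S_plane n u), act (translation \<tau>) (S_plane n u)}"

definition packing :: "nat \<Rightarrow> quat set \<Rightarrow> quat \<Rightarrow> quat \<Rightarrow> osphere set" where
  "packing n R u \<tau> = {act g S | g S. g \<in> Gamma n R u \<tau> \<and> S \<in> base_planes n u \<tau>}"

text \<open>Lebesgue measure on $R(\mathbb{R})^+$, as a Borel measure on all quaternions; this is the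
  definition of \<open>lborel\<close> with \<open>plus_basis n\<close> in place of \<open>Basis\<close>.\<close>

definition vol :: "nat \<Rightarrow> quat measure" where
  "vol n = distr (\<Pi>\<^sub>M b\<in>plus_basis n. lborel) borel (\<lambda>f. \<Sum>b\<in>plus_basis n. f b *\<^sub>R b)"

text \<open>The covolume in $R(\mathbb{R})^+$ of a full lattice \<open>L\<close>: the volume of the fundamental
  parallelepiped of a basis.\<close>

definition covol :: "nat \<Rightarrow> quat set \<Rightarrow> ennreal" where
  "covol n L = emeasure (vol n)
     (let B = (SOME B. zbasis B L)
      in {\<Sum>b\<in>B. t b *\<^sub>R b | t. \<forall>b\<in>B. 0 \<le> t b \<and> t b < 1})"

definition packing_orbits :: "nat \<Rightarrow> quat set \<Rightarrow> quat \<Rightarrow> quat \<Rightarrow> osphere set set" where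
  "packing_orbits n R u \<tau> =
     {{act (translation w) S | w. w \<in> plane_lattice n R u} | S.
        S \<in> packing n R u \<tau> - base_planes n u \<tau>}"

definition packing_density :: "nat \<Rightarrow> quat set \<Rightarrow> quat \<Rightarrow> quat \<Rightarrow> ennreal" where
  "packing_density n R u \<tau> = 1 / covol n (RZ_plus n R) *
     (\<Sum>\<^sub>\<infinity>Q\<in>packing_orbits n R u \<tau>. emeasure (vol n) (Int_sphere (SOME S. S \<in> Q)))"

end

theory Submission
  imports Defs
begin

text \<open>Moebius transformations act as isometries of the Lorentz form \<open>2 (A C - |v|\<^sup>2)\<close>, and all
  groups involved preserve the lattice of vectors with \<open>A\<close>, \<open>C\<close> integral and \<open>v\<close> in the given lattice.
  Consequently isometric spheres have radius at most 1, and a transformation that preserves a lattice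
  hyperplane but moves \<open>\<infinity>\<close> carries all points at height at least 1 to points at height at most 1.
  When the distance \<open>h\<close> of consecutive lattice hyperplanes is large, the stabilizers of a
  hyperplane and of \<open>\<infinity>\<close>, or of two consecutive hyperplanes, therefore play ping-pong.

  For the elementary group this confines the orbit of \<open>\<infinity>\<close> to the points at distance at most 1
  from the lattice hyperplanes, whereas a matrix with lower left entry 3 is found all of whose
  positive powers send \<open>\<infinity>\<close> to height about \<open>h / 3\<close>; the index is thus infinite. For the packing
  it shows that different balls are disjoint, and that up to translation each of them lies in one
  of two fixed balls of radius 2, while the covolume grows linearly in \<open>h\<close>; the density is thus
  \<open>O(1 / h)\<close>. Finally \<open>h\<close> is large when the discriminant is: the ring contains a
  full set of independent elements of norm \<open>O(h)\<close>, namely \<open>1, t\<close> or \<open>1, l, t, l t\<close> with \<open>l\<close> a short element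
  of the hyperplane and \<open>t\<close> one at height \<open>h\<close>.\<close>

text \<open>A map fixing infinity might a priori tilt the family of lattice hyperplanes, and then
  ping-pong would break down. The covering property rules this out: a tilted plane contains a vector
  sent to height \<open>h / 2\<close>, and the lattice point within distance 1 of it has no
  admissible image. The same property cuts the packing down to two balls and supplies the short
  elements \<open>l\<close> and \<open>t\<close>.

  The lower left entry 3 balances two demands. The quotient a / 3 must have a height far from all
  multiples of \<open>h\<close>, and completing the column to determinant 1 needs the norm of
  \<open>a\<close> to be prime to the entry. Modulo 2 both \<tau> and \<tau> + 1 can have even norm;
  modulo 3 one of three consecutive shifts always works. The second diagonal entry is taken to
  commute with the first, so that one construction serves all three groups.

  The bound \<open>h > 10\<close> is a generous margin for strips of half-width 1 and for the
  distance \<open>h / 3\<close>.\<close>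

abbreviation finv :: "('a \<Rightarrow> 'b) \<Rightarrow> 'b \<Rightarrow> 'a" where "finv \<equiv> inv_into UNIV"

section \<open>Amalgamated products of groups of maps\<close>

definition map_group :: "('a \<Rightarrow> 'a) set \<Rightarrow> bool" where
  "map_group G \<longleftrightarrow> id \<in> G \<and> (\<forall>f\<in>G. bij f \<and> finv f \<in> G) \<and> (\<forall>f\<in>G. \<forall>g\<in>G. f \<circ> g \<in> G)"

inductive_set map_gen :: "('a \<Rightarrow> 'a) set \<Rightarrow> ('a \<Rightarrow> 'a) set" for S where
  map_gen_id: "id \<in> map_gen S"
| map_gen_comp: "a \<in> S \<Longrightarrow> w \<in> map_gen S \<Longrightarrow> a \<circ> w \<in> map_gen S"

text \<open>Reduced words of the amalgam over \<open>X True \<inter> X False\<close>, of length at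
  least one: every letter lies in exactly one of the two groups. The index records the group of the
  outermost letter, the one applied last.\<close>

inductive alt_word :: "(bool \<Rightarrow> ('a \<Rightarrow> 'a) set) \<Rightarrow> bool \<Rightarrow> ('a \<Rightarrow> 'a) \<Rightarrow> bool" for X where
  alt_single: "a \<in> X i - X (\<not> i) \<Longrightarrow> alt_word X i a"
| alt_comp: "a \<in> X i - X (\<not> i) \<Longrightarrow> alt_word X (\<not> i) w \<Longrightarrow> alt_word X i (a \<circ> w)"

lemma map_gen_incl: "a \<in> S \<Longrightarrow> a \<in> map_gen S"
  using map_gen_comp[OF _ map_gen_id, of a S] by simp

lemma map_gen_mult: "v \<in> map_gen S \<Longrightarrow> w \<in> map_gen S \<Longrightarrow> v \<circ> w \<in> map_gen S"
  by (induction rule: map_gen.induct) (auto simp: comp_assoc intro: map_gen_comp)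

lemma map_gen_inv:
  assumes "\<And>f. f \<in> S \<Longrightarrow> bij f \<and> finv f \<in> S" "w \<in> map_gen S"
  shows "bij w \<and> finv w \<in> map_gen S"
  using assms(2)
proof (induction rule: map_gen.induct)
  case map_gen_id
  have "finv (id :: 'a \<Rightarrow> 'a) = id" by (rule inv_id)
  then show ?case by (metis bij_id map_gen.map_gen_id)
next
  case (map_gen_comp a w)
  have "finv (a \<circ> w) = finv w \<circ> finv a"
    using assms(1)[of a] map_gen_comp by (intro o_inv_distrib) auto
  then show ?case
    using assms(1)[of a] map_gen_comp by (metis bij_comp map_gen_mult map_gen_incl)
qed

lemma map_group_cancel:
  assumes "map_group A" "c \<in> A" "bij c" "c \<circ> b \<in> A"
  shows "b \<in> A"
proof -
  have "finv c \<circ> (c \<circ> b) \<in> A"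
    using assms by (auto simp: map_group_def)
  then show ?thesis
    using assms(3) by (simp add: o_assoc[symmetric] bij_is_inj o_assoc)
qed

text \<open>A common element merges with the first letter. The product is still outside the other
  group, since cancelling \<open>c\<close> would otherwise put the letter itself there.\<close>

lemma alt_word_intersection:
  assumes X: "\<And>i. map_group (X i)" and c: "c \<in> X True" "c \<in> X False" and w: "alt_word X i w"
  shows "alt_word X i (c \<circ> w)"
proof -
  have c': "c \<in> X j" for j using c by (cases j) auto
  have bc: "bij c" using X[of True] c by (auto simp: map_group_def)
  have *: "c \<circ> b \<in> X i - X (\<not> i)" if "b \<in> X i - X (\<not> i)" for b
    using that X c' map_group_cancel[OF X[of "\<not> i"] c'[of "\<not> i"] bc, of b]
    by (auto simp: map_group_def)
  from w show ?thesis
  proof cases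
    case alt_single
    then show ?thesis using * by (auto intro: alt_word.alt_single)
  next
    case (alt_comp a v)
    then have "alt_word X i ((c \<circ> a) \<circ> v)" using * by (blast intro: alt_word.alt_comp)
    then show ?thesis using alt_comp by (simp add: comp_assoc)
  qed
qed

text \<open>Letters are added on the left. A new letter from the group of the current first letter
  is multiplied into it, and if the product falls into the intersection, it is absorbed by the rest
  of the word; a letter from the other group starts a new syllable.\<close>

theorem amalgam_normal_form:
  assumes X: "\<And>i. map_group (X i)" and w: "w \<in> map_gen (X True \<union> X False)"
  shows "w \<in> X True \<inter> X False \<or> (\<exists>i. alt_word X i w)"
  using w
proof (induction rule: map_gen.induct)
  case map_gen_id
  then show ?case using X unfolding map_group_def by blast
next
  case (map_gen_comp a w)
  obtain i where a: "a \<in> X i" using map_gen_comp.hyps by auto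
  have mem: "(f \<in> X True \<and> f \<in> X False) \<or> f \<in> X i - X (\<not> i)" if "f \<in> X i" for f
    using that by (cases i) auto
  have letter: "a \<circ> b \<in> X True \<inter> X False \<or> (\<exists>j. alt_word X j (a \<circ> b))" if "b \<in> X i" for b
  proof -
    have "a \<circ> b \<in> X i" using X[of i] a that by (simp add: map_group_def)
    then show ?thesis using mem[of "a \<circ> b"] alt_word.alt_single[of "a \<circ> b" X i] by blast
  qed
  have comp: "\<exists>j. alt_word X j (b \<circ> v)" if "b \<in> X i" "alt_word X (\<not> i) v" for b v
    using mem[of b] that alt_word_intersection[where c = b and i = "\<not> i" and w = v and X = X, OF X]
      alt_word.alt_comp[where a = b and X = X and i = i and w = v] by blast
  show ?case
  proof (cases "w \<in> X True \<inter> X False")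
    case True
    then have "w \<in> X i" by (cases i) auto
    then show ?thesis by (rule letter)
  next
    case False
    then obtain j where j: "alt_word X j w" using map_gen_comp.IH by blast
    show ?thesis
    proof (cases "j = i")
      case True
      from j show ?thesis
      proof cases
        case alt_single
        then show ?thesis using letter[of w] True by blast
      next
        case (alt_comp b v)
        have "a \<circ> b \<in> X i" using X[of i] a alt_comp True by (auto simp: map_group_def)
        then have "\<exists>j. alt_word X j ((a \<circ> b) \<circ> v)" using comp[of "a \<circ> b" v] alt_comp True by blast
        then show ?thesis unfolding alt_comp(1) o_assoc by blast
      qed
    next
      case False
      then have "j = (\<not> i)" by auto
      then show ?thesis using comp[OF a, of w] j by blast
    qed
  qed
qed

section \<open>The light cone model of inversive geometry\<close>

text \<open>A point \<open>z\<close> of the one-point compactification is the ray through \<open>hat z\<close> of the light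
  cone of the form \<open>lf\<close>; Moebius transformations are linear isometries of \<open>lf\<close>, and the height
  of a point above a hyperplane through \<open>\<infinity>\<close> becomes a quotient of two linear forms.\<close>

type_synonym 'a lspace = "real \<times> 'a \<times> real"

abbreviation lA :: "'a lspace \<Rightarrow> real" where "lA \<equiv> fst"
abbreviation lv :: "'a lspace \<Rightarrow> 'a" where "lv x \<equiv> fst (snd x)"
abbreviation lC :: "'a lspace \<Rightarrow> real" where "lC x \<equiv> snd (snd x)"

text \<open>The polarized Lorentz form, scaled so that the pairing of \<open>hat (Some z)\<close>
  and \<open>hat (Some w)\<close> is the squared distance of the points; pairing with
  \<open>e_inf\<close> returns the first coordinate.\<close>

definition lf :: "'a::euclidean_space lspace \<Rightarrow> 'a lspace \<Rightarrow> real" where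
  "lf x y = lA x * lC y + lC x * lA y - 2 * (lv x \<bullet> lv y)"

abbreviation e_inf :: "'a::zero lspace" where "e_inf \<equiv> (0, 0, 1)"

definition hat :: "'a::euclidean_space option \<Rightarrow> 'a lspace" where
  "hat z = (case z of None \<Rightarrow> e_inf | Some z \<Rightarrow> (1, z, z \<bullet> z))"

lemma hat_simps [simp]: "hat None = e_inf" "hat (Some z) = (1, z, z \<bullet> z)"
  by (simp_all add: hat_def)

lemma lf_e_inf: "lf x e_inf = lA x"
  by (simp add: lf_def)

lemma lf_hat_Some: "lf (1, z, z \<bullet> z) (1, w, w \<bullet> w) = (norm (z - w))\<^sup>2"
  by (simp add: lf_def power2_norm_eq_inner algebra_simps inner_commute)

lemma lf_hat_hat: "lf (hat z) (hat z) = 0"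
  by (cases z) (simp_all add: lf_def)

lemma hat_pos: "0 < lA (hat z) + lC (hat z)"
  by (cases z) (auto intro: add_pos_nonneg)

lemma lf_scaleR: "lf (a *\<^sub>R x) (b *\<^sub>R y) = a * b * lf x y"
  by (simp add: lf_def algebra_simps)

text \<open>The equation says A C = |v|^2, so A + C > 0 makes both outer coordinates nonnegative. A
  = 0 forces v = 0 and gives the ray of infinity; otherwise the point is v / A.\<close>

lemma isotropic_eq_hat:
  assumes "lf x x = 0" "0 < lA x + lC x"
  obtains \<mu> z where "0 < \<mu>" "x = \<mu> *\<^sub>R hat z"
proof -
  have eq: "lA x * lC x = lv x \<bullet> lv x" using assms(1) by (simp add: lf_def)
  show thesis
  proof (cases "lA x = 0")
    case True
    then show thesis
      using eq assms(2) by (intro that[of "lC x" None]) (auto simp: prod_eq_iff)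
  next
    case False
    have "0 \<le> lA x * lC x" using eq by simp
    then have "0 < lA x" using False assms(2)
      by (metis add_neg_nonpos add_pos_nonneg linorder_neqE_linordered_idom linorder_not_less
          zero_le_mult_iff less_le_not_le order_less_imp_le)
    then show thesis
      using eq by (intro that[of "lA x" "Some ((1 / lA x) *\<^sub>R lv x)"]) (auto simp: prod_eq_iff field_simps)
  qed
qed

lemma hat_ray_eqD:
  assumes "\<mu> *\<^sub>R hat z = \<nu> *\<^sub>R hat w" "0 < \<mu>"
  shows "z = w \<and> \<mu> = \<nu>"
  using assms by (cases z; cases w) auto

text \<open>The linear extension of \<open>hat (Some z)\<close> \<mapsto>
  \<open>hat (Some (z + p))\<close>, read off from |z + p|^2 = |z|^2 + 2 z.p + |p|^2.\<close>

definition l_trans :: "'a::euclidean_space \<Rightarrow> 'a lspace \<Rightarrow> 'a lspace" where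
  "l_trans p x = (lA x, lv x + lA x *\<^sub>R p, lC x + 2 * (lv x \<bullet> p) + lA x * (p \<bullet> p))"

text \<open>Inversion in the unit sphere: (1, z, |z|^2) and (|z|^2, z, 1) span the rays of z and of
  z / |z|^2.\<close>

definition l_invert :: "'a::euclidean_space lspace \<Rightarrow> 'a lspace" where
  "l_invert x = (lC x, lv x, lA x)"

definition l_rot :: "('a \<Rightarrow> 'a) \<Rightarrow> 'a::euclidean_space lspace \<Rightarrow> 'a lspace" where
  "l_rot f x = (lA x, f (lv x), lC x)"

text \<open>\<open>V\<close> is the ambient space, \<open>L\<close> an integral lattice in it, \<open>e\<close> a unit normal vector of a
  hyperplane whose lattice points have covering radius at most 1, and \<open>h\<close> the distance of
  consecutive parallel lattice hyperplanes.\<close>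

locale slab =
  fixes V L :: "'a::euclidean_space set" and e t :: 'a and h :: real
  assumes subspace_V: "subspace V"
    and L_sub: "L \<subseteq> V"
    and L_diff: "\<And>x y. x \<in> L \<Longrightarrow> y \<in> L \<Longrightarrow> x - y \<in> L"
    and L_int: "\<And>x. x \<in> L \<Longrightarrow> x \<bullet> x \<in> \<int>"
    and e_V: "e \<in> V" and norm_e: "norm e = 1"
    and t_L: "t \<in> L" and t_ht: "e \<bullet> t = h" and h_gt: "h > 10"
    and L_ht: "\<And>x. x \<in> L \<Longrightarrow> \<exists>k::int. e \<bullet> x = of_int k * h"
    and cover: "\<And>x. x \<in> V \<Longrightarrow> e \<bullet> x = 0 \<Longrightarrow> \<exists>p\<in>L. e \<bullet> p = 0 \<and> norm (x - p) < 1"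
begin

lemma L_0: "0 \<in> L" using L_diff[OF t_L t_L] by simp
lemma L_uminus: "x \<in> L \<Longrightarrow> - x \<in> L" using L_diff[OF L_0, of x] by simp
lemma L_add: "x \<in> L \<Longrightarrow> y \<in> L \<Longrightarrow> x + y \<in> L" using L_diff[of x "- y"] L_uminus by simp

lemma L_scale_int: "x \<in> L \<Longrightarrow> of_int k *\<^sub>R x \<in> L"
proof (induction k rule: int_induct[where k = 0])
  case base
  then show ?case by (simp add: L_0)
next
  case (step1 i)
  then show ?case using L_add[of "of_int i *\<^sub>R x" x] by (simp add: algebra_simps)
next
  case (step2 i)
  then show ?case using L_diff[of "of_int i *\<^sub>R x" x] by (simp add: algebra_simps)
qed

lemma L_inner: "x \<in> L \<Longrightarrow> y \<in> L \<Longrightarrow> 2 * (x \<bullet> y) \<in> \<int>"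
proof -
  assume xy: "x \<in> L" "y \<in> L"
  have "2 * (x \<bullet> y) = (x + y) \<bullet> (x + y) - x \<bullet> x - y \<bullet> y"
    by (simp add: algebra_simps inner_commute)
  then show ?thesis using L_int L_add xy by (metis Ints_diff)
qed

section \<open>The isometries of the light cone that preserve the lattice\<close>

definition Lat :: "'a lspace set" where "Lat = {x. lA x \<in> \<int> \<and> lv x \<in> L \<and> lC x \<in> \<int>}"

definition WV :: "'a lspace set" where "WV = {x. lv x \<in> V}"

text \<open>The last clause selects the isometries that keep the forward half of the light cone, so
  that rays of points go to rays of points with positive factors. Equality of images, rather than
  inclusion, makes inverses preserve \<open>Lat\<close> and \<open>WV\<close> as well.\<close>

definition LG :: "('a lspace \<Rightarrow> 'a lspace) set" where
  "LG = {T. linear T \<and> bij T \<and> (\<forall>x y. lf (T x) (T y) = lf x y) \<and> T ` Lat = Lat \<and> T ` WV = WV \<and>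
     (\<forall>x. lf x x = 0 \<and> 0 < lA x + lC x \<longrightarrow> 0 < lA (T x) + lC (T x))}"

lemma LG_D:
  assumes "T \<in> LG"
  shows "linear T" "bij T" "lf (T x) (T y) = lf x y" "T ` Lat = Lat" "T ` WV = WV"
    "lf x x = 0 \<Longrightarrow> 0 < lA x + lC x \<Longrightarrow> 0 < lA (T x) + lC (T x)"
  using assms unfolding LG_def by blast+

text \<open>By linearity and \<open>isotropic_eq_hat\<close>, the forward cone has to be tested only
  on the vectors \<open>hat z\<close>.\<close>

lemma LG_I:
  assumes "linear T" "\<And>x. T (S x) = x" "\<And>x. S (T x) = x" "\<And>x y. lf (T x) (T y) = lf x y"
    "\<And>x. x \<in> Lat \<Longrightarrow> T x \<in> Lat" "\<And>x. x \<in> Lat \<Longrightarrow> S x \<in> Lat"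
    "\<And>x. x \<in> WV \<Longrightarrow> T x \<in> WV" "\<And>x. x \<in> WV \<Longrightarrow> S x \<in> WV"
    "\<And>z. 0 < lA (T (hat z)) + lC (T (hat z))"
  shows "T \<in> LG"
proof -
  have "bij T" by (rule o_bij[of S]) (auto simp: assms)
  moreover have img: "T ` M = M" if "\<And>x. x \<in> M \<Longrightarrow> T x \<in> M" "\<And>x. x \<in> M \<Longrightarrow> S x \<in> M" for M
  proof
    show "M \<subseteq> T ` M"
    proof
      fix x assume "x \<in> M"
      then show "x \<in> T ` M" using that(2) assms(2)[of x, symmetric] by (rule_tac image_eqI[of _ _ "S x"]) auto
    qed
  qed (use that(1) in blast)
  have "T ` Lat = Lat" "T ` WV = WV" by (rule img; fact assms)+
  moreover have "0 < lA (T x) + lC (T x)" if iso: "lf x x = 0" "0 < lA x + lC x" for x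
  proof -
    obtain \<mu> z where "0 < \<mu>" "x = \<mu> *\<^sub>R hat z" using isotropic_eq_hat[OF iso] by blast
    then show ?thesis using assms(9)[of z] by (simp add: linear_scale[OF assms(1)] flip: distrib_left del: hat_simps)
  qed
  ultimately show ?thesis using assms(1,4) unfolding LG_def by blast
qed

lemma LG_group: "map_group LG"
proof -
  have 1: "id \<in> LG" using linear_id by (simp add: LG_def)
  have 2: "f \<circ> g \<in> LG" if "f \<in> LG" "g \<in> LG" for f g
  proof -
    have "(f \<circ> g) ` Lat = Lat" "(f \<circ> g) ` WV = WV"
      using LG_D(4,5)[OF that(1)] LG_D(4,5)[OF that(2)] by (metis image_comp)+
    then show ?thesis
      using linear_compose[OF LG_D(1)[OF that(2)] LG_D(1)[OF that(1)]]
        bij_comp[OF LG_D(2)[OF that(2)] LG_D(2)[OF that(1)]]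
        LG_D(3,6)[OF that(1)] LG_D(3,6)[OF that(2)]
      unfolding LG_def mem_Collect_eq o_apply by presburger
  qed
  have 3: "bij f \<and> finv f \<in> LG" if "f \<in> LG" for f
  proof -
    note f = LG_D[OF that]
    have inv1: "f (finv f x) = x" "finv f (f x) = x" for x
      using f(2) by (simp_all add: bij_is_surj surj_f_inv_f bij_is_inj)
    have lin: "linear (finv f)"
      using f(1,2) inv1 by (metis bij_is_inj linear_injective_left_inverse linear_iff bij_is_surj
          linear_inj_imp_surj inv_equality inj_linear_imp_inv_linear)
    have lf: "lf (finv f x) (finv f y) = lf x y" for x y
      using f(3)[of "finv f x" "finv f y"] inv1 by simp
    \<comment> \<open>If the preimage y were not forward, - y would be, and \<open>f\<close> would
      send it to the backward vector \<open>- hat z\<close>. The borderline case A + C = 0 is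
      excluded first: for an isotropic vector it means |v|^2 + A^2 = 0.\<close>
    have "0 < lA (finv f (hat z)) + lC (finv f (hat z))" for z
    proof (rule ccontr)
      let ?y = "finv f (hat z)"
      assume neg: "\<not> 0 < lA ?y + lC ?y"
      have iso: "lf ?y ?y = 0" using lf lf_hat_hat by metis
      have "lA ?y + lC ?y \<noteq> 0"
      proof
        assume "lA ?y + lC ?y = 0"
        then have C: "lC ?y = - lA ?y" by simp
        have "lv ?y \<bullet> lv ?y + lA ?y * lA ?y = 0" using iso unfolding lf_def C by simp
        then have "lv ?y \<bullet> lv ?y = 0 \<and> lA ?y * lA ?y = 0"
          by (smt (verit) inner_ge_zero zero_le_square)
        then have "?y = 0" using C by (simp add: prod_eq_iff)
        then have "hat z = 0" using inv1(1)[of "hat z"] linear_0[OF f(1)] by simp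
        then show False by (cases z) (auto simp: zero_prod_def)
      qed
      then have "0 < lA (- ?y) + lC (- ?y)" using neg by simp
      moreover have "lf (- ?y) (- ?y) = 0" using iso by (simp add: lf_def mult.commute)
      ultimately have "0 < lA (f (- ?y)) + lC (f (- ?y))" using f(6) by blast
      then show False using hat_pos[of z] by (simp add: linear_neg[OF f(1)] inv1)
    qed
    then have "finv f \<in> LG"
    proof (intro LG_I[of _ f])
      show "finv f x \<in> Lat" "f x \<in> Lat" if "x \<in> Lat" for x using that inv1 f(4) by (metis imageE imageI)+
      show "finv f x \<in> WV" "f x \<in> WV" if "x \<in> WV" for x using that inv1 f(5) by (metis imageE imageI)+
    qed (use lin lf inv1 in auto)
    then show ?thesis using f by simp
  qed
  show ?thesis using 1 2 3 by (auto simp: map_group_def)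
qed

lemma LG_comp: "S \<in> LG \<Longrightarrow> T \<in> LG \<Longrightarrow> S \<circ> T \<in> LG"
  using LG_group unfolding map_group_def by blast

lemma e_inf_Lat: "e_inf \<in> Lat" by (simp add: Lat_def L_0)
lemma e_inf_WV: "e_inf \<in> WV" using subspace_0[OF subspace_V] by (simp add: WV_def)
lemma hat_WV: "z \<in> V \<Longrightarrow> hat (Some z) \<in> WV" by (simp add: WV_def)

lemma LG_finv: "T \<in> LG \<Longrightarrow> finv T \<in> LG" "T \<in> LG \<Longrightarrow> finv T (T x) = x" "T \<in> LG \<Longrightarrow> T (finv T x) = x"
  using LG_group LG_D(2)[of T]
  by (simp_all add: map_group_def bij_is_surj surj_f_inv_f bij_is_inj)

lemma LG_hat:
  assumes "T \<in> LG"
  obtains \<mu> z' where "0 < \<mu>" "T (hat z) = \<mu> *\<^sub>R hat z'"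
proof -
  have "lf (T (hat z)) (T (hat z)) = 0" using LG_D(3)[OF assms] lf_hat_hat by metis
  moreover have "0 < lA (T (hat z)) + lC (T (hat z))"
    using LG_D(6)[OF assms] lf_hat_hat hat_pos by blast
  ultimately show thesis by (rule isotropic_eq_hat) (rule that)
qed

lemma LG_WV: "T \<in> LG \<Longrightarrow> x \<in> WV \<Longrightarrow> T x \<in> WV" using LG_D(5) by blast

lemma scaled_hat_WV:
  assumes "0 < \<mu>" "\<mu> *\<^sub>R hat (Some z) \<in> WV" shows "z \<in> V"
proof -
  have "\<mu> *\<^sub>R z \<in> V" using assms(2) by (simp add: WV_def)
  then have "(1 / \<mu>) *\<^sub>R \<mu> *\<^sub>R z \<in> V" by (rule subspace_scale[OF subspace_V])
  then show ?thesis using assms(1) by simp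
qed

text \<open>The image of \<open>e_inf\<close> is a lattice vector on the cone. On the ray of
  infinity the factor and its inverse are both integers, hence 1; elsewhere the factor is the first
  coordinate, a positive integer. It is the inverse squared radius of the isometric sphere centred
  at \<open>p\<close>.\<close>

lemma LG_move_inf:
  assumes T: "T \<in> LG" and ne: "T e_inf \<noteq> e_inf"
  obtains c p where "1 \<le> c" "p \<in> V" "T e_inf = c *\<^sub>R hat (Some p)"
proof -
  obtain \<mu> z where \<mu>: "0 < \<mu>" and z: "T e_inf = \<mu> *\<^sub>R hat z"
    using LG_hat[OF T, of None] by auto
  have lat: "\<mu> *\<^sub>R hat z \<in> Lat" using LG_D(4)[OF T] e_inf_Lat z by (metis imageI)
  show thesis
  proof (cases z)
    case None
    have m: "\<mu> \<in> \<int>" using lat None by (simp add: Lat_def)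
    have "finv T e_inf = (1 / \<mu>) *\<^sub>R finv T (\<mu> *\<^sub>R e_inf)"
      using \<mu> LG_D(1)[OF LG_finv(1)[OF T]] by (simp add: linear_scale del: scaleR_Pair)
    also have "finv T (\<mu> *\<^sub>R e_inf) = e_inf" using z None LG_finv(2)[OF T, of e_inf] by simp
    finally have "(1 / \<mu>) *\<^sub>R e_inf \<in> Lat"
      using LG_D(4)[OF LG_finv(1)[OF T]] e_inf_Lat by (metis imageI)
    then have m': "1 / \<mu> \<in> \<int>" by (simp add: Lat_def)
    obtain k l :: int where kl: "\<mu> = of_int k" "1 / \<mu> = of_int l" using m m' by (auto elim!: Ints_cases)
    then have "of_int (k * l) = (1::real)" using \<mu> by (metis of_int_mult nonzero_eq_divide_eq less_irrefl mult.commute)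
    then have "k * l = 1" by (metis of_int_eq_1_iff)
    then have "k = 1" using \<mu> kl(1) by (metis of_int_0_less_iff pos_zmult_eq_1_iff)
    then show thesis using ne z None kl by simp
  next
    case (Some p)
    have "\<mu> \<in> \<int>" using lat Some by (simp add: Lat_def)
    then have "1 \<le> \<mu>" using \<mu> by (auto elim!: Ints_cases)
    moreover have "p \<in> V"
      using scaled_hat_WV[OF \<mu>, of p] LG_WV[OF T e_inf_WV] z Some by simp
    ultimately show thesis using that z Some by blast
  qed
qed

text \<open>The squared radius of the isometric sphere of \<open>T\<close> is the inverse of an integer, so the
  part of space at height at least 1 is contracted towards the invariant hyperplane.\<close>

lemma LG_contract:
  fixes fl :: "'a lspace \<Rightarrow> real"
  assumes T: "T \<in> LG" and ne: "T e_inf \<noteq> e_inf"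
    and fl: "\<And>x. fl x = \<sigma> * (e \<bullet> lv x) + k * lA x" and \<sigma>: "\<bar>\<sigma>\<bar> = 1"
    and inv: "\<And>x. x \<in> WV \<Longrightarrow> fl (T x) = s * fl x" and s: "\<bar>s\<bar> = 1"
  obtains c q where "0 < c" "q \<in> V" "fl (hat (Some q)) = 0" "T e_inf = c *\<^sub>R hat (Some q)"
    "\<And>z. z \<in> V \<Longrightarrow> 1 \<le> \<bar>fl (hat (Some z))\<bar> \<Longrightarrow> \<exists>\<mu>>0. \<exists>w\<in>V. T (hat (Some z)) = \<mu> *\<^sub>R hat (Some w) \<and>
       fl (hat (Some z)) * s = \<mu> * fl (hat (Some w)) \<and> \<bar>fl (hat (Some w))\<bar> \<le> 1 \<and> norm (w - q) \<le> 1"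
proof -
  have fl_lin: "fl (\<mu> *\<^sub>R x) = \<mu> * fl x" for \<mu> x by (simp add: fl algebra_simps)
  have fl_inf: "fl e_inf = 0" by (simp add: fl)
  obtain c q where c: "1 \<le> c" and q: "q \<in> V" "T e_inf = c *\<^sub>R hat (Some q)"
    using LG_move_inf[OF T ne] by blast
  have flq: "fl (hat (Some q)) = 0"
    using inv[OF e_inf_WV] q(2) c by (simp add: fl_lin fl_inf del: hat_simps)
  have ne': "finv T e_inf \<noteq> e_inf" using ne LG_finv(3)[OF T, of e_inf] by metis
  obtain c' p where c': "1 \<le> c'" and p: "p \<in> V" "finv T e_inf = c' *\<^sub>R hat (Some p)"
    using LG_move_inf[OF LG_finv(1)[OF T] ne'] by blast
  have "s * fl (finv T e_inf) = fl e_inf"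
    using inv[OF LG_WV[OF LG_finv(1)[OF T] e_inf_WV]] LG_finv(3)[OF T] by metis
  then have flp: "fl (hat (Some p)) = 0" using s c' p(2) by (auto simp: fl_lin fl_inf simp del: hat_simps)
  have "\<exists>\<mu>>0. \<exists>w\<in>V. T (hat (Some z)) = \<mu> *\<^sub>R hat (Some w) \<and>
       fl (hat (Some z)) * s = \<mu> * fl (hat (Some w)) \<and> \<bar>fl (hat (Some w))\<bar> \<le> 1 \<and> norm (w - q) \<le> 1"
    if z: "z \<in> V" and big: "1 \<le> \<bar>fl (hat (Some z))\<bar>" for z
  proof -
    let ?z = "hat (Some z)"
    obtain \<mu> z' where \<mu>: "0 < \<mu>" and z': "T ?z = \<mu> *\<^sub>R hat z'" using LG_hat[OF T] by metis
    \<comment> \<open>The first coordinate is the pairing with \<open>e_inf\<close>; moved back by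
      the isometry, it becomes \<open>c'\<close> times the squared distance to the pole
      \<open>p\<close>.\<close>
    have "lA (T ?z) = lf (T ?z) (T (finv T e_inf))" by (simp add: LG_finv(3)[OF T] lf_e_inf)
    also have "\<dots> = c' * lf ?z (hat (Some p))"
      using lf_scaleR[of 1 ?z c' "hat (Some p)"] by (simp add: LG_D(3)[OF T] p(2) del: hat_simps)
    also have "lf ?z (hat (Some p)) = (norm (z - p))\<^sup>2" by (simp add: lf_hat_Some)
    finally have A: "lA (T ?z) = c' * (norm (z - p))\<^sup>2" .
    \<comment> \<open>The pole has height 0, so the height of \<open>z\<close> is at most its
      distance from the pole.\<close>
    have "fl ?z = fl ?z - fl (hat (Some p))" by (simp only: flp diff_zero)
    also have "\<dots> = \<sigma> * (e \<bullet> (z - p))" by (simp add: fl algebra_simps)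
    finally have "\<bar>fl ?z\<bar> = \<bar>e \<bullet> (z - p)\<bar>" using \<sigma> by (simp add: abs_mult)
    also have "\<dots> \<le> norm e * norm (z - p)" by (rule Cauchy_Schwarz_ineq2)
    finally have d: "\<bar>fl ?z\<bar> \<le> norm (z - p)" using norm_e by simp
    have d2: "(fl ?z)\<^sup>2 \<le> (norm (z - p))\<^sup>2" using power_mono[OF d, of 2] by simp
    have d3: "\<bar>fl ?z\<bar> \<le> (fl ?z)\<^sup>2"
      using big mult_left_mono[of 1 "\<bar>fl ?z\<bar>" "\<bar>fl ?z\<bar>"] by (simp add: power2_eq_square flip: abs_mult)
    \<comment> \<open>The map divides heights by the first coordinate, which is at least the squared
      height and hence, at height at least 1, at least the height itself.\<close>
    have A_ge: "\<bar>fl ?z\<bar> \<le> lA (T ?z)"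
      using A d2 d3 c' mult_right_mono[of 1 c' "(norm (z - p))\<^sup>2"] by simp
    then have "lA (T ?z) > 0" using big by linarith
    then obtain w where w: "z' = Some w" using z' by (cases z') auto
    have \<mu>_eq: "\<mu> = lA (T ?z)" using z' w by simp
    have wV: "w \<in> V" using scaled_hat_WV[OF \<mu>, of w] LG_WV[OF T hat_WV[OF z]] z' w by simp
    have e1: "fl ?z * s = \<mu> * fl (hat (Some w))"
      using inv[OF hat_WV[OF z]] z' w by (simp add: fl_lin mult.commute del: hat_simps)
    then have "\<bar>fl ?z\<bar> = \<mu> * \<bar>fl (hat (Some w))\<bar>" using s \<mu> by (metis abs_mult abs_of_pos mult.right_neutral)
    then have "\<mu> * \<bar>fl (hat (Some w))\<bar> \<le> \<mu> * 1" using A_ge \<mu>_eq by simp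
    then have e2: "\<bar>fl (hat (Some w))\<bar> \<le> 1" using \<mu> by simp
    \<comment> \<open>The pairing of \<open>hat (Some z)\<close> with \<open>e_inf\<close> is 1;
      evaluating it after \<open>T\<close> bounds the distance of \<open>w\<close> from the image
      \<open>q\<close> of infinity.\<close>
    have "1 = lf (T ?z) (T e_inf)" by (simp add: LG_D(3)[OF T] lf_e_inf)
    also have "\<dots> = \<mu> * c * (norm (w - q))\<^sup>2"
      using lf_scaleR[of \<mu> "hat (Some w)" c "hat (Some q)"] z' w q(2) by (simp add: lf_hat_Some)
    finally have "1 = \<mu> * c * (norm (w - q))\<^sup>2" .
    moreover have "1 \<le> \<mu> * c" using A_ge big \<mu>_eq c mult_mono[of 1 \<mu> 1 c] by simp
    then have "1 * (norm (w - q))\<^sup>2 \<le> \<mu> * c * (norm (w - q))\<^sup>2" by (intro mult_right_mono) auto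
    ultimately have "(norm (w - q))\<^sup>2 \<le> 1\<^sup>2" by simp
    then have e3: "norm (w - q) \<le> 1" by (rule power2_le_imp_le) simp
    show ?thesis using \<mu> z' w wV e1 e2 e3 by blast
  qed
  then show thesis using that[of c q] c q flq by auto
qed

subsection \<open>The stabilizer of the point at infinity\<close>

text \<open>Suppose \<open>F\<close> tilts \<open>x\<close> out of the plane. Scaled so that its
  image has height \<open>h / 2\<close>, the vector lies within 1 of a lattice point of the plane,
  whose image has a height that is a multiple of \<open>h\<close>. These heights differ by at least
  \<open>h / 2\<close>, yet \<open>F\<close> preserves distances.\<close>

lemma orthogonal_height_0:
  assumes F: "linear F" "\<And>x. norm (F x) = norm x" "\<And>x. x \<in> L \<Longrightarrow> F x \<in> L"
    and x: "x \<in> V" "e \<bullet> x = 0"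
  shows "e \<bullet> F x = 0"
proof (rule ccontr)
  assume nz: "e \<bullet> F x \<noteq> 0"
  define y where "y = (h / 2 / (e \<bullet> F x)) *\<^sub>R x"
  have y: "y \<in> V" "e \<bullet> y = 0" "e \<bullet> F y = h / 2"
    using nz x subspace_scale[OF subspace_V] by (auto simp: y_def linear_scale[OF F(1)])
  obtain p where p: "p \<in> L" "norm (y - p) < 1" using cover[OF y(1,2)] by blast
  obtain k :: int where k: "e \<bullet> F p = of_int k * h" using L_ht F(3) p(1) by blast
  have "\<bar>e \<bullet> F (y - p)\<bar> \<le> norm e * norm (F (y - p))" by (rule Cauchy_Schwarz_ineq2)
  also have "\<dots> < 1" using norm_e F(2) p(2) by simp
  finally have "\<bar>h / 2 - of_int k * h\<bar> < 1"
    by (simp add: linear_diff[OF F(1)] inner_diff_right y(3) k)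
  moreover have "\<bar>h / 2 - of_int k * h\<bar> = h * \<bar>1 / 2 - of_int k\<bar>"
  proof -
    have "h / 2 - of_int k * h = h * (1 / 2 - of_int k)" by (simp add: algebra_simps)
    then show ?thesis using h_gt by (simp add: abs_mult)
  qed
  moreover have "\<bar>1 / 2 - of_int k :: real\<bar> \<ge> 1 / 2"
  proof (cases "k \<le> 0")
    case True
    then have "of_int k \<le> (0::real)" by simp
    then show ?thesis by linarith
  next
    case False
    then have "(1::real) \<le> of_int k" by simp
    then show ?thesis by linarith
  qed
  moreover have "h * (1 / 2) \<le> h * \<bar>1 / 2 - of_int k\<bar>"
    using calculation(3) h_gt by (intro mult_left_mono) auto
  ultimately show False using h_gt by linarith
qed

text \<open>An isometry fixing \<open>e_inf\<close> preserves the first coordinate, so it acts as an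
  affine map with an orthogonal linear part \<open>F\<close>, which keeps the plane by
  \<open>orthogonal_height_0\<close>. The lattice vector \<open>t\<close> makes \<epsilon> an
  integer, orthogonality bounds it by 1, and surjectivity on \<open>WV\<close> excludes 0. The image
  of the origin contributes \<open>k\<close>.\<close>

lemma LG_fix_inf:
  assumes T: "T \<in> LG" and T_inf: "T e_inf = e_inf"
  obtains \<epsilon> and k :: int where "\<bar>\<epsilon>\<bar> = 1"
    "\<And>x. x \<in> WV \<Longrightarrow> e \<bullet> lv (T x) = \<epsilon> * (e \<bullet> lv x) + of_int k * h * lA x"
proof -
  note lin = LG_D(1)[OF T]
  have lA_T: "lA (T x) = lA x" for x using LG_D(3)[OF T, of x e_inf] by (simp add: T_inf lf_e_inf)
  define F where "F v = lv (T (0, v, 0))" for v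
  have F_lin: "linear F"
  proof (rule linearI)
    fix b1 b2 :: 'a and r :: real
    have "T (0, b1 + b2, 0) = T (0, b1, 0) + T (0, b2, 0)" using linear_add[OF lin, symmetric] by simp
    then show "F (b1 + b2) = F b1 + F b2" by (simp add: F_def)
    have "T (0, r *\<^sub>R b1, 0) = r *\<^sub>R T (0, b1, 0)" using linear_scale[OF lin, symmetric] by simp
    then show "F (r *\<^sub>R b1) = r *\<^sub>R F b1" by (simp add: F_def)
  qed
  have F_norm: "norm (F v) = norm v" for v
    using LG_D(3)[OF T, of "(0, v, 0)" "(0, v, 0)"] lA_T[of "(0, v, 0)"]
    by (simp add: lf_def F_def norm_eq_sqrt_inner)
  have F_L: "F v \<in> L" if "v \<in> L" for v
  proof -
    have "(0, v, 0) \<in> Lat" using that by (simp add: Lat_def)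
    then have "T (0, v, 0) \<in> Lat" using LG_D(4)[OF T] by blast
    then show ?thesis by (simp add: Lat_def F_def)
  qed
  define \<epsilon> where "\<epsilon> = e \<bullet> F e"
  have ht_F: "e \<bullet> F v = \<epsilon> * (e \<bullet> v)" if "v \<in> V" for v
  proof -
    have "v - (e \<bullet> v) *\<^sub>R e \<in> V"
      by (intro subspace_diff[OF subspace_V] subspace_scale[OF subspace_V] that e_V)
    moreover have "e \<bullet> (v - (e \<bullet> v) *\<^sub>R e) = 0"
      using norm_e by (simp add: inner_diff_right norm_eq_1)
    ultimately have "e \<bullet> F (v - (e \<bullet> v) *\<^sub>R e) = 0"
      using orthogonal_height_0[OF F_lin F_norm] F_L by blast
    then show ?thesis
      by (simp add: linear_diff[OF F_lin] linear_scale[OF F_lin] inner_diff_right \<epsilon>_def)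
  qed
  have "\<bar>\<epsilon>\<bar> \<le> norm e * norm (F e)" unfolding \<epsilon>_def by (rule Cauchy_Schwarz_ineq2)
  then have le1: "\<bar>\<epsilon>\<bar> \<le> 1" using F_norm norm_e by simp
  have "\<epsilon> * h = e \<bullet> F t" using ht_F[of t] t_L L_sub t_ht by auto
  then obtain l :: int where "\<epsilon> * h = of_int l * h" using L_ht F_L t_L by metis
  then have l: "\<epsilon> = of_int l" using h_gt by simp
  have "\<epsilon> \<noteq> 0"
  proof
    assume "\<epsilon> = 0"
    have "(0, e, 0) \<in> T ` WV" using LG_D(5)[OF T] e_V by (simp add: WV_def)
    then obtain y where y: "y \<in> WV" "T y = (0, e, 0)" by auto
    have "lA y = 0" using lA_T[of y] y by simp
    then have "y = (0, lv y, 0) + lC y *\<^sub>R e_inf" by (simp add: prod_eq_iff)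
    then have "T y = T (0, lv y, 0) + lC y *\<^sub>R e_inf"
      using T_inf linear_add[OF lin] linear_scale[OF lin] by metis
    then have "F (lv y) = e" using y(2) by (simp add: F_def prod_eq_iff)
    then have "e \<bullet> e = 0" using ht_F[of "lv y"] y(1) \<open>\<epsilon> = 0\<close> by (simp add: WV_def)
    then show False using norm_e by auto
  qed
  moreover have "\<bar>l\<bar> \<le> 1" using le1 l by linarith
  ultimately have "\<bar>l\<bar> = 1" using l by auto
  then have eps: "\<bar>\<epsilon>\<bar> = 1" using l by (simp flip: of_int_abs)
  have "(1, 0, 0) \<in> Lat" using L_0 by (simp add: Lat_def)
  then have "T (1, 0, 0) \<in> Lat" using LG_D(4)[OF T] by blast
  then obtain k :: int where k: "e \<bullet> lv (T (1, 0, 0)) = of_int k * h" using L_ht by (auto simp: Lat_def)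
  have "e \<bullet> lv (T x) = \<epsilon> * (e \<bullet> lv x) + of_int k * h * lA x" if "x \<in> WV" for x
  proof -
    have "x = lA x *\<^sub>R (1, 0, 0) + (0, lv x, 0) + lC x *\<^sub>R e_inf" by (simp add: prod_eq_iff)
    then have "T x = lA x *\<^sub>R T (1, 0, 0) + T (0, lv x, 0) + lC x *\<^sub>R e_inf"
      using T_inf linear_add[OF lin] linear_scale[OF lin] by metis
    then have "lv (T x) = lA x *\<^sub>R lv (T (1, 0, 0)) + F (lv x)" by (simp add: F_def)
    then show ?thesis using ht_F[of "lv x"] that k by (simp add: inner_add_right WV_def)
  qed
  then show thesis using that eps by blast
qed

subsection \<open>The orbit of infinity avoids the middle of the slab\<close>

text \<open>\<open>True\<close> stands for the stabilizer of the plane of height 0, whose two sides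
  may be exchanged, hence the sign; \<open>False\<close> stands for the stabilizer of
  infinity.\<close>

definition refl_grp :: "bool \<Rightarrow> ('a lspace \<Rightarrow> 'a lspace) set" where
  "refl_grp i = (if i then {T\<in>LG. \<exists>s. \<bar>s\<bar> = 1 \<and> (\<forall>x\<in>WV. e \<bullet> lv (T x) = s * (e \<bullet> lv x))}
     else {T\<in>LG. T e_inf = e_inf})"

lemma map_group_refl_grp: "map_group (refl_grp i)"
proof (cases i)
  case True
  have "finv T \<in> refl_grp True" if "T \<in> refl_grp True" for T
  proof -
    obtain s where T: "T \<in> LG" and s: "\<bar>s\<bar> = 1" "\<And>x. x \<in> WV \<Longrightarrow> e \<bullet> lv (T x) = s * (e \<bullet> lv x)"
      using \<open>T \<in> refl_grp True\<close> by (auto simp: refl_grp_def)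
    have ss: "s * s = 1" using s(1) by (metis abs_mult_self_eq mult.right_neutral)
    have "e \<bullet> lv (finv T x) = s * (e \<bullet> lv x)" if "x \<in> WV" for x
    proof -
      have "e \<bullet> lv x = s * (e \<bullet> lv (finv T x))"
        using s(2)[OF LG_WV[OF LG_finv(1)[OF T] that]] LG_finv(3)[OF T] by simp
      then show ?thesis using ss by (simp add: mult.assoc[symmetric])
    qed
    then show ?thesis using LG_finv(1)[OF T] s(1) by (auto simp: refl_grp_def)
  qed
  moreover have "S \<circ> T \<in> refl_grp True" if ST: "S \<in> refl_grp True" "T \<in> refl_grp True" for S T
  proof -
    obtain s where S: "S \<in> LG" and s: "\<bar>s\<bar> = 1" "\<And>x. x \<in> WV \<Longrightarrow> e \<bullet> lv (S x) = s * (e \<bullet> lv x)"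
      using ST(1) by (auto simp: refl_grp_def)
    obtain r where T: "T \<in> LG" and r: "\<bar>r\<bar> = 1" "\<And>x. x \<in> WV \<Longrightarrow> e \<bullet> lv (T x) = r * (e \<bullet> lv x)"
      using ST(2) by (auto simp: refl_grp_def)
    have "e \<bullet> lv ((S \<circ> T) x) = (s * r) * (e \<bullet> lv x)" if "x \<in> WV" for x
      using s(2)[OF LG_WV[OF T that]] r(2)[OF that] by simp
    moreover have "\<bar>s * r\<bar> = 1" using s r by (simp add: abs_mult)
    moreover have "S \<circ> T \<in> LG" using S T LG_group by (simp add: map_group_def)
    ultimately show ?thesis unfolding refl_grp_def if_True by blast
  qed
  moreover have "id \<in> refl_grp True"
    using LG_group by (auto simp: refl_grp_def map_group_def intro: exI[of _ 1])
  ultimately show ?thesis using True LG_D(2) by (auto simp: map_group_def refl_grp_def)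
next
  case False
  have "finv T e_inf = e_inf" if "T \<in> LG" "T e_inf = e_inf" for T
    using LG_finv(2)[OF that(1), of e_inf] that by simp
  then show ?thesis using False LG_group LG_finv(1) LG_D(2)
    by (simp add: map_group_def refl_grp_def)
qed

text \<open>Ping-pong between the strip of half-width 1 about the plane of height 0 and the union of
  the same strips about the other lattice planes. A letter that moves infinity contracts the second
  set into the first; a letter that fixes infinity but not the plane moves the first strip to
  another one. A single letter fixing infinity accounts for the extra alternative.\<close>

lemma alt_word_refl_grp_e_inf:
  assumes "alt_word refl_grp i w"
  shows "if i then \<exists>\<mu>>0. \<exists>z\<in>V. w e_inf = \<mu> *\<^sub>R hat (Some z) \<and> \<bar>e \<bullet> z\<bar> \<le> 1
    else w e_inf = e_inf \<or>
      (\<exists>\<mu>>0. \<exists>z\<in>V. \<exists>k::int. k \<noteq> 0 \<and> w e_inf = \<mu> *\<^sub>R hat (Some z) \<and> \<bar>e \<bullet> z - of_int k * h\<bar> \<le> 1)"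
proof -
  have A: "\<exists>q\<in>V. \<exists>c>0. a e_inf = c *\<^sub>R hat (Some q) \<and> e \<bullet> q = 0 \<and>
      (\<forall>z\<in>V. 1 \<le> \<bar>e \<bullet> z\<bar> \<longrightarrow> (\<exists>\<mu>>0. \<exists>w\<in>V. a (hat (Some z)) = \<mu> *\<^sub>R hat (Some w) \<and> \<bar>e \<bullet> w\<bar> \<le> 1))"
    if a: "a \<in> refl_grp True - refl_grp False" for a
  proof -
    obtain s where T: "a \<in> LG" "a e_inf \<noteq> e_inf" and
      s: "\<bar>s\<bar> = 1" "\<And>x. x \<in> WV \<Longrightarrow> e \<bullet> lv (a x) = s * (e \<bullet> lv x)"
      using a by (auto simp: refl_grp_def)
    show ?thesis
      by (rule LG_contract[where fl = "\<lambda>x. e \<bullet> lv x" and \<sigma> = 1 and k = 0, OF T _ _ s(2) s(1)])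
        (simp_all, blast)
  qed
  have B: "\<exists>w\<in>V. b (hat (Some z)) = hat (Some w) \<and> (\<exists>k::int. k \<noteq> 0 \<and> \<bar>e \<bullet> w - of_int k * h\<bar> \<le> 1)"
    if b: "b \<in> refl_grp False - refl_grp True" and z: "z \<in> V" "\<bar>e \<bullet> z\<bar> \<le> 1" for b z
  proof -
    have T: "b \<in> LG" "b e_inf = e_inf" using b by (auto simp: refl_grp_def)
    obtain \<epsilon> and k :: int where eps: "\<bar>\<epsilon>\<bar> = 1"
      and k: "\<And>x. x \<in> WV \<Longrightarrow> e \<bullet> lv (b x) = \<epsilon> * (e \<bullet> lv x) + of_int k * h * lA x"
      using LG_fix_inf[OF T] by blast
    \<comment> \<open>With \<open>k = 0\<close> the letter would preserve the plane and belong to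
      the other group as well.\<close>
    have "k \<noteq> 0" using b eps k T(1) by (auto simp: refl_grp_def)
    obtain \<mu> z' where \<mu>: "0 < \<mu>" and z': "b (hat (Some z)) = \<mu> *\<^sub>R hat z'" using LG_hat[OF T(1)] by metis
    have lA1: "lA (b (hat (Some z))) = 1"
      using LG_D(3)[OF T(1), of "hat (Some z)" e_inf] by (simp add: T(2) lf_e_inf)
    then obtain w where w: "z' = Some w" using z' by (cases z') auto
    have bz: "b (hat (Some z)) = hat (Some w)" using z' w lA1 by simp
    have "w \<in> V" using scaled_hat_WV[of 1 w] LG_WV[OF T(1) hat_WV[OF z(1)]] bz by simp
    moreover have "e \<bullet> w - of_int k * h = \<epsilon> * (e \<bullet> z)" using k[OF hat_WV[OF z(1)]] bz by simp
    then have "\<bar>e \<bullet> w - of_int k * h\<bar> \<le> 1" using eps z(2) by (simp add: abs_mult)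
    ultimately show ?thesis using bz \<open>k \<noteq> 0\<close> by blast
  qed
  \<comment> \<open>Heights in the strips about the other planes are at least \<open>h - 1\<close>
    in absolute value, so \<open>LG_contract\<close> applies there.\<close>
  have far: "1 \<le> \<bar>x\<bar>" if "k \<noteq> 0" "\<bar>x - of_int k * h\<bar> \<le> 1" for k :: int and x
  proof -
    have "1 \<le> \<bar>k\<bar>" using that(1) by linarith
    then have "1 * h \<le> \<bar>of_int k\<bar> * h" using h_gt by (intro mult_right_mono) (simp_all flip: of_int_abs)
    then have "h \<le> \<bar>of_int k * h\<bar>" using h_gt by (simp add: abs_mult)
    then show ?thesis using that(2) h_gt by linarith
  qed
  from assms show ?thesis
  proof (induction rule: alt_word.induct)
    case (alt_single a i)
    show ?case
    proof (cases i)
      case True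
      then have "a \<in> refl_grp True - refl_grp False" using alt_single by simp
      from A[OF this] obtain q c where "q \<in> V" "0 < c" "a e_inf = c *\<^sub>R hat (Some q)" "e \<bullet> q = 0" by blast
      then have "\<exists>\<mu>>0. \<exists>z\<in>V. a e_inf = \<mu> *\<^sub>R hat (Some z) \<and> \<bar>e \<bullet> z\<bar> \<le> 1" by force
      then show ?thesis using True by argo
    qed (use alt_single in \<open>auto simp: refl_grp_def\<close>)
  next
    case (alt_comp a i w)
    show ?case
    proof (cases i)
      case True
      then have "a \<in> refl_grp True - refl_grp False" using alt_comp by simp
      from A[OF this] obtain q c where q: "q \<in> V" "0 < c" "a e_inf = c *\<^sub>R hat (Some q)" "e \<bullet> q = 0"
        and q': "\<And>z. z \<in> V \<Longrightarrow> 1 \<le> \<bar>e \<bullet> z\<bar> \<Longrightarrow>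
          \<exists>\<mu>>0. \<exists>w\<in>V. a (hat (Some z)) = \<mu> *\<^sub>R hat (Some w) \<and> \<bar>e \<bullet> w\<bar> \<le> 1" by blast
      have lin: "linear a" using alt_comp LG_D(1) True by (auto simp: refl_grp_def)
      consider "w e_inf = e_inf"
        | \<mu> z k where "0 < \<mu>" "z \<in> V" "(k::int) \<noteq> 0" "w e_inf = \<mu> *\<^sub>R hat (Some z)" "\<bar>e \<bullet> z - of_int k * h\<bar> \<le> 1"
        using alt_comp.IH True by auto
      then have "\<exists>\<mu>>0. \<exists>z\<in>V. (a \<circ> w) e_inf = \<mu> *\<^sub>R hat (Some z) \<and> \<bar>e \<bullet> z\<bar> \<le> 1"
      proof cases
        case 1
        then show ?thesis using q by force
      next
        case 2
        obtain \<nu> y where "0 < \<nu>" "y \<in> V" "a (hat (Some z)) = \<nu> *\<^sub>R hat (Some y)" "\<bar>e \<bullet> y\<bar> \<le> 1"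
          using q'[OF 2(2) far[OF 2(3,5)]] by blast
        then show ?thesis using 2
          by (intro exI[of _ "\<mu> * \<nu>"] conjI bexI[of _ y]) (simp_all add: linear_scale[OF lin] del: hat_simps)
      qed
      then show ?thesis using True by argo
    next
      case False
      then have a: "a \<in> refl_grp False - refl_grp True" using alt_comp by simp
      have lin: "linear a" using a LG_D(1) by (auto simp: refl_grp_def)
      obtain \<mu> z where z: "0 < \<mu>" "z \<in> V" "w e_inf = \<mu> *\<^sub>R hat (Some z)" "\<bar>e \<bullet> z\<bar> \<le> 1"
        using alt_comp.IH False by auto
      obtain y k where y: "y \<in> V" "a (hat (Some z)) = hat (Some y)" "(k::int) \<noteq> 0" "\<bar>e \<bullet> y - of_int k * h\<bar> \<le> 1"
        using B[OF a z(2,4)] by blast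
      have "(a \<circ> w) e_inf = \<mu> *\<^sub>R hat (Some y)" using y z by (simp add: linear_scale[OF lin] del: hat_simps)
      then have "\<exists>\<mu>>0. \<exists>z\<in>V. \<exists>k::int. k \<noteq> 0 \<and> (a \<circ> w) e_inf = \<mu> *\<^sub>R hat (Some z) \<and> \<bar>e \<bullet> z - of_int k * h\<bar> \<le> 1"
        using y z by blast
      then show ?thesis using False by argo
    qed
  qed
qed

theorem orbit_e_inf_near_planes:
  assumes "T \<in> map_gen (refl_grp True \<union> refl_grp False)"
  shows "T e_inf = e_inf \<or>
    (\<exists>\<mu>>0. \<exists>z. \<exists>k::int. T e_inf = \<mu> *\<^sub>R hat (Some z) \<and> \<bar>e \<bullet> z - of_int k * h\<bar> \<le> 1)"
proof -
  consider "T \<in> refl_grp False" | "alt_word refl_grp True T" | "alt_word refl_grp False T"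
    using amalgam_normal_form[OF map_group_refl_grp assms] by (metis (full_types) IntD2)
  then show ?thesis
  proof cases
    case 1
    then show ?thesis by (simp add: refl_grp_def)
  next
    case 2
    from alt_word_refl_grp_e_inf[OF this] obtain \<mu> z
      where "0 < \<mu>" "T e_inf = \<mu> *\<^sub>R hat (Some z)" "\<bar>e \<bullet> z\<bar> \<le> 1"
      unfolding if_True by blast
    then show ?thesis by (intro disjI2 exI[of _ \<mu>] exI[of _ z] exI[of _ 0] conjI) simp_all
  next
    case 3
    from alt_word_refl_grp_e_inf[OF this] show ?thesis unfolding if_False by blast
  qed
qed

subsection \<open>The two half-spaces under the group generated by the two reflection groups\<close>

text \<open>Both forms are heights measured from a bounding plane towards the strip between the
  planes at heights 0 and \<open>h\<close>. On points they add up to \<open>h\<close>, so a point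
  behind one plane has value above \<open>h\<close> for the other.\<close>

definition fl :: "bool \<Rightarrow> 'a lspace \<Rightarrow> real" where
  "fl i x = (if i then e \<bullet> lv x else h * lA x - e \<bullet> lv x)"

text \<open>Without the sign of \<open>refl_grp\<close>: the generators of the packing group keep
  the two sides of their plane, and the ping-pong is now about half-spaces.\<close>

definition side_grp :: "bool \<Rightarrow> ('a lspace \<Rightarrow> 'a lspace) set" where
  "side_grp i = {T\<in>LG. \<forall>x\<in>WV. fl i (T x) = fl i x}"

lemma fl_scaleR: "fl i (\<mu> *\<^sub>R x) = \<mu> * fl i x"
  by (simp add: fl_def algebra_simps)

lemma fl_e_inf: "fl i e_inf = 0"
  by (simp add: fl_def)

lemma fl_not: "fl (\<not> i) x = h * lA x - fl i x"
  by (simp add: fl_def)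

lemma map_group_side_grp: "map_group (side_grp i)"
proof -
  have "finv T \<in> side_grp i" if "T \<in> side_grp i" for T
  proof -
    have T: "T \<in> LG" "\<And>x. x \<in> WV \<Longrightarrow> fl i (T x) = fl i x" using that by (auto simp: side_grp_def)
    have "fl i (finv T x) = fl i x" if "x \<in> WV" for x
      using T(2)[OF LG_WV[OF LG_finv(1)[OF T(1)] that]] LG_finv(3)[OF T(1)] by simp
    then show ?thesis using LG_finv(1)[OF T(1)] by (simp add: side_grp_def)
  qed
  moreover have "S \<circ> T \<in> side_grp i" if "S \<in> side_grp i" "T \<in> side_grp i" for S T
  proof -
    have "S \<circ> T \<in> LG" using that LG_group by (simp add: map_group_def side_grp_def)
    moreover have "fl i (S (T x)) = fl i x" if "x \<in> WV" for x
      using \<open>S \<in> side_grp i\<close> \<open>T \<in> side_grp i\<close> that LG_WV by (simp add: side_grp_def)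
    ultimately show ?thesis by (simp add: side_grp_def)
  qed
  moreover have "id \<in> side_grp i" using LG_group by (simp add: side_grp_def map_group_def)
  ultimately show ?thesis using LG_D(2) by (simp add: map_group_def side_grp_def)
qed

text \<open>The two forms add up to \<open>h * lA\<close>. Once one of them is preserved, the other
  is preserved exactly when \<open>lA\<close> is, and \<open>lA\<close> is the pairing with
  \<open>e_inf\<close>.\<close>

lemma side_grp_e_inf:
  assumes T: "T \<in> side_grp i"
  shows "T \<in> side_grp (\<not> i) \<longleftrightarrow> T e_inf = e_inf"
proof
  have TL: "T \<in> LG" and Tf: "\<And>x. x \<in> WV \<Longrightarrow> fl i (T x) = fl i x" using T by (auto simp: side_grp_def)
  assume "T \<in> side_grp (\<not> i)"
  then have Tn: "fl (\<not> i) (T x) = fl (\<not> i) x" if "x \<in> WV" for x using that by (simp add: side_grp_def)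
  have lA_T: "lA (T x) = lA x" if "x \<in> WV" for x
  proof -
    have "h * lA (T x) = h * lA x" using Tf[OF that] Tn[OF that] by (simp add: fl_not)
    then show ?thesis using h_gt by simp
  qed
  show "T e_inf = e_inf"
  proof (rule ccontr)
    assume "T e_inf \<noteq> e_inf"
    then have "finv T e_inf \<noteq> e_inf" using LG_finv(3)[OF TL, of e_inf] by metis
    then obtain c p where c: "1 \<le> c" "finv T e_inf = c *\<^sub>R hat (Some p)"
      using LG_move_inf[OF LG_finv(1)[OF TL]] by metis
    have "lA (finv T e_inf) = lA e_inf"
      using lA_T[OF LG_WV[OF LG_finv(1)[OF TL] e_inf_WV]] LG_finv(3)[OF TL] by simp
    then show False using c by simp
  qed
next
  assume fixed: "T e_inf = e_inf"
  have TL: "T \<in> LG" using T by (simp add: side_grp_def)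
  have "lA (T x) = lA x" for x using LG_D(3)[OF TL, of x e_inf] by (simp add: fixed lf_e_inf)
  then show "T \<in> side_grp (\<not> i)" using T by (simp add: side_grp_def fl_not)
qed

text \<open>\<open>j\<close> names the half-space that is moved and \<open>i\<close> the plane next
  to which it arrives. The image lies on the strip side of plane \<open>i\<close>, at height at most
  1 and within 1 of a single point \<open>q\<close> of that plane.\<close>

definition shrinks :: "('a lspace \<Rightarrow> 'a lspace) \<Rightarrow> bool \<Rightarrow> bool \<Rightarrow> bool" where
  "shrinks w j i \<longleftrightarrow> (\<exists>q\<in>V. fl i (hat (Some q)) = 0 \<and> (\<forall>z\<in>V. fl j (hat (Some z)) < 0 \<longrightarrow>
     (\<exists>\<mu>>0. \<exists>y\<in>V. w (hat (Some z)) = \<mu> *\<^sub>R hat (Some y) \<and>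
        0 < fl i (hat (Some y)) \<and> fl i (hat (Some y)) \<le> 1 \<and> norm (y - q) \<le> 1)))"

text \<open>Half-space \<open>j\<close> is far from the other plane, so a letter of the other side
  contracts it, while a letter of side \<open>j\<close> applied first leaves it in place. After one
  contraction the image is within 1 of a plane, hence at height at least \<open>h - 1\<close> for
  the next letter, which contracts again. Only a single letter of side \<open>j\<close>
  escapes.\<close>

lemma alt_word_side_grp:
  assumes "alt_word side_grp i w"
  shows "(i = j \<and> (\<forall>x\<in>WV. fl j (w x) = fl j x)) \<or> shrinks w j i"
proof -
  have A: "\<exists>q\<in>V. fl i (hat (Some q)) = 0 \<and>
      (\<forall>z\<in>V. 1 \<le> fl i (hat (Some z)) \<longrightarrow> (\<exists>\<mu>>0. \<exists>y\<in>V. a (hat (Some z)) = \<mu> *\<^sub>R hat (Some y) \<and>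
        0 < fl i (hat (Some y)) \<and> fl i (hat (Some y)) \<le> 1 \<and> norm (y - q) \<le> 1))"
    if a: "a \<in> side_grp i - side_grp (\<not> i)" for a i
  proof -
    have T: "a \<in> LG" "a e_inf \<noteq> e_inf" using a side_grp_e_inf[of a i] by (auto simp: side_grp_def)
    have inv: "fl i (a x) = 1 * fl i x" if "x \<in> WV" for x using a that by (simp add: side_grp_def)
    have form: "fl i x = (if i then 1 else -1) * (e \<bullet> lv x) + (if i then 0 else h) * lA x" for x
      by (simp add: fl_def)
    obtain c q where q: "q \<in> V" "fl i (hat (Some q)) = 0"
      and con: "\<And>z. z \<in> V \<Longrightarrow> 1 \<le> \<bar>fl i (hat (Some z))\<bar> \<Longrightarrow> \<exists>\<mu>>0. \<exists>w\<in>V. a (hat (Some z)) = \<mu> *\<^sub>R hat (Some w) \<and>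
       fl i (hat (Some z)) * 1 = \<mu> * fl i (hat (Some w)) \<and> \<bar>fl i (hat (Some w))\<bar> \<le> 1 \<and> norm (w - q) \<le> 1"
      by (rule LG_contract[where fl = "fl i", OF T form _ inv]) (auto split: if_splits)
    have "\<exists>\<mu>>0. \<exists>y\<in>V. a (hat (Some z)) = \<mu> *\<^sub>R hat (Some y) \<and>
        0 < fl i (hat (Some y)) \<and> fl i (hat (Some y)) \<le> 1 \<and> norm (y - q) \<le> 1"
      if z: "z \<in> V" "1 \<le> fl i (hat (Some z))" for z
    proof -
      obtain \<mu> y where y: "0 < \<mu>" "y \<in> V" "a (hat (Some z)) = \<mu> *\<^sub>R hat (Some y)"
        "fl i (hat (Some z)) = \<mu> * fl i (hat (Some y))" "\<bar>fl i (hat (Some y))\<bar> \<le> 1" "norm (y - q) \<le> 1"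
        using con[OF z(1)] z(2) by auto
      have "0 < fl i (hat (Some y))" using y(1,4) z(2) by (metis less_le_trans zero_less_mult_pos zero_less_one)
      then show ?thesis using y by (metis abs_le_iff)
    qed
    then show ?thesis using q by blast
  qed
  from assms show ?thesis
  proof (induction rule: alt_word.induct)
    case (alt_single a i)
    show ?case
    proof (cases "i = j")
      case True
      then show ?thesis using alt_single by (simp add: side_grp_def)
    next
      case False
      then have j: "j = (\<not> i)" by auto
      have "1 \<le> fl i (hat (Some z))" if "fl j (hat (Some z)) < 0" for z
        using that h_gt unfolding j fl_not by simp
      then show ?thesis using A[OF alt_single] unfolding shrinks_def by blast
    qed
  next
    case (alt_comp a i w)
    have TL: "a \<in> LG" using alt_comp by (simp add: side_grp_def)
    have w1: "w \<in> LG"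
      using \<open>alt_word side_grp (\<not> i) w\<close>
    proof (induction)
      case (alt_comp a i w)
      then have "a \<in> LG" by (simp add: side_grp_def)
      then show ?case using alt_comp.IH by (rule LG_comp)
    qed (simp add: side_grp_def)
    note lin = LG_D(1)[OF TL]
    obtain q where q: "q \<in> V" "fl i (hat (Some q)) = 0"
      and con: "\<And>z. z \<in> V \<Longrightarrow> 1 \<le> fl i (hat (Some z)) \<Longrightarrow> \<exists>\<mu>>0. \<exists>y\<in>V. a (hat (Some z)) = \<mu> *\<^sub>R hat (Some y) \<and>
        0 < fl i (hat (Some y)) \<and> fl i (hat (Some y)) \<le> 1 \<and> norm (y - q) \<le> 1"
      using A[OF alt_comp.hyps(1)] by blast
    have "\<exists>\<mu>>0. \<exists>y\<in>V. (a \<circ> w) (hat (Some z)) = \<mu> *\<^sub>R hat (Some y) \<and>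
        0 < fl i (hat (Some y)) \<and> fl i (hat (Some y)) \<le> 1 \<and> norm (y - q) \<le> 1"
      if z: "z \<in> V" "fl j (hat (Some z)) < 0" for z
    proof -
      have "\<exists>\<mu>>0. \<exists>y\<in>V. w (hat (Some z)) = \<mu> *\<^sub>R hat (Some y) \<and> 1 \<le> fl i (hat (Some y))"
        using alt_comp.IH
      proof
        \<comment> \<open>The rest of the word keeps half-space \<open>j\<close>, and a point behind
          plane \<open>j\<close> has value above \<open>h\<close> for plane
          \<open>i\<close>.\<close>
        assume j: "(\<not> i) = j \<and> (\<forall>x\<in>WV. fl j (w x) = fl j x)"
        obtain \<mu> z' where \<mu>: "0 < \<mu>" and z': "w (hat (Some z)) = \<mu> *\<^sub>R hat z'" using LG_hat[OF w1] by metis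
        have "\<mu> * fl j (hat z') = fl j (hat (Some z))"
          using j hat_WV[OF z(1)] z' by (metis fl_scaleR)
        then have neg: "\<mu> * fl j (hat z') < 0" using z(2) by simp
        then obtain y where y: "z' = Some y" by (cases z') (auto simp: fl_e_inf)
        have "fl j (hat (Some y)) < 0" using neg \<mu> y by (simp add: mult_less_0_iff)
        moreover have "j = (\<not> i)" using j by auto
        ultimately have "1 \<le> fl i (hat (Some y))" using h_gt by (simp add: fl_not)
        moreover have "y \<in> V" using scaled_hat_WV[OF \<mu>, of y] LG_WV[OF w1 hat_WV[OF z(1)]] z' y by simp
        ultimately show ?thesis using \<mu> z' y by blast
      next
        assume "shrinks w j (\<not> i)"
        then obtain \<mu> y where y: "0 < \<mu>" "y \<in> V" "w (hat (Some z)) = \<mu> *\<^sub>R hat (Some y)"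
          "fl (\<not> i) (hat (Some y)) \<le> 1"
          using z unfolding shrinks_def by blast
        have "1 \<le> fl i (hat (Some y))" using y(4) h_gt by (simp add: fl_not)
        then show ?thesis using y by blast
      qed
      then obtain \<mu> y where y: "0 < \<mu>" "y \<in> V" "w (hat (Some z)) = \<mu> *\<^sub>R hat (Some y)" "1 \<le> fl i (hat (Some y))"
        by blast
      obtain \<nu> x where x: "0 < \<nu>" "x \<in> V" "a (hat (Some y)) = \<nu> *\<^sub>R hat (Some x)"
        "0 < fl i (hat (Some x))" "fl i (hat (Some x)) \<le> 1" "norm (x - q) \<le> 1"
        using con[OF y(2,4)] by blast
      have "(a \<circ> w) (hat (Some z)) = (\<mu> * \<nu>) *\<^sub>R hat (Some x)"
        using x(3) y(3) by (simp add: linear_scale[OF lin] del: hat_simps)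
      moreover have "0 < \<mu> * \<nu>" using x y by simp
      ultimately show ?thesis using x by blast
    qed
    then have "shrinks (a \<circ> w) j i" using q unfolding shrinks_def by blast
    then show ?case by blast
  qed
qed

theorem half_space_images:
  assumes "T \<in> map_gen (side_grp True \<union> side_grp False)"
  shows "(\<forall>x\<in>WV. fl j (T x) = fl j x) \<or> (\<exists>i. shrinks T j i)"
  using amalgam_normal_form[OF map_group_side_grp assms]
proof
  assume "T \<in> side_grp True \<inter> side_grp False"
  then have "T \<in> side_grp j" by (cases j) auto
  then show ?thesis by (simp add: side_grp_def)
next
  assume "\<exists>i. alt_word side_grp i T"
  then show ?thesis using alt_word_side_grp by blast
qed

subsection \<open>Generators\<close>

lemma l_trans_LG:
  assumes "p \<in> L" shows "l_trans p \<in> LG"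
proof (rule LG_I[of _ "l_trans (- p)"])
  have pV: "p \<in> V" using assms L_sub by blast
  show "linear (l_trans p)"
    by (rule linearI) (simp_all add: l_trans_def algebra_simps)
  show "l_trans p (l_trans (- p) x) = x" "l_trans (- p) (l_trans p x) = x" for x
    by (simp_all add: l_trans_def prod_eq_iff algebra_simps)
  show "lf (l_trans p x) (l_trans p y) = lf x y" for x y
    by (simp add: l_trans_def lf_def algebra_simps inner_commute)
  \<comment> \<open>The last coordinate gains 2 v.q and A |q|^2, which are integral because all
    norms of the lattice are.\<close>
  have 1: "l_trans q x \<in> Lat" if "x \<in> Lat" "q \<in> L" for x q
  proof -
    have "lA x \<in> \<int>" using that by (simp add: Lat_def)
    then obtain k where k: "lA x = of_int k" by (rule Ints_cases)
    show ?thesis using that k L_add L_scale_int L_inner L_int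
      by (auto simp: l_trans_def Lat_def intro!: Ints_add Ints_mult)
  qed
  show "l_trans p x \<in> Lat" "l_trans (- p) x \<in> Lat" if "x \<in> Lat" for x
    using 1 that assms L_uminus by blast+
  show "l_trans p x \<in> WV" "l_trans (- p) x \<in> WV" if "x \<in> WV" for x
    using that pV subspace_add[OF subspace_V] subspace_scale[OF subspace_V] subspace_diff[OF subspace_V]
    by (auto simp: l_trans_def WV_def)
  show "0 < lA (l_trans p (hat z)) + lC (l_trans p (hat z))" for z
  proof (cases z)
    case (Some z)
    have "l_trans p (hat (Some z)) = hat (Some (z + p))"
      by (simp add: l_trans_def algebra_simps inner_commute)
    then show ?thesis using hat_pos Some by metis
  qed (simp add: l_trans_def)
qed

lemma l_invert_LG: "l_invert \<in> LG"
proof (rule LG_I[of _ "l_invert"])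
  show "linear l_invert" by (rule linearI) (simp_all add: l_invert_def)
  show "0 < lA (l_invert (hat z)) + lC (l_invert (hat z))" for z :: "'a option"
    using hat_pos[of z] by (simp add: l_invert_def)
qed (auto simp: l_invert_def lf_def Lat_def WV_def)

lemma l_rot_LG:
  assumes "linear f" "\<And>x. norm (f x) = norm x" "\<And>x. f (g x) = x" "\<And>x. g (f x) = x"
    "\<And>x. x \<in> L \<Longrightarrow> f x \<in> L" "\<And>x. x \<in> L \<Longrightarrow> g x \<in> L" "\<And>x. x \<in> V \<Longrightarrow> f x \<in> V" "\<And>x. x \<in> V \<Longrightarrow> g x \<in> V"
  shows "l_rot f \<in> LG"
proof (rule LG_I[of _ "l_rot g"])
  have inner: "f x \<bullet> f y = x \<bullet> y" for x y
    using assms(2)[of "x + y"] assms(2)[of x] assms(2)[of y]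
    by (simp add: linear_add[OF assms(1)] norm_eq_sqrt_inner algebra_simps inner_commute)
  show "linear (l_rot f)"
    by (rule linearI) (simp_all add: l_rot_def linear_add[OF assms(1)] linear_scale[OF assms(1)])
  show "lf (l_rot f x) (l_rot f y) = lf x y" for x y by (simp add: lf_def l_rot_def inner)
  show "0 < lA (l_rot f (hat z)) + lC (l_rot f (hat z))" for z :: "'a option"
    using hat_pos[of z] by (simp add: l_rot_def)
qed (auto simp: l_rot_def assms Lat_def WV_def)

lemma l_trans_side_grp:
  assumes "p \<in> L" "e \<bullet> p = 0" shows "l_trans p \<in> side_grp i"
  using l_trans_LG[OF assms(1)] assms(2)
  by (simp add: side_grp_def fl_def l_trans_def inner_add_right)

text \<open>In coordinates centred at \<open>p\<close> the inversion exchanges \<open>lA\<close> and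
  \<open>lC\<close> and keeps \<open>lv\<close>, so the height above a plane through
  \<open>p\<close> is unchanged.\<close>

lemma inversion_side_grp:
  assumes "p \<in> L" "fl i (hat (Some p)) = 0"
  shows "l_trans p \<circ> (l_invert \<circ> l_trans (- p)) \<in> side_grp i"
proof -
  have "l_trans p \<circ> (l_invert \<circ> l_trans (- p)) \<in> LG"
    using LG_group l_trans_LG[OF assms(1)] l_trans_LG[OF L_uminus[OF assms(1)]] l_invert_LG
    by (simp add: map_group_def)
  moreover have "fl i ((l_trans p \<circ> (l_invert \<circ> l_trans (- p))) x) = fl i x" for x
  proof -
    have "e \<bullet> p = (if i then 0 else h)" using assms(2) by (cases i) (simp_all add: fl_def)
    then show ?thesis
      by (cases i) (simp_all add: fl_def l_trans_def l_invert_def inner_add_right inner_diff_right algebra_simps)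
  qed
  ultimately show ?thesis by (simp add: side_grp_def)
qed

end

section \<open>Volume\<close>

lemma plus_basis_Basis: "plus_basis n \<subseteq> Basis"
  by (auto simp: plus_basis_def Basis_quat_def)

lemma inner_plus_basis:
  assumes "b \<in> plus_basis n" "c \<in> plus_basis n" shows "c \<bullet> b = (if c = b then 1 else 0)"
  using assms plus_basis_Basis[of n] by (intro inner_Basis) auto

lemma norm_plus_basis: "b \<in> plus_basis n \<Longrightarrow> norm b = 1"
  using inner_plus_basis[of b n b] by (simp add: norm_eq_sqrt_inner)

lemma sum_mult_delta:
  fixes f :: "'a \<Rightarrow> real"
  assumes "finite B" "b \<in> B" shows "(\<Sum>x\<in>B. f x * (if x = b then 1 else 0)) = f b"
proof -
  have "(\<Sum>x\<in>B. f x * (if x = b then 1 else 0)) = (\<Sum>x\<in>B. if x = b then f x else 0)"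
    by (rule sum.cong) auto
  then show ?thesis using assms by simp
qed

lemma finite_plus_basis: "finite (plus_basis n)"
  by (simp add: plus_basis_def)

lemma card_plus_basis: "card (plus_basis n) \<le> 4"
  by (simp add: plus_basis_def card_insert_if)

lemma subspace_RR_plus: "subspace (RR_plus n)"
  by (simp add: RR_plus_def)

lemma closed_RR_plus: "closed (RR_plus n)"
  by (simp add: RR_plus_def)

lemma RR_plus_expand:
  assumes "w \<in> RR_plus n" shows "(\<Sum>b\<in>plus_basis n. (w \<bullet> b) *\<^sub>R b) = w"
proof -
  obtain f where f: "w = (\<Sum>b\<in>plus_basis n. f b *\<^sub>R b)"
    using assms finite_plus_basis by (auto simp: RR_plus_def span_finite)
  have "w \<bullet> b = f b" if "b \<in> plus_basis n" for b
  proof -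
    have "w \<bullet> b = (\<Sum>c\<in>plus_basis n. f c * (if c = b then 1 else 0))"
      unfolding f inner_sum_left using that by (intro sum.cong refl) (simp add: inner_plus_basis)
    then show ?thesis using sum_mult_delta[OF finite_plus_basis that, of f] by metis
  qed
  then show ?thesis using f by simp
qed

definition lincomb :: "nat \<Rightarrow> (quat \<Rightarrow> real) \<Rightarrow> quat" where
  "lincomb n f = (\<Sum>b\<in>plus_basis n. f b *\<^sub>R b)"

abbreviation coord_measure :: "nat \<Rightarrow> (quat \<Rightarrow> real) measure" where
  "coord_measure n \<equiv> \<Pi>\<^sub>M b\<in>plus_basis n. lborel"

lemma lincomb_RR_plus: "lincomb n f \<in> RR_plus n"
  unfolding lincomb_def RR_plus_def by (intro span_sum span_scale span_base)

lemma lincomb_measurable [measurable]: "lincomb n \<in> measurable (coord_measure n) borel"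
  unfolding lincomb_def by measurable

lemma vol_eq: "vol n = distr (coord_measure n) borel (lincomb n)"
  by (simp add: vol_def lincomb_def[abs_def])

lemma sets_vol [simp, measurable_cong]: "sets (vol n) = sets borel"
  and space_vol [simp]: "space (vol n) = UNIV"
  by (simp_all add: vol_eq)

lemma emeasure_vol:
  "A \<in> sets borel \<Longrightarrow> emeasure (vol n) A = emeasure (coord_measure n) (lincomb n -` A \<inter> space (coord_measure n))"
  unfolding vol_eq by (rule emeasure_distr[OF lincomb_measurable])

lemma vol_inter_RR_plus:
  assumes "A \<in> sets borel" shows "emeasure (vol n) (A \<inter> RR_plus n) = emeasure (vol n) A"
proof -
  have "A \<inter> RR_plus n \<in> sets borel" using assms borel_closed[OF closed_RR_plus] by (rule sets.Int)
  moreover have "lincomb n -` (A \<inter> RR_plus n) = lincomb n -` A" using lincomb_RR_plus by auto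
  ultimately show ?thesis using assms by (simp add: emeasure_vol)
qed

interpretation coord: product_sigma_finite "\<lambda>_::quat. lborel :: real measure"
  by standard

text \<open>\<open>vol\<close> is the image of a product measure, so its invariance comes from that
  of the factors, checked on boxes. The restriction keeps the shifted coordinate functions
  extensional, as elements of the product space are.\<close>

lemma coord_measure_translate:
  "distr (coord_measure n) (coord_measure n) (\<lambda>f. \<lambda>b\<in>plus_basis n. f b + c b) = coord_measure n"
proof (rule coord.PiM_eqI[OF finite_plus_basis])
  let ?B = "plus_basis n" and ?M = "coord_measure n"
  have meas: "(\<lambda>f. \<lambda>b\<in>?B. f b + c b) \<in> measurable ?M ?M" by measurable
  fix A :: "quat \<Rightarrow> real set" assume A: "\<And>i. i \<in> ?B \<Longrightarrow> A i \<in> sets lborel"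
  have A': "Pi\<^sub>E ?B A \<in> sets ?M" by (rule sets_PiM_I_finite[OF finite_plus_basis]) (use A in auto)
  have "emeasure (distr ?M ?M (\<lambda>f. \<lambda>b\<in>?B. f b + c b)) (Pi\<^sub>E ?B A)
      = emeasure ?M ((\<lambda>f. \<lambda>b\<in>?B. f b + c b) -` Pi\<^sub>E ?B A \<inter> space ?M)"
    by (rule emeasure_distr[OF meas A'])
  also have "(\<lambda>f. \<lambda>b\<in>?B. f b + c b) -` Pi\<^sub>E ?B A \<inter> space ?M = Pi\<^sub>E ?B (\<lambda>b. (+) (c b) -` A b)"
    by (auto simp: space_PiM PiE_def Pi_def add.commute)
  also have "emeasure ?M \<dots> = (\<Prod>b\<in>?B. emeasure lborel ((+) (c b) -` A b))"
  proof (rule coord.emeasure_PiM[OF finite_plus_basis])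
    fix i assume "i \<in> ?B"
    then have "A i \<in> sets borel" using A by simp
    then show "(+) (c i) -` A i \<in> sets lborel"
      using measurable_sets[of "(+) (c i)" borel borel "A i"] by simp
  qed
  also have "\<dots> = (\<Prod>b\<in>?B. emeasure lborel (A b))"
  proof (rule prod.cong[OF refl])
    fix b assume "b \<in> ?B"
    then have "A b \<in> sets borel" using A by simp
    then have "emeasure (distr lborel borel ((+) (c b))) (A b) = emeasure lborel ((+) (c b) -` A b)"
      by (subst emeasure_distr) auto
    then show "emeasure lborel ((+) (c b) -` A b) = emeasure lborel (A b)"
      by (simp add: lborel_distr_plus)
  qed
  finally show "emeasure (distr ?M ?M (\<lambda>f. \<lambda>b\<in>?B. f b + c b)) (Pi\<^sub>E ?B A) = (\<Prod>b\<in>?B. emeasure lborel (A b))" .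
qed simp

lemma vol_translate:
  assumes w: "w \<in> RR_plus n" and A: "A \<in> sets borel"
  shows "emeasure (vol n) ((\<lambda>x. x + w) -` A) = emeasure (vol n) A"
proof -
  let ?B = "plus_basis n" and ?M = "coord_measure n"
  let ?sh = "\<lambda>f. \<lambda>b\<in>?B. f b + w \<bullet> b"
  have meas: "?sh \<in> measurable ?M ?M" by measurable
  have pre: "lincomb n -` A \<inter> space ?M \<in> sets ?M" using A by measurable
  have A': "(\<lambda>x. x + w) -` A \<in> sets borel" using measurable_sets[OF _ A, of "\<lambda>x. x + w" borel] by simp
  have comb: "lincomb n (?sh f) = lincomb n f + w" for f
  proof -
    have "lincomb n (?sh f) = (\<Sum>b\<in>?B. f b *\<^sub>R b + (w \<bullet> b) *\<^sub>R b)"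
      unfolding lincomb_def by (intro sum.cong refl) (simp add: scaleR_add_left)
    then show ?thesis using RR_plus_expand[OF w] by (simp add: sum.distrib lincomb_def)
  qed
  have "emeasure (vol n) A = emeasure (distr ?M ?M ?sh) (lincomb n -` A \<inter> space ?M)"
    using A by (simp add: emeasure_vol coord_measure_translate)
  also have "\<dots> = emeasure ?M (?sh -` (lincomb n -` A \<inter> space ?M) \<inter> space ?M)"
    by (rule emeasure_distr[OF meas pre])
  also have "?sh -` (lincomb n -` A \<inter> space ?M) \<inter> space ?M = lincomb n -` ((\<lambda>x. x + w) -` A) \<inter> space ?M"
    using measurable_space[OF meas] by (auto simp: comb)
  finally show ?thesis using A' by (simp add: emeasure_vol)
qed

lemma vol_box:
  assumes "0 \<le> r"
  shows "emeasure (coord_measure n) (Pi\<^sub>E (plus_basis n) (\<lambda>_. {-r<..<r})) = ennreal ((2 * r) ^ card (plus_basis n))"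
  using assms by (subst coord.emeasure_PiM[OF finite_plus_basis]) (simp_all add: ennreal_power)

text \<open>The ball lies in a cube of edge 4, in dimension at most 4.\<close>

lemma vol_ball_le:
  assumes "x \<in> RR_plus n" shows "emeasure (vol n) (ball x 2) \<le> 256"
proof -
  have "(\<lambda>y. y + x) -` ball x 2 = ball 0 2" by (auto simp: dist_norm norm_minus_commute)
  then have "emeasure (vol n) (ball x 2) = emeasure (vol n) (ball 0 2)"
    using vol_translate[OF assms, of "ball x 2"] by simp
  also have "\<dots> = emeasure (coord_measure n) (lincomb n -` ball 0 2 \<inter> space (coord_measure n))"
    by (rule emeasure_vol) simp
  also have "\<dots> \<le> emeasure (coord_measure n) (Pi\<^sub>E (plus_basis n) (\<lambda>_. {-2<..<2}))"
  proof (rule emeasure_mono)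
    show "Pi\<^sub>E (plus_basis n) (\<lambda>_. {-2<..<2}) \<in> sets (coord_measure n)"
      by (rule sets_PiM_I_finite[OF finite_plus_basis]) auto
    show "lincomb n -` ball 0 2 \<inter> space (coord_measure n) \<subseteq> Pi\<^sub>E (plus_basis n) (\<lambda>_. {-2<..<2})"
    proof
      fix f assume f: "f \<in> lincomb n -` ball 0 2 \<inter> space (coord_measure n)"
      have "\<bar>f b\<bar> < 2" if b: "b \<in> plus_basis n" for b
      proof -
        have "lincomb n f \<bullet> b = (\<Sum>c\<in>plus_basis n. f c * (if c = b then 1 else 0))"
          unfolding lincomb_def inner_sum_left using b
          by (intro sum.cong refl) (simp add: inner_plus_basis)
        then have "\<bar>f b\<bar> = \<bar>lincomb n f \<bullet> b\<bar>" using sum_mult_delta[OF finite_plus_basis b, of f] by metis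
        also have "\<dots> \<le> norm (lincomb n f)" using b plus_basis_Basis by (intro Basis_le_norm) auto
        also have "\<dots> < 2" using f by simp
        finally show ?thesis .
      qed
      then show "f \<in> Pi\<^sub>E (plus_basis n) (\<lambda>_. {-2<..<2})"
        using f by (force simp: space_PiM PiE_def Pi_def abs_less_iff)
    qed
  qed
  also have "\<dots> = ennreal (4 ^ card (plus_basis n))" using vol_box[of 2 n] by simp
  also have "\<dots> \<le> ennreal (4 ^ 4)" by (intro ennreal_leI power_increasing card_plus_basis) simp
  finally show ?thesis by simp
qed

text \<open>A cube of edge 1/4 fits into the ball: at most four coordinates of size below 1/8 give a
  norm below 1/2.\<close>

lemma vol_ball_ge:
  assumes "x \<in> RR_plus n" shows "ennreal (1 / 256) \<le> emeasure (vol n) (ball x (1 / 2))"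
proof -
  have "ennreal (1 / 256) = ennreal ((1 / 4) ^ 4)" by (simp add: power_divide)
  also have "\<dots> \<le> ennreal ((1 / 4) ^ card (plus_basis n))"
    by (intro ennreal_leI power_decreasing card_plus_basis) auto
  also have "\<dots> = emeasure (coord_measure n) (Pi\<^sub>E (plus_basis n) (\<lambda>_. {-(1/8)<..<1/8}))"
    using vol_box[of "1/8" n] by simp
  also have "\<dots> \<le> emeasure (coord_measure n) (lincomb n -` ball 0 (1/2) \<inter> space (coord_measure n))"
  proof (rule emeasure_mono)
    show "Pi\<^sub>E (plus_basis n) (\<lambda>_. {-(1/8)<..<1/8}) \<subseteq> lincomb n -` ball 0 (1/2) \<inter> space (coord_measure n)"
    proof
      fix f :: "quat \<Rightarrow> real" assume f: "f \<in> Pi\<^sub>E (plus_basis n) (\<lambda>_. {-(1/8)<..<1/8})"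
      have ne: "plus_basis n \<noteq> {}" by (simp add: plus_basis_def)
      have "norm (lincomb n f) \<le> (\<Sum>b\<in>plus_basis n. norm (f b *\<^sub>R b))"
        unfolding lincomb_def by (rule norm_sum)
      also have "\<dots> < (\<Sum>b\<in>plus_basis n. 1 / 8)"
      proof (rule sum_strict_mono[OF finite_plus_basis ne])
        fix b assume b: "b \<in> plus_basis n"
        then have "norm b = 1" by (rule norm_plus_basis)
        then show "norm (f b *\<^sub>R b) < 1 / 8" using f b by (force simp: abs_less_iff)
      qed
      also have "\<dots> = card (plus_basis n) / 8" by simp
      also have "\<dots> \<le> 1 / 2" using card_plus_basis[of n] by linarith
      finally show "f \<in> lincomb n -` ball 0 (1/2) \<inter> space (coord_measure n)"
        using f by (auto simp: space_PiM PiE_def)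
    qed
  qed measurable
  also have "\<dots> = emeasure (vol n) (ball 0 (1/2))" by (rule emeasure_vol[symmetric]) simp
  also have "\<dots> = emeasure (vol n) (ball x (1/2))"
  proof -
    have "(\<lambda>y. y + x) -` ball x (1/2) = ball 0 (1/2)" by (auto simp: dist_norm norm_minus_commute)
    then show ?thesis using vol_translate[OF assms, of "ball x (1/2)"] by simp
  qed
  finally show ?thesis .
qed

subsection \<open>Fundamental parallelepipeds\<close>

text \<open>Cut \<open>K\<close> along the translates of the parallelepiped and move every piece
  back into it. By \<open>disj\<close> the moved pieces do not overlap, so the volume of
  \<open>K\<close> fits. This is Blichfeldt's principle.\<close>

lemma emeasure_parallelepiped_ge:
  assumes B: "finite B" "independent B" "span B = RR_plus n"
    and K: "K \<in> sets borel" "bounded K" "K \<subseteq> RR_plus n"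
    and disj: "\<And>c x. (\<exists>b\<in>B. c b \<noteq> 0) \<Longrightarrow> x \<in> K \<Longrightarrow> x + (\<Sum>b\<in>B. of_int (c b) *\<^sub>R b) \<in> K \<Longrightarrow> False"
  shows "emeasure (vol n) K \<le> emeasure (vol n) {\<Sum>b\<in>B. t b *\<^sub>R b | t. \<forall>b\<in>B. 0 \<le> t b \<and> t b < 1}"
    (is "_ \<le> emeasure _ ?P")
proof -
  have "\<exists>g. linear g \<and> (\<forall>x\<in>B. g x = (if x = b then 1 else (0::real)))" for b
    by (rule linear_independent_extend[OF B(2)])
  then obtain g where g: "\<And>b. linear (g b)" "\<And>b x. x \<in> B \<Longrightarrow> g b x = (if x = b then 1 else (0::real))"
    by metis
  have g_comb: "g b (\<Sum>x\<in>B. t x *\<^sub>R x) = t b" if "b \<in> B" for b t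
  proof -
    have "g b (\<Sum>x\<in>B. t x *\<^sub>R x) = (\<Sum>x\<in>B. t x * (if x = b then 1 else 0))"
      by (simp add: linear_sum[OF g(1)] linear_scale[OF g(1)] g(2) cong: sum.cong)
    then show ?thesis using sum_mult_delta[OF B(1) that, of t] by metis
  qed
  have span_eq: "x = (\<Sum>b\<in>B. g b x *\<^sub>R b)" if x: "x \<in> span B" for x
  proof -
    obtain t where "x = (\<Sum>b\<in>B. t b *\<^sub>R b)" using x B(1) by (auto simp: span_finite)
    then show ?thesis using g_comb by simp
  qed
  have P_eq: "?P = span B \<inter> (\<Inter>b\<in>B. {x. 0 \<le> g b x} \<inter> {x. g b x < 1})" (is "_ = ?Q")
  proof
    show "?P \<subseteq> ?Q"
    proof
      fix x assume "x \<in> ?P"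
      then obtain t where t: "x = (\<Sum>b\<in>B. t b *\<^sub>R b)" "\<forall>b\<in>B. 0 \<le> t b \<and> t b < 1" by blast
      moreover have "x \<in> span B" unfolding t by (intro span_sum span_scale span_base)
      ultimately show "x \<in> ?Q" using g_comb by auto
    qed
    show "?Q \<subseteq> ?P" using span_eq by fastforce
  qed
  have cont: "continuous_on UNIV (g b)" for b using g(1) by (simp add: linear_continuous_on linear_conv_bounded_linear)
  have [measurable]: "g b \<in> borel_measurable borel" for b by (rule borel_measurable_continuous_onI[OF cont])
  have P_sets: "?P \<in> sets borel"
  proof -
    have "{x. 0 \<le> g b x} \<inter> {x. g b x < 1} \<in> sets borel" for b by measurable
    moreover have "span B \<in> sets borel" using closed_subspace[of "span B"] by auto
    ultimately show ?thesis unfolding P_eq using B(1)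
      by (intro sets.Int) (auto simp: sets.finite_INT intro!: sets.countable_INT'' countable_finite)
  qed
  \<comment> \<open>\<open>K\<close> is bounded, so the integer parts of its coordinates lie in a
    finite box and only finitely many pieces occur.\<close>
  obtain N where N: "\<And>b x. b \<in> B \<Longrightarrow> x \<in> K \<Longrightarrow> \<bar>g b x\<bar> \<le> of_int N"
  proof -
    have "\<exists>M. \<forall>x\<in>K. \<bar>g b x\<bar> \<le> M" for b
    proof -
      have "bounded (g b ` K)" using K(2) g(1) by (simp add: bounded_linear_image linear_conv_bounded_linear)
      then show ?thesis by (auto simp: bounded_iff)
    qed
    then obtain M where M: "\<And>b x. x \<in> K \<Longrightarrow> \<bar>g b x\<bar> \<le> M b" by metis
    have "\<bar>g b x\<bar> \<le> of_int \<lceil>\<Sum>b\<in>B. \<bar>M b\<bar>\<rceil>" if "b \<in> B" "x \<in> K" for b x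
    proof -
      have "\<bar>g b x\<bar> \<le> \<bar>M b\<bar>" using M[OF that(2), of b] by linarith
      also have "\<dots> \<le> (\<Sum>b\<in>B. \<bar>M b\<bar>)" using that B(1) by (intro member_le_sum) auto
      also have "\<dots> \<le> of_int \<lceil>\<Sum>b\<in>B. \<bar>M b\<bar>\<rceil>" by simp
      finally show ?thesis .
    qed
    then show thesis using that by blast
  qed
  define X where "X = (\<Pi>\<^sub>E b\<in>B. {-N-1..N})"
  define v where "v c = (\<Sum>b\<in>B. of_int (c b) *\<^sub>R b)" for c :: "quat \<Rightarrow> int"
  have "finite X" unfolding X_def using B(1) by (intro finite_PiE) auto
  \<comment> \<open>The piece of \<open>K\<close> in the translate by \<open>v c\<close>, already
    moved into the parallelepiped.\<close>
  define Kc where "Kc c = (\<lambda>x. x + v c) -` K \<inter> ?P" for c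
  have pre: "(\<lambda>x. x + w) -` A \<in> sets borel" if "A \<in> sets borel" for w and A :: "quat set"
    using measurable_sets[OF _ that, of "\<lambda>x. x + w" borel] by simp
  have Kc_sets: "Kc c \<in> sets borel" for c
    unfolding Kc_def using pre[OF K(1)] P_sets by (rule sets.Int)
  have v_RR: "v c \<in> RR_plus n" for c
    unfolding v_def B(3)[symmetric] by (intro span_sum span_scale span_base)
  have shift: "(\<lambda>x. x + v c) -` ((\<lambda>x. x - v c) -` A) = A" for c A by auto
  have "K \<subseteq> (\<Union>c\<in>X. (\<lambda>x. x - v c) -` Kc c)"
  proof
    fix x assume x: "x \<in> K"
    define c where "c = (\<lambda>b\<in>B. \<lfloor>g b x\<rfloor>)"
    have "c \<in> X"
    proof -
      have "- N - 1 \<le> \<lfloor>g b x\<rfloor> \<and> \<lfloor>g b x\<rfloor> \<le> N" if "b \<in> B" for b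
        using N[OF that x] by linarith
      then show ?thesis by (auto simp: X_def c_def)
    qed
    moreover have "x - v c \<in> ?P"
    proof -
      have xs: "x \<in> span B" using x K(3) B(3) by auto
      have "x - v c = (\<Sum>b\<in>B. (g b x - of_int \<lfloor>g b x\<rfloor>) *\<^sub>R b)"
        using span_eq[OF xs] by (simp add: v_def c_def scaleR_diff_left sum_subtractf)
      moreover have "0 \<le> g b x - of_int \<lfloor>g b x\<rfloor> \<and> g b x - of_int \<lfloor>g b x\<rfloor> < 1" for b by linarith
      ultimately show ?thesis
        unfolding mem_Collect_eq by (intro exI[of _ "\<lambda>b. g b x - of_int \<lfloor>g b x\<rfloor>"]) simp
    qed
    ultimately show "x \<in> (\<Union>c\<in>X. (\<lambda>x. x - v c) -` Kc c)" using x by (auto simp: Kc_def)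
  qed
  moreover have sh_sets: "(\<lambda>x. x - v c) -` Kc c \<in> sets borel" for c
    using pre[OF Kc_sets, of "- v c" c] by simp
  ultimately have "emeasure (vol n) K \<le> emeasure (vol n) (\<Union>c\<in>X. (\<lambda>x. x - v c) -` Kc c)"
    using \<open>finite X\<close> by (intro emeasure_mono) (auto intro!: sets.finite_UN)
  also have "\<dots> \<le> (\<Sum>c\<in>X. emeasure (vol n) ((\<lambda>x. x - v c) -` Kc c))"
    using \<open>finite X\<close> sh_sets by (intro emeasure_subadditive_finite) auto
  also have "\<dots> = (\<Sum>c\<in>X. emeasure (vol n) (Kc c))"
  proof (rule sum.cong[OF refl])
    fix c
    show "emeasure (vol n) ((\<lambda>x. x - v c) -` Kc c) = emeasure (vol n) (Kc c)"
      using vol_translate[OF v_RR sh_sets, of c c] by (simp only: shift)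
  qed
  also have "\<dots> = emeasure (vol n) (\<Union>c\<in>X. Kc c)"
  proof (rule sum_emeasure)
    show "Kc ` X \<subseteq> sets (vol n)" using Kc_sets by auto
    show "disjoint_family_on Kc X"
      unfolding disjoint_family_on_def
    proof (intro ballI impI)
      fix c d assume cd: "c \<in> X" "d \<in> X" "c \<noteq> d"
      show "Kc c \<inter> Kc d = {}"
      proof (rule ccontr)
        assume "Kc c \<inter> Kc d \<noteq> {}"
        then obtain x where x: "x + v c \<in> K" "x + v d \<in> K" by (auto simp: Kc_def)
        have "\<exists>b\<in>B. d b - c b \<noteq> 0"
          using cd PiE_ext[of c B "\<lambda>_. {-N-1..N}" d] unfolding X_def by fastforce
        moreover have "x + v d = x + v c + (\<Sum>b\<in>B. of_int (d b - c b) *\<^sub>R b)"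
          by (simp add: v_def scaleR_diff_left sum_subtractf)
        ultimately show False using disj[of "\<lambda>b. d b - c b" "x + v c"] x by metis
      qed
    qed
  qed fact
  also have "\<dots> \<le> emeasure (vol n) ?P"
    using P_sets by (intro emeasure_mono) (auto simp: Kc_def)
  finally show ?thesis .
qed

text \<open>Stack \<open>N\<close> balls of radius 1/2 along the normal \<open>e\<close>. Points of
  the stack differ in height by less than \<open>N \<le> h\<close>, so a lattice vector joining two
  of them lies in the plane; then both are in the same ball, at distance below 1, against the
  minimal length 1.\<close>

lemma emeasure_parallelepiped_ge_slab:
  assumes B: "finite B" "independent B" "span B = RR_plus n"
    and e: "e \<in> RR_plus n" "norm e = 1" and N: "real N \<le> h"
    and far: "\<And>c. (\<exists>b\<in>B. c b \<noteq> 0) \<Longrightarrow> (let x = (\<Sum>b\<in>B. of_int (c b) *\<^sub>R b) in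
      e \<bullet> x = 0 \<and> 1 \<le> norm x \<or> h \<le> \<bar>e \<bullet> x\<bar>)"
  shows "ennreal (real N / 256) \<le> emeasure (vol n) {\<Sum>b\<in>B. t b *\<^sub>R b | t. \<forall>b\<in>B. 0 \<le> t b \<and> t b < 1}"
proof -
  define D where "D i = ball ((real i + 1 / 2) *\<^sub>R e) (1 / 2)" for i
  define K where "K = (\<Union>i<N. D i)"
  have ee: "e \<bullet> e = 1" using e(2) by (simp add: norm_eq_1)
  have D_ht: "real i < e \<bullet> x \<and> e \<bullet> x < real i + 1" if "x \<in> D i" for x i
  proof -
    have "\<bar>e \<bullet> (x - (real i + 1 / 2) *\<^sub>R e)\<bar> \<le> norm e * norm (x - (real i + 1 / 2) *\<^sub>R e)"
      by (rule Cauchy_Schwarz_ineq2)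
    also have "\<dots> < 1 / 2" using that e(2) by (simp add: D_def dist_norm norm_minus_commute)
    finally have "\<bar>e \<bullet> x - (real i + 1 / 2)\<bar> < 1 / 2" by (simp add: inner_diff_right ee)
    then show ?thesis by linarith
  qed
  have D_inj: "i = j" if "x \<in> D i" "y \<in> D j" "e \<bullet> x = e \<bullet> y" for x y i j
    using D_ht[OF that(1)] D_ht[OF that(2)] that(3) by linarith
  have "ennreal (real N / 256) = (\<Sum>i<N. ennreal (1 / 256))"
    by (simp add: ennreal_of_nat_eq_real_of_nat ennreal_mult[symmetric] del: ennreal_numeral)
  also have "\<dots> \<le> (\<Sum>i<N. emeasure (vol n) (D i))"
    unfolding D_def by (intro sum_mono vol_ball_ge subspace_scale[OF subspace_RR_plus] e)
  also have "\<dots> = emeasure (vol n) K"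
    unfolding K_def
  proof (rule sum_emeasure)
    show "disjoint_family_on D {..<N}"
      using D_inj by (auto simp: disjoint_family_on_def)
  qed (auto simp: D_def)
  also have "\<dots> = emeasure (vol n) (K \<inter> RR_plus n)"
    by (rule vol_inter_RR_plus[symmetric]) (auto simp: K_def D_def)
  also have "\<dots> \<le> emeasure (vol n) {\<Sum>b\<in>B. t b *\<^sub>R b | t. \<forall>b\<in>B. 0 \<le> t b \<and> t b < 1}"
  proof (rule emeasure_parallelepiped_ge[OF B])
    have "K \<in> sets borel" by (auto simp: K_def D_def)
    then show "K \<inter> RR_plus n \<in> sets borel" using borel_closed[OF closed_RR_plus] by (rule sets.Int)
    have "bounded K" by (auto simp: K_def D_def)
    then show "bounded (K \<inter> RR_plus n)" by (rule bounded_subset) auto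
    show "K \<inter> RR_plus n \<subseteq> RR_plus n" by auto
    fix c x assume c: "\<exists>b\<in>B. c b \<noteq> 0" and "x \<in> K \<inter> RR_plus n"
      and "x + (\<Sum>b\<in>B. of_int (c b) *\<^sub>R b) \<in> K \<inter> RR_plus n"
    define v where "v = (\<Sum>b\<in>B. of_int (c b) *\<^sub>R b)"
    obtain i j where ij: "x \<in> D i" "i < N" "x + v \<in> D j" "j < N"
      using \<open>x \<in> K \<inter> RR_plus n\<close> \<open>x + _ \<in> _\<close> by (auto simp: K_def v_def)
    have "0 < e \<bullet> x" "e \<bullet> x < N" using D_ht[OF ij(1)] ij(2) by linarith+
    moreover have "0 < e \<bullet> x + e \<bullet> v" "e \<bullet> x + e \<bullet> v < N"
      using D_ht[OF ij(3)] ij(4) unfolding inner_add_right by linarith+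
    ultimately have "\<bar>e \<bullet> v\<bar> < h" using N by linarith
    moreover have "e \<bullet> v = 0 \<and> 1 \<le> norm v \<or> h \<le> \<bar>e \<bullet> v\<bar>" using far[OF c] by (simp add: v_def Let_def)
    ultimately have v: "e \<bullet> v = 0" "1 \<le> norm v" by auto
    then have "i = j" using D_inj[OF ij(1,3)] by (simp add: inner_add_right)
    then have "dist x (x + v) < 1"
      using dist_triangle_half_r[of "(real i + 1 / 2) *\<^sub>R e" x 1 "x + v"] ij by (simp add: D_def)
    then show False using v by (simp add: dist_norm)
  qed
  finally show ?thesis .
qed

lemma infsum_emeasure_disjoint_le:
  assumes "\<And>i. i \<in> I \<Longrightarrow> A i \<in> sets M" "disjoint_family_on A I"
    "\<And>i. i \<in> I \<Longrightarrow> A i \<subseteq> S" "S \<in> sets M"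
  shows "(\<Sum>\<^sub>\<infinity>i\<in>I. emeasure M (A i)) \<le> emeasure M S"
proof (rule infsum_le_finite_sums)
  show "(\<lambda>i. emeasure M (A i)) summable_on I" by (rule nonneg_summable_on_complete) simp
  fix F assume F: "finite F" "F \<subseteq> I"
  have "(\<Sum>i\<in>F. emeasure M (A i)) = emeasure M (\<Union>i\<in>F. A i)"
    using assms F by (intro sum_emeasure) (auto intro: disjoint_family_on_mono)
  also have "\<dots> \<le> emeasure M S" using assms F by (intro emeasure_mono) auto
  finally show "(\<Sum>i\<in>F. emeasure M (A i)) \<le> emeasure M S" .
qed

section \<open>Discrete subgroups and Gram determinants\<close>

abbreviation int_combs :: "'i set \<Rightarrow> ('i \<Rightarrow> 'a::real_vector) \<Rightarrow> 'a set" where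
  "int_combs B f \<equiv> {\<Sum>b\<in>B. of_int (c b) *\<^sub>R f b | c :: 'i \<Rightarrow> int. True}"

lemma int_combs_I:
  fixes c :: "'i \<Rightarrow> int"
  assumes "x = (\<Sum>b\<in>B. of_int (c b) *\<^sub>R f b)" shows "x \<in> int_combs B f"
  using assms by blast

lemma of_int_mult_quat: "of_int k * b = (of_int k :: real) *\<^sub>R b" for b :: quat
  by (metis of_real_of_int_eq scaleR_conv_of_real)

lemma zspan_eq:
  assumes "finite B" shows "zspan B = int_combs B (\<lambda>b. b)"
proof (intro equalityI subsetI)
  fix x assume "x \<in> zspan B"
  then obtain T and c :: "quat \<Rightarrow> int" where T: "finite T" "T \<subseteq> B" "x = (\<Sum>b\<in>T. of_int (c b) *\<^sub>R b)"
    by (auto simp: zspan_def of_int_mult_quat)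
  have "x = (\<Sum>b\<in>B. of_int (if b \<in> T then c b else 0) *\<^sub>R b)"
    unfolding T(3) using T(2) assms by (intro sum.mono_neutral_cong_left) auto
  then show "x \<in> int_combs B (\<lambda>b. b)" by (rule int_combs_I)
next
  fix x assume "x \<in> int_combs B (\<lambda>b. b)"
  then obtain c :: "quat \<Rightarrow> int" where "x = (\<Sum>b\<in>B. of_int (c b) * b)" by (auto simp: of_int_mult_quat)
  then show "x \<in> zspan B" unfolding zspan_def using assms by blast
qed

locale discrete_group =
  fixes M :: "quat set"
  assumes M_0: "0 \<in> M" and M_diff: "\<And>x y. x \<in> M \<Longrightarrow> y \<in> M \<Longrightarrow> x - y \<in> M"
    and M_norm: "\<And>x. x \<in> M \<Longrightarrow> x \<noteq> 0 \<Longrightarrow> 1 \<le> norm x"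
begin

lemma M_uminus: "x \<in> M \<Longrightarrow> - x \<in> M" using M_diff[OF M_0, of x] by simp
lemma M_add: "x \<in> M \<Longrightarrow> y \<in> M \<Longrightarrow> x + y \<in> M" using M_diff[of x "- y"] M_uminus by simp

lemma M_scale_int: "x \<in> M \<Longrightarrow> (of_int k :: real) *\<^sub>R x \<in> M"
proof (induction k rule: int_induct[where k = 0])
  case base
  then show ?case by (simp add: M_0)
next
  case (step1 i)
  then show ?case using M_add[of "of_int i *\<^sub>R x" x] by (simp add: algebra_simps)
next
  case (step2 i)
  then show ?case using M_diff[of "of_int i *\<^sub>R x" x] by (simp add: algebra_simps)
qed

lemma M_sum: "(\<And>i. i \<in> I \<Longrightarrow> v i \<in> M) \<Longrightarrow> (\<Sum>i\<in>I. of_int (k i) *\<^sub>R v i) \<in> M"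
  by (induction I rule: infinite_finite_induct) (auto simp: M_0 M_add M_scale_int)

lemma finite_ball: "finite (M \<inter> cball 0 r)"
proof -
  have "x = y" if "x \<in> M" "y \<in> M" "dist x y < 1" for x y
    using M_norm[of "x - y"] M_diff that by (force simp: dist_norm)
  then have "uniform_discrete (M \<inter> cball 0 r)"
    unfolding uniform_discrete_def by (intro exI[of _ 1]) auto
  moreover have "bounded (M \<inter> cball 0 r)" by (rule bounded_subset[of "cball 0 r"]) auto
  ultimately show ?thesis using uniform_discrete_finite_iff by blast
qed

lemma remainder_ball:
  assumes "finite B" "B \<subseteq> M" "x \<in> M" "x = (\<Sum>b\<in>B. t b *\<^sub>R b)"
  shows "x - (\<Sum>b\<in>B. of_int \<lfloor>t b\<rfloor> *\<^sub>R b) \<in> M \<inter> cball 0 (\<Sum>b\<in>B. norm b)"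
proof -
  have "x - (\<Sum>b\<in>B. of_int \<lfloor>t b\<rfloor> *\<^sub>R b) \<in> M"
    using assms by (intro M_diff M_sum) auto
  moreover have "norm (x - (\<Sum>b\<in>B. of_int \<lfloor>t b\<rfloor> *\<^sub>R b)) \<le> (\<Sum>b\<in>B. norm b)"
  proof -
    have "x - (\<Sum>b\<in>B. of_int \<lfloor>t b\<rfloor> *\<^sub>R b) = (\<Sum>b\<in>B. (t b - of_int \<lfloor>t b\<rfloor>) *\<^sub>R b)"
      unfolding assms(4) by (simp add: scaleR_diff_left sum_subtractf)
    also have "norm \<dots> \<le> (\<Sum>b\<in>B. norm ((t b - of_int \<lfloor>t b\<rfloor>) *\<^sub>R b))" by (rule norm_sum)
    also have "\<dots> \<le> (\<Sum>b\<in>B. norm b)"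
    proof (rule sum_mono)
      fix b :: quat
      have "\<bar>t b - of_int \<lfloor>t b\<rfloor>\<bar> \<le> 1" by linarith
      then show "norm ((t b - of_int \<lfloor>t b\<rfloor>) *\<^sub>R b) \<le> norm b"
        using mult_right_mono[of "\<bar>t b - of_int \<lfloor>t b\<rfloor>\<bar>" 1 "norm b"] by simp
    qed
    finally show ?thesis .
  qed
  ultimately show ?thesis by simp
qed

text \<open>Round down the coordinates with respect to a maximal independent subset: what remains is
  one of the finitely many elements of a ball, and these are added to the generators.\<close>

lemma finitely_generated:
  obtains F where "finite F" "M = int_combs F (\<lambda>b. b)"
proof -
  obtain B where B: "B \<subseteq> M" "independent B" "M \<subseteq> span B" by (rule maximal_independent_subset)
  have finB: "finite B" using B(2) by (rule independent_imp_finite)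
  define F where "F = B \<union> (M \<inter> cball 0 (\<Sum>b\<in>B. norm b))"
  have finF: "finite F" using finB finite_ball by (simp add: F_def)
  have "M = int_combs F (\<lambda>b. b)"
  proof (intro equalityI subsetI)
    fix x assume "x \<in> int_combs F (\<lambda>b. b)"
    then show "x \<in> M" using B(1) by (auto simp: F_def intro: M_sum)
  next
    fix x assume x: "x \<in> M"
    then obtain t where t: "x = (\<Sum>b\<in>B. t b *\<^sub>R b)" using B(3) finB by (auto simp: span_finite)
    define r where "r = x - (\<Sum>b\<in>B. of_int \<lfloor>t b\<rfloor> *\<^sub>R b)"
    have r: "r \<in> F" using remainder_ball[OF finB B(1) x t] by (simp add: F_def r_def)
    have "(\<Sum>b\<in>F. of_int ((if b \<in> B then \<lfloor>t b\<rfloor> else 0) + (if b = r then 1 else 0)) *\<^sub>R b)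
        = (\<Sum>b\<in>F. of_int (if b \<in> B then \<lfloor>t b\<rfloor> else 0) *\<^sub>R b) + (\<Sum>b\<in>F. of_int (if b = r then 1 else 0) *\<^sub>R b)"
      by (simp add: scaleR_add_left sum.distrib)
    also have "(\<Sum>b\<in>F. of_int (if b \<in> B then \<lfloor>t b\<rfloor> else 0) *\<^sub>R b) = (\<Sum>b\<in>B. of_int \<lfloor>t b\<rfloor> *\<^sub>R b)"
      using finF by (intro sum.mono_neutral_cong_right) (auto simp: F_def)
    also have "(\<Sum>b\<in>F. of_int (if b = r then 1 else 0) *\<^sub>R b) = (\<Sum>b\<in>F. if b = r then b else 0)"
      by (rule sum.cong) auto
    also have "\<dots> = r" using r finF by simp
    finally have "x = (\<Sum>b\<in>F. of_int ((if b \<in> B then \<lfloor>t b\<rfloor> else 0) + (if b = r then 1 else 0)) *\<^sub>R b)"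
      by (simp add: r_def)
    then show "x \<in> int_combs F (\<lambda>b. b)" by (rule int_combs_I)
  qed
  then show thesis using that finF by blast
qed

text \<open>A generating family of minimal size is free: otherwise take a nontrivial relation with
  minimal sum of absolute values and apply one step of the Euclidean algorithm to it.\<close>

definition gens :: "nat set \<Rightarrow> (nat \<Rightarrow> quat) \<Rightarrow> bool" where
  "gens I v \<longleftrightarrow> finite I \<and> M = int_combs I v"

lemma gens_drop:
  assumes "gens I v" "i \<in> I" "v i = 0"
  shows "gens (I - {i}) v"
proof -
  have eq: "(\<Sum>j\<in>I. of_int (k j) *\<^sub>R v j) = (\<Sum>j\<in>I - {i}. of_int (k j) *\<^sub>R v j)" for k :: "nat \<Rightarrow> int"
    using assms by (simp add: gens_def sum.remove)
  have "M = int_combs I v" using assms by (simp only: gens_def)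
  also have "\<dots> = int_combs (I - {i}) v" by (simp only: eq)
  finally show ?thesis using assms unfolding gens_def by blast
qed

text \<open>Adding a multiple of \<open>v i\<close> to \<open>v j\<close> is compensated in the
  coefficient of \<open>v i\<close>. This is the step of the Euclidean algorithm, performed on a
  relation.\<close>

lemma sum_add_multiple:
  fixes k :: "nat \<Rightarrow> int"
  assumes "finite I" "i \<in> I" "j \<in> I" "i \<noteq> j"
  shows "(\<Sum>l\<in>I. of_int ((k(i := k i - s * k j)) l) *\<^sub>R (v(j := v j + of_int s *\<^sub>R v i)) l)
    = (\<Sum>l\<in>I. of_int (k l) *\<^sub>R (v l :: quat))"
proof -
  have "(\<Sum>l\<in>I. of_int ((k(i := k i - s * k j)) l) *\<^sub>R (v(j := v j + of_int s *\<^sub>R v i)) l)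
    = (\<Sum>l\<in>I. of_int (k l) *\<^sub>R v l + (if l = i then - of_int (s * k j) *\<^sub>R v i else 0)
         + (if l = j then of_int (s * k j) *\<^sub>R v i else 0))"
    using assms(4) by (intro sum.cong refl) (auto simp: algebra_simps)
  also have "\<dots> = (\<Sum>l\<in>I. of_int (k l) *\<^sub>R v l)"
    using assms by (simp add: sum.distrib)
  finally show ?thesis .
qed

lemma gens_add_multiple:
  assumes g: "gens I v" and ij: "i \<in> I" "j \<in> I" "i \<noteq> j"
  shows "gens I (v(j := v j + of_int s *\<^sub>R v i))"
proof -
  let ?v = "v(j := v j + of_int s *\<^sub>R v i)"
  have fin: "finite I" using g by (simp add: gens_def)
  have vM: "v l \<in> M" if "l \<in> I" for l
  proof -
    have "(\<Sum>m\<in>I. of_int (if m = l then 1 else 0) *\<^sub>R v m) = (\<Sum>m\<in>I. if m = l then v m else 0)"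
      by (rule sum.cong) auto
    also have "\<dots> = v l" using that fin by simp
    finally have "v l = (\<Sum>m\<in>I. of_int (if m = l then 1 else 0) *\<^sub>R v m)" by simp
    then have "v l \<in> int_combs I v" by (rule int_combs_I)
    then show ?thesis using g unfolding gens_def by blast
  qed
  have "M = int_combs I ?v"
  proof (intro equalityI subsetI)
    fix x assume "x \<in> M"
    then obtain k :: "nat \<Rightarrow> int" where "x = (\<Sum>l\<in>I. of_int (k l) *\<^sub>R v l)" using g by (auto simp: gens_def)
    then have "x = (\<Sum>l\<in>I. of_int ((k(i := k i - s * k j)) l) *\<^sub>R ?v l)"
      using sum_add_multiple[OF fin ij, of k s v] by simp
    then show "x \<in> int_combs I ?v" by (rule int_combs_I)
  next
    fix x assume "x \<in> int_combs I ?v"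
    then obtain k :: "nat \<Rightarrow> int" where k: "x = (\<Sum>l\<in>I. of_int (k l) *\<^sub>R ?v l)" by blast
    have "?v l \<in> M" if "l \<in> I" for l using vM that ij by (auto intro!: M_add M_scale_int)
    then show "x \<in> M" unfolding k by (rule M_sum)
  qed
  then show ?thesis using fin unfolding gens_def by blast
qed

lemma exists_free_gens:
  "\<exists>I v. gens I v \<and> (\<forall>c :: nat \<Rightarrow> int. (\<Sum>i\<in>I. of_int (c i) *\<^sub>R v i) = 0 \<longrightarrow> (\<forall>i\<in>I. c i = 0))"
proof -
  obtain F where F: "finite F" "M = int_combs F (\<lambda>b. b)"
    by (rule finitely_generated)
  have "\<exists>I v. gens I v"
  proof -
    obtain n and v :: "nat \<Rightarrow> quat" where v: "F = v ` {i. i < n}" "inj_on v {i. i < n}"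
      using finite_imp_nat_seg_image_inj_on[OF F(1)] by blast
    have "M = int_combs {i. i < n} v"
    proof (intro equalityI subsetI)
      fix x assume "x \<in> M"
      then obtain c :: "quat \<Rightarrow> int" where "x = (\<Sum>b\<in>F. of_int (c b) *\<^sub>R b)" using F(2) by blast
      then have "x = (\<Sum>i\<in>{i. i < n}. of_int ((c \<circ> v) i) *\<^sub>R v i)"
        unfolding v(1) by (simp add: sum.reindex[OF v(2)])
      then show "x \<in> int_combs {i. i < n} v" by (rule int_combs_I)
    next
      fix x assume "x \<in> int_combs {i. i < n} v"
      then obtain k :: "nat \<Rightarrow> int" where k: "x = (\<Sum>i\<in>{i. i < n}. of_int (k i) *\<^sub>R v i)" by blast
      have "x = (\<Sum>b\<in>F. of_int (k (inv_into {i. i < n} v b)) *\<^sub>R b)"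
        unfolding v(1) k sum.reindex[OF v(2)] by (rule sum.cong) (simp_all add: inv_into_f_f[OF v(2)])
      then show "x \<in> M" unfolding F(2) by (rule int_combs_I)
    qed
    then have "gens {i. i < n} v" unfolding gens_def by simp
    then show ?thesis by blast
  qed
  then obtain I v where "gens I v" by blast
  define m where "m = (LEAST m. \<exists>I v. gens I v \<and> card I = m)"
  have m_ex: "\<exists>I v. gens I v \<and> card I = m"
    unfolding m_def by (rule LeastI_ex) (use \<open>gens I v\<close> in blast)
  have m_min: "m \<le> card I" if "gens I v" for I v
    unfolding m_def by (rule Least_le) (use that in blast)
  have no_rel: False
    if "gens I v" "card I = m" "(\<Sum>i\<in>I. of_int (c i) *\<^sub>R v i) = 0" "\<exists>i\<in>I. c i \<noteq> 0"
    for I v and c :: "nat \<Rightarrow> int"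
    using that
  proof (induction "nat (\<Sum>i\<in>I. \<bar>c i\<bar>)" arbitrary: v c rule: less_induct)
    case less
    have fin: "finite I" using less.prems by (simp add: gens_def)
    obtain i where i: "i \<in> I" "c i \<noteq> 0" using less.prems by blast
    show False
    proof (cases "\<exists>j\<in>I. j \<noteq> i \<and> c j \<noteq> 0")
      case False
      \<comment> \<open>A relation with one nonzero coefficient makes that generator 0, and dropping
        it contradicts the minimal size.\<close>
      then have "(\<Sum>l\<in>I. of_int (c l) *\<^sub>R v l) = (\<Sum>l\<in>I. if l = i then of_int (c l) *\<^sub>R v l else 0)"
        by (intro sum.cong) auto
      then have "of_int (c i) *\<^sub>R v i = 0" using less.prems(3) i fin by simp
      then have "gens (I - {i}) v" using gens_drop[OF less.prems(1) i(1)] i(2) by simp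
      then have "m \<le> card (I - {i})" by (rule m_min)
      then show False using i(1) fin less.prems(2) by (metis card_Diff1_less not_le)
    next
      case True
      have step: False if ij: "i \<in> I" "j \<in> I" "i \<noteq> j" "c j \<noteq> 0" "\<bar>c j\<bar> \<le> \<bar>c i\<bar>" for i j
      proof -
        \<comment> \<open>With this sign the larger coefficient shrinks by the absolute value of the
          smaller one, while the smaller one survives and keeps the relation nontrivial.\<close>
        define s where "s = sgn (c i) * sgn (c j)"
        have "\<bar>c i - s * c j\<bar> < \<bar>c i\<bar>"
          using ij(4,5) unfolding s_def by (auto simp: sgn_if split: if_splits)
        then have lt: "(\<Sum>l\<in>I. \<bar>(c(i := c i - s * c j)) l\<bar>) < (\<Sum>l\<in>I. \<bar>c l\<bar>)"
          using ij fin by (intro sum_strict_mono_ex1) auto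
        have nz: "\<exists>l\<in>I. (c(i := c i - s * c j)) l \<noteq> 0" using ij by (intro bexI[of _ j]) auto
        have rel: "(\<Sum>l\<in>I. of_int ((c(i := c i - s * c j)) l) *\<^sub>R (v(j := v j + of_int s *\<^sub>R v i)) l) = 0"
          using sum_add_multiple[OF fin ij(1-3), of c s v] less.prems(3) by simp
        show False
        proof (rule less.hyps[OF _ gens_add_multiple[OF less.prems(1) ij(1-3)] less.prems(2) rel nz])
          show "nat (\<Sum>l\<in>I. \<bar>(c(i := c i - s * c j)) l\<bar>) < nat (\<Sum>l\<in>I. \<bar>c l\<bar>)"
            using lt by (subst nat_mono_iff) (auto intro: le_less_trans[OF sum_nonneg lt])
        qed
      qed
      from True obtain j where "j \<in> I" "j \<noteq> i" "c j \<noteq> 0" by blast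
      then show False using step[of i j] step[of j i] i by linarith
    qed
  qed
  obtain J w where Jw: "gens J w" "card J = m" using m_ex by blast
  then show ?thesis using no_rel[OF Jw] by blast
qed

lemma exists_zbasis: "\<exists>B. zbasis B M"
proof -
  obtain I v where g: "gens I v"
    and free: "\<And>c :: nat \<Rightarrow> int. (\<Sum>i\<in>I. of_int (c i) *\<^sub>R v i) = 0 \<Longrightarrow> \<forall>i\<in>I. c i = 0"
    using exists_free_gens by blast
  have fin: "finite I" using g by (simp add: gens_def)
  \<comment> \<open>\<open>zbasis\<close> speaks of sets, so repetitions in the family must be
    excluded; one would give the relation \<open>v i - v j = 0\<close>.\<close>
  have inj: "inj_on v I"
  proof (rule inj_onI, rule ccontr)
    fix i j assume ij: "i \<in> I" "j \<in> I" "v i = v j" "i \<noteq> j"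
    have "(\<Sum>l\<in>I. of_int ((if l = i then 1 else 0) - (if l = j then 1 else 0)) *\<^sub>R v l)
      = (\<Sum>l\<in>I. (if l = i then v l else 0) - (if l = j then v l else 0))"
      by (rule sum.cong) auto
    also have "\<dots> = 0" using ij fin by (simp add: sum_subtractf)
    finally show False using free[of "\<lambda>l. (if l = i then 1 else 0) - (if l = j then 1 else 0)"] ij by auto
  qed
  have "zspan (v ` I) = M"
  proof -
    have "zspan (v ` I) = {\<Sum>i\<in>I. of_int (c (v i)) *\<^sub>R v i | c :: quat \<Rightarrow> int. True}"
      using fin by (simp add: zspan_eq sum.reindex[OF inj])
    also have "\<dots> = int_combs I v"
    proof (intro equalityI subsetI)
      fix x assume "x \<in> int_combs I v"
      then obtain k :: "nat \<Rightarrow> int" where k: "x = (\<Sum>i\<in>I. of_int (k i) *\<^sub>R v i)" by blast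
      have "x = (\<Sum>i\<in>I. of_int ((k \<circ> inv_into I v) (v i)) *\<^sub>R v i)"
        unfolding k by (rule sum.cong) (simp_all add: inv_into_f_f[OF inj])
      then have "\<exists>c :: quat \<Rightarrow> int. x = (\<Sum>i\<in>I. of_int (c (v i)) *\<^sub>R v i)"
        by - (rule exI[where x = "k \<circ> inv_into I v"])
      then show "x \<in> {\<Sum>i\<in>I. of_int (c (v i)) *\<^sub>R v i | c :: quat \<Rightarrow> int. True}" by blast
    next
      fix x assume "x \<in> {\<Sum>i\<in>I. of_int (c (v i)) *\<^sub>R v i | c :: quat \<Rightarrow> int. True}"
      then obtain c :: "quat \<Rightarrow> int" where "x = (\<Sum>i\<in>I. of_int ((c \<circ> v) i) *\<^sub>R v i)" by auto
      then show "x \<in> int_combs I v" by (rule int_combs_I)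
    qed
    finally show ?thesis using g by (simp add: gens_def)
  qed
  moreover have "\<forall>b\<in>v ` I. c b = 0" if "(\<Sum>b\<in>v ` I. of_int (c b) * b) = 0" for c :: "quat \<Rightarrow> int"
    using free[of "c \<circ> v"] that by (auto simp: sum.reindex[OF inj] of_int_mult_quat)
  ultimately show ?thesis using fin unfolding zbasis_def by blast
qed

lemma zbasis_span: "zbasis B M \<Longrightarrow> M \<subseteq> span B"
  by (auto simp: zbasis_def zspan_eq intro!: span_sum span_scale intro: span_base)

lemma zbasis_subset:
  assumes "zbasis B M" shows "B \<subseteq> M"
proof
  fix b assume b: "b \<in> B"
  have fin: "finite B" using assms by (simp add: zbasis_def)
  have "(\<Sum>x\<in>B. of_int (if x = b then 1 else 0) *\<^sub>R x) = (\<Sum>x\<in>B. if x = b then x else 0)"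
    by (rule sum.cong) auto
  also have "\<dots> = b" using b fin by simp
  finally have "b \<in> zspan B" unfolding zspan_eq[OF fin] by (intro int_combs_I[where c = "\<lambda>x. if x = b then 1 else 0"]) simp
  then show "b \<in> M" using assms by (simp add: zbasis_def)
qed

text \<open>Pigeonhole: the remainders of the multiples of \<open>b\<close> lie in a finite set.\<close>

lemma zbasis_independent:
  assumes "zbasis B M" shows "independent B"
proof -
  have fin: "finite B" using assms by (simp add: zbasis_def)
  obtain B1 where B1: "B1 \<subseteq> B" "independent B1" "B \<subseteq> span B1" by (rule maximal_independent_subset)
  have finB1: "finite B1" using B1(1) fin by (rule finite_subset)
  have B1M: "B1 \<subseteq> M" using B1(1) zbasis_subset[OF assms] by blast
  have "B \<subseteq> B1"
  proof
    fix b assume b: "b \<in> B"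
    show "b \<in> B1"
    proof (rule ccontr)
      assume nb: "b \<notin> B1"
      obtain t where t: "b = (\<Sum>c\<in>B1. t c *\<^sub>R c)" using b B1(3) finB1 by (auto simp: span_finite)
      define r where "r k = of_int (int k) *\<^sub>R b - (\<Sum>c\<in>B1. of_int \<lfloor>real k * t c\<rfloor> *\<^sub>R c)" for k :: nat
      have "r k \<in> M \<inter> cball 0 (\<Sum>c\<in>B1. norm c)" for k
        unfolding r_def
      proof (rule remainder_ball[OF finB1 B1M])
        show "of_int (int k) *\<^sub>R b \<in> M" using b zbasis_subset[OF assms] M_scale_int by blast
        show "of_int (int k) *\<^sub>R b = (\<Sum>c\<in>B1. (real k * t c) *\<^sub>R c)" by (subst t) (simp add: scaleR_sum_right)
      qed
      then have "range r \<subseteq> M \<inter> cball 0 (\<Sum>c\<in>B1. norm c)" by blast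
      then have "finite (range r)" by (rule finite_subset[OF _ finite_ball])
      then have "\<not> inj r" using finite_imageD[of r UNIV] infinite_UNIV_nat by auto
      \<comment> \<open>Equal remainders of two multiples of \<open>b\<close> give an integral
        relation in which \<open>b\<close> has the coefficient \<open>k - l\<close>.\<close>
      then obtain k l where kl: "r k = r l" "k \<noteq> l" by (auto simp: inj_on_def)
      define c where "c x = (if x = b then int k - int l else if x \<in> B1 then \<lfloor>real l * t x\<rfloor> - \<lfloor>real k * t x\<rfloor> else 0)" for x
      have "(\<Sum>x\<in>B. of_int (c x) *\<^sub>R x) = of_int (c b) *\<^sub>R b + (\<Sum>x\<in>B - {b}. of_int (c x) *\<^sub>R x)"
        by (rule sum.remove[OF fin b])
      also have "(\<Sum>x\<in>B - {b}. of_int (c x) *\<^sub>R x) = (\<Sum>x\<in>B1. of_int (\<lfloor>real l * t x\<rfloor> - \<lfloor>real k * t x\<rfloor>) *\<^sub>R x)"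
        using fin B1(1) nb by (intro sum.mono_neutral_cong_right) (auto simp: c_def)
      also have "of_int (c b) *\<^sub>R b + \<dots> = r k - r l"
        by (simp add: c_def r_def scaleR_diff_left sum_subtractf)
      finally have "(\<Sum>x\<in>B. of_int (c x) *\<^sub>R x) = 0" using kl by simp
      then have "c b = 0" using assms b by (simp add: zbasis_def of_int_mult_quat)
      then show False using kl by (simp add: c_def)
    qed
  qed
  then show ?thesis using B1 by (metis subset_antisym)
qed

end

subsection \<open>Gram determinants\<close>

text \<open>\<open>gram_det\<close> is indexed by the basis itself; indexing by a finite type makes
  the theory of \<open>det\<close> applicable.\<close>

lemma gram_det_reindex:
  fixes e :: "'k::finite \<Rightarrow> quat"
  assumes e: "bij_betw e UNIV B"
  shows "gram_det B = det ((\<chi> i j. tr (e i * qcnj (e j))) :: real^'k^'k)"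
proof -
  let ?m = "map_permutation UNIV e"
  have inj: "inj e" using e by (simp add: bij_betw_def)
  have B: "B = range e" using e by (simp add: bij_betw_def)
  have e': "bij_betw (inv_into UNIV e) B UNIV" by (rule bij_betw_inv_into[OF e])
  have bij: "bij_betw ?m {p. p permutes UNIV} {p. p permutes B}"
  proof (rule bij_betw_byWitness[where f' = "map_permutation B (inv_into UNIV e)"])
    show "\<forall>p\<in>{p. p permutes UNIV}. map_permutation B (inv_into UNIV e) (?m p) = p"
      using e inj by (auto intro!: map_permutation_compose_inv)
    show "\<forall>p\<in>{p. p permutes B}. ?m (map_permutation B (inv_into UNIV e) p) = p"
      using e' B by (auto intro!: map_permutation_compose_inv simp: f_inv_into_f)
    show "?m ` {p. p permutes UNIV} \<subseteq> {p. p permutes B}"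
      using map_permutation_permutes[OF e] by auto
    show "map_permutation B (inv_into UNIV e) ` {p. p permutes B} \<subseteq> {p. p permutes UNIV}"
      using map_permutation_permutes[OF e'] by auto
  qed
  have "gram_det B = (\<Sum>p\<in>{p. p permutes UNIV}. of_int (sign (?m p)) * (\<Prod>x\<in>B. tr (x * qcnj (?m p x))))"
    unfolding gram_det_def by (rule sum.reindex_bij_betw[OF bij, symmetric])
  also have "\<dots> = (\<Sum>p\<in>{p. p permutes UNIV}. of_int (sign p) * (\<Prod>i\<in>UNIV. tr (e i * qcnj (e (p i)))))"
  proof (rule sum.cong[OF refl])
    fix p :: "'k \<Rightarrow> 'k" assume "p \<in> {p. p permutes UNIV}"
    then have p: "p permutes UNIV" by simp
    have "(\<Prod>x\<in>B. tr (x * qcnj (?m p x))) = (\<Prod>i\<in>UNIV. tr (e i * qcnj (?m p (e i))))"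
      unfolding B by (simp add: prod.reindex[OF inj])
    moreover have "?m p (e i) = e (p i)" for i
      using inj by (intro map_permutation_apply) auto
    moreover have "sign (?m p) = sign p" using p inj by (intro sign_map_permutation) auto
    ultimately show "of_int (sign (?m p)) * (\<Prod>x\<in>B. tr (x * qcnj (?m p x)))
      = real_of_int (sign p) * (\<Prod>i\<in>UNIV. tr (e i * qcnj (e (p i))))" by simp
  qed
  finally show ?thesis by (simp add: det_def)
qed

lemma tr_eq_inner: "tr (x * qcnj y) = 2 * (x \<bullet> y)"
  by (simp add: inner_eq_tr)

text \<open>A kernel vector of the Gram matrix gives a combination of the \<open>f j\<close> that is
  orthogonal to every \<open>f i\<close>, hence to itself.\<close>

lemma gram_det_nonzero:
  fixes f :: "'k::finite \<Rightarrow> quat"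
  assumes "inj f" "independent (range f)"
  shows "det ((\<chi> i j. tr (f i * qcnj (f j))) :: real^'k^'k) \<noteq> 0"
proof
  let ?G = "(\<chi> i j. tr (f i * qcnj (f j))) :: real^'k^'k"
  assume "det ?G = 0"
  then obtain c where c: "c \<noteq> 0" "?G *v c = 0"
    by (metis invertible_det_nz invertible_left_inverse matrix_left_invertible_ker)
  define s where "s = (\<Sum>j\<in>UNIV. c $ j *\<^sub>R f j)"
  have "f i \<bullet> s = 0" for i
  proof -
    have "2 * (f i \<bullet> s) = (?G *v c) $ i"
      by (simp add: s_def matrix_vector_mult_def tr_eq_inner inner_sum_right sum_distrib_left algebra_simps)
    then show ?thesis using c(2) by simp
  qed
  then have "s \<bullet> s = 0" by (subst (1) s_def) (simp add: inner_sum_left)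
  then have "s = 0" by simp
  have "c $ i = 0" for i
  proof -
    have "(\<Sum>x\<in>range f. c $ (inv_into UNIV f x) *\<^sub>R x) = s"
      unfolding s_def by (simp add: sum.reindex[OF assms(1)] inv_into_f_f[OF assms(1)])
    then have "c $ (inv_into UNIV f (f i)) = 0"
      using independentD[OF assms(2), of "range f" "\<lambda>x. c $ (inv_into UNIV f x)" "f i"] \<open>s = 0\<close> by simp
    then show ?thesis using inv_into_f_f[OF assms(1)] by simp
  qed
  then show False using c(1) by (simp add: vec_eq_iff)
qed

lemma det_of_int_matrix: "det ((\<chi> i j. of_int (A i j)) :: real^'k^'k) \<in> \<int>" for A :: "'k::finite \<Rightarrow> 'k \<Rightarrow> int"
  unfolding det_def by (intro Ints_sum Ints_mult Ints_prod) auto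

lemma abs_det_le:
  fixes A :: "real^'k^'k::finite"
  assumes "\<And>i j. \<bar>A $ i $ j\<bar> \<le> r" "0 \<le> r"
  shows "\<bar>det A\<bar> \<le> fact CARD('k) * r ^ CARD('k)"
proof -
  have "\<bar>det A\<bar> \<le> (\<Sum>p\<in>{p. p permutes (UNIV :: 'k set)}. \<bar>of_int (sign p) * (\<Prod>i\<in>UNIV. A $ i $ p i)\<bar>)"
    unfolding det_def by (rule sum_abs)
  also have "\<dots> \<le> (\<Sum>p\<in>{p. p permutes (UNIV :: 'k set)}. r ^ CARD('k))"
  proof (rule sum_mono)
    fix p :: "'k \<Rightarrow> 'k"
    have "\<bar>real_of_int (sign p)\<bar> = 1" by (simp add: sign_def)
    then have "\<bar>of_int (sign p) * (\<Prod>i\<in>UNIV. A $ i $ p i)\<bar> = (\<Prod>i\<in>UNIV. \<bar>A $ i $ p i\<bar>)"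
      by (simp only: abs_mult abs_prod mult_1_left)
    also have "\<dots> \<le> (\<Prod>i\<in>(UNIV :: 'k set). r)" by (rule prod_mono) (use assms in auto)
    finally show "\<bar>of_int (sign p) * (\<Prod>i\<in>UNIV. A $ i $ p i)\<bar> \<le> r ^ CARD('k)" by simp
  qed
  also have "\<dots> = fact CARD('k) * r ^ CARD('k)"
    using card_permutations[of "UNIV :: 'k set" "CARD('k)"] by simp
  finally show ?thesis .
qed

text \<open>Writing \<open>f\<close> in the basis by an integral matrix \<open>A\<close> multiplies
  the Gram determinant by the square of \<open>det A\<close>, which is at least 1. So every full
  independent family bounds the discriminant, here through Leibniz' formula with entries at most 2
  r^2.\<close>

lemma (in discrete_group) gram_det_le:
  fixes f :: "'k::finite \<Rightarrow> quat"
  assumes B: "zbasis B M" and f: "inj f" "independent (range f)" "range f \<subseteq> M" "M \<subseteq> span (range f)"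
    and r: "\<And>i. norm (f i) \<le> r"
  shows "\<bar>gram_det B\<bar> \<le> fact CARD('k) * (2 * r\<^sup>2) ^ CARD('k)"
proof -
  have indB: "independent B" and finB: "finite B" and BM: "B \<subseteq> M"
    using zbasis_independent[OF B] B zbasis_subset[OF B] by (auto simp: zbasis_def)
  have "card B = dim M" using BM indB zbasis_span[OF B] by (simp add: basis_card_eq_dim)
  moreover have "card (range f) = dim M" using f by (intro basis_card_eq_dim)
  ultimately have "card B = CARD('k)" using card_image[OF f(1)] by simp
  then obtain e :: "'k \<Rightarrow> quat" where e: "bij_betw e UNIV B"
    using finite_same_card_bij[of "UNIV :: 'k set" B] finB by auto
  have "\<exists>k :: quat \<Rightarrow> int. f i = (\<Sum>b\<in>B. of_int (k b) *\<^sub>R b)" for i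
  proof -
    have "f i \<in> zspan B" using f(3) B by (auto simp: zbasis_def)
    then show ?thesis using zspan_eq[OF finB] by auto
  qed
  then obtain k :: "'k \<Rightarrow> quat \<Rightarrow> int" where k: "\<And>i. f i = (\<Sum>b\<in>B. of_int (k i b) *\<^sub>R b)" by metis
  define A where "A = ((\<chi> i j. of_int (k i (e j))) :: real^'k^'k)"
  have fe: "f i = (\<Sum>j\<in>UNIV. A $ i $ j *\<^sub>R e j)" for i :: 'k
    unfolding k A_def by (simp add: sum.reindex_bij_betw[OF e, of "\<lambda>b. of_int (k i b) *\<^sub>R b"])
  let ?Gf = "(\<chi> i j. tr (f i * qcnj (f j))) :: real^'k^'k" and ?Ge = "(\<chi> i j. tr (e i * qcnj (e j))) :: real^'k^'k"
  have "?Gf = A ** ?Ge ** transpose A"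
  proof -
    have "?Gf $ i $ j = (A ** ?Ge ** transpose A) $ i $ j" for i j
    proof -
      have "?Gf $ i $ j = 2 * ((\<Sum>l\<in>UNIV. A $ i $ l *\<^sub>R e l) \<bullet> (\<Sum>m\<in>UNIV. A $ j $ m *\<^sub>R e m))"
        by (simp only: vec_lambda_beta tr_eq_inner fe)
      also have "\<dots> = (\<Sum>m\<in>UNIV. \<Sum>l\<in>UNIV. 2 * (A $ i $ l * (A $ j $ m * (e l \<bullet> e m))))"
        unfolding inner_sum_left inner_sum_right inner_scaleR_left inner_scaleR_right sum_distrib_left
        by (intro sum.cong refl) (simp add: mult_ac)
      also have "\<dots> = (\<Sum>m\<in>UNIV. (\<Sum>l\<in>UNIV. A $ i $ l * (2 * (e l \<bullet> e m))) * A $ j $ m)"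
        unfolding sum_distrib_right by (intro sum.cong refl) (simp add: mult_ac)
      also have "\<dots> = (A ** ?Ge ** transpose A) $ i $ j"
        by (simp add: matrix_matrix_mult_def transpose_def tr_eq_inner)
      finally show ?thesis .
    qed
    then show ?thesis unfolding vec_eq_iff by blast
  qed
  then have "det ?Gf = det A * det ?Ge * det A" by (simp add: det_mul det_transpose)
  then have eq: "\<bar>det ?Gf\<bar> = \<bar>det A\<bar> * \<bar>det A\<bar> * \<bar>det ?Ge\<bar>" by (simp add: abs_mult)
  have "det A \<noteq> 0" using gram_det_nonzero[OF f(1,2)] \<open>det ?Gf = _\<close> by auto
  moreover have "det A \<in> \<int>" unfolding A_def by (rule det_of_int_matrix)
  ultimately have "1 \<le> \<bar>det A\<bar>" by (auto elim!: Ints_cases simp flip: of_int_abs)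
  then have "1 * 1 \<le> \<bar>det A\<bar> * \<bar>det A\<bar>" by (intro mult_mono) auto
  then have "\<bar>det ?Ge\<bar> \<le> \<bar>det ?Gf\<bar>"
    unfolding eq using mult_right_mono[of "1 * 1" "\<bar>det A\<bar> * \<bar>det A\<bar>" "\<bar>det ?Ge\<bar>"] by simp
  also have "\<bar>det ?Gf\<bar> \<le> fact CARD('k) * (2 * r\<^sup>2) ^ CARD('k)"
  proof (rule abs_det_le)
    fix i j :: 'k
    have "\<bar>f i \<bullet> f j\<bar> \<le> norm (f i) * norm (f j)" by (rule Cauchy_Schwarz_ineq2)
    also have "\<dots> \<le> r * r"
      using r[of i] r[of j] order_trans[OF norm_ge_zero r[of i]] by (intro mult_mono) auto
    finally show "\<bar>?Gf $ i $ j\<bar> \<le> 2 * r\<^sup>2" by (simp add: tr_eq_inner abs_mult power2_eq_square)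
  qed simp
  finally show ?thesis using gram_det_reindex[OF e] by simp
qed

section \<open>Integrality of norms and traces\<close>

lemma nrm_mult: "nrm (x * y) = nrm x * nrm y"
  by (simp add: nrm_def qcnj_def quat_ops algebra_simps)

lemma nrm_one: "nrm 1 = 1"
  by (simp add: nrm_def qcnj_def quat_ops)

lemma nrm_power: "nrm (x ^ k) = nrm x ^ k"
  by (induction k) (simp_all add: nrm_mult nrm_one)

lemma nrm_eq_inner: "nrm x = x \<bullet> x"
  by (simp add: nrm_eq_norm power2_norm_eq_inner)

lemma norm_quat_mult: "norm (x * y) = norm x * norm y" for x y :: quat
  using nrm_mult[of x y] by (metis nrm_eq_norm norm_ge_zero power2_eq_iff_nonneg power_mult_distrib mult_nonneg_nonneg)

lemma norm_quat_one: "norm (1 :: quat) = 1"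
  by (simp add: norm_quat_def inner_quat_def one_quat_def)

lemma inner_quat_one: "x \<bullet> 1 = qRe x" "1 \<bullet> x = qRe x"
  by (simp_all add: inner_quat_def one_quat_def)

lemma tr_eq_Re: "tr x = 2 * qRe x"
  by (simp add: tr_def qcnj_def quat_ops)

lemma tr_eq_nrm: "tr x = nrm (1 + x) - 1 - nrm x"
  by (simp add: tr_def nrm_def qcnj_def quat_ops algebra_simps)

text \<open>All powers of the reduced denominator divide \<open>d\<close>, so the denominator is
  1.\<close>

lemma bounded_denominator_Ints:
  fixes r :: real
  assumes r: "r \<in> \<rat>" and d: "0 < d" "\<And>k. real d * r ^ k \<in> \<int>"
  shows "r \<in> \<int>"
proof -
  obtain p q :: int where q: "0 < q" "coprime p q" and rpq: "r = of_int p / of_int q"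
    using r by (metis Rats_cases')
  have "q ^ k dvd int d" for k
  proof -
    obtain m :: int where m: "real d * r ^ k = of_int m" using d(2)[of k] by (auto elim: Ints_cases)
    have "real_of_int (int d * p ^ k) = of_int (m * q ^ k)"
      using m q(1) unfolding rpq by (simp add: power_divide field_simps)
    then have "int d * p ^ k = m * q ^ k" by (simp only: of_int_eq_iff)
    then have "q ^ k dvd int d * p ^ k" by simp
    moreover have "coprime (q ^ k) (p ^ k)" using q(2) by (simp add: coprime_commute)
    ultimately show ?thesis by (simp add: coprime_dvd_mult_left_iff)
  qed
  then have le: "q ^ k \<le> int d" for k using d(1) by (intro zdvd_imp_le) auto
  have "q = 1"
  proof (rule ccontr)
    assume "q \<noteq> 1"
    then have "2 ^ d \<le> q ^ d" using q(1) by (intro power_mono) auto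
    moreover have "int d < 2 ^ d" using of_nat_less_two_power[of d, where 'a = int] by simp
    ultimately show False using le[of d] by linarith
  qed
  then show ?thesis using rpq by simp
qed

lemma common_denominator:
  fixes A :: "real set"
  assumes "finite A" "A \<subseteq> \<rat>"
  shows "\<exists>d::nat. 0 < d \<and> (\<forall>a\<in>A. real d * a \<in> \<int>)"
  using assms
proof (induction A rule: finite_induct)
  case empty
  then show ?case by (intro exI[of _ 1]) auto
next
  case (insert a A)
  then obtain d :: nat where d: "0 < d" "\<forall>a\<in>A. real d * a \<in> \<int>" by auto
  have "a \<in> \<rat>" using insert.prems by simp
  then obtain p q :: int where q: "0 < q" "a = of_int p / of_int q" by (metis Rats_cases')
  have "real (nat q * d) * x \<in> \<int>" if x: "x \<in> insert a A" for x
  proof (cases "x = a")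
    case True
    have "real (nat q * d) * a = of_int (int d * p)" using q by simp
    then show ?thesis using True by (metis Ints_of_int)
  next
    case False
    have "real (nat q * d) * x = of_int q * (real d * x)" using q by simp
    moreover have "real d * x \<in> \<int>" using x d False by auto
    ultimately show ?thesis by (metis Ints_mult Ints_of_int)
  qed
  then show ?case using d(1) q(1) by (intro exI[of _ "nat q * d"]) auto
qed

text \<open>The norm is multiplicative, and the norms of all powers of \<open>x\<close> share a
  denominator, that of the finitely many products \<open>v i \<bullet> v j\<close>. This serves
  orders and imaginary quadratic integers alike.\<close>

lemma nrm_Ints_if_powers_in_combinations:
  fixes v :: "'i \<Rightarrow> quat"
  assumes I: "finite I" and rat: "\<And>i j. i \<in> I \<Longrightarrow> j \<in> I \<Longrightarrow> v i \<bullet> v j \<in> \<rat>"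
    and pow: "\<And>k. \<exists>c :: 'i \<Rightarrow> int. x ^ k = (\<Sum>i\<in>I. of_int (c i) *\<^sub>R v i)"
  shows "nrm x \<in> \<int>"
proof -
  have "(\<lambda>(i, j). v i \<bullet> v j) ` (I \<times> I) \<subseteq> \<rat>" using rat by auto
  then obtain d :: nat where d: "0 < d" "\<forall>a\<in>(\<lambda>(i, j). v i \<bullet> v j) ` (I \<times> I). real d * a \<in> \<int>"
    using common_denominator[of "(\<lambda>(i, j). v i \<bullet> v j) ` (I \<times> I)"] I by blast
  have den: "real d * nrm x ^ k \<in> \<int>" for k
  proof -
    obtain c :: "'i \<Rightarrow> int" where c: "x ^ k = (\<Sum>i\<in>I. of_int (c i) *\<^sub>R v i)" using pow by blast
    have "nrm x ^ k = x ^ k \<bullet> x ^ k" by (metis nrm_power nrm_eq_inner)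
    then have "real d * nrm x ^ k = real d * ((\<Sum>i\<in>I. of_int (c i) *\<^sub>R v i) \<bullet> (\<Sum>i\<in>I. of_int (c i) *\<^sub>R v i))"
      by (simp only: c)
    also have "\<dots> = (\<Sum>i\<in>I. \<Sum>j\<in>I. of_int (c i * c j) * (real d * (v j \<bullet> v i)))"
      unfolding inner_sum_left inner_sum_right inner_scaleR_left inner_scaleR_right sum_distrib_left
      by (intro sum.cong refl) (simp add: mult_ac)
    also have "\<dots> \<in> \<int>"
      using d(2) by (intro Ints_sum Ints_mult[OF Ints_of_int]) auto
    finally show ?thesis .
  qed
  have "nrm x \<in> \<rat>"
  proof -
    have "real d * nrm x \<in> \<rat>" using den[of 1] Ints_subset_Rats by auto
    then have "(real d * nrm x) / real d \<in> \<rat>" by (intro Rats_divide) auto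
    then show ?thesis using d(1) by simp
  qed
  then show ?thesis using bounded_denominator_Ints d(1) den by blast
qed

definition integral_ring :: "quat set \<Rightarrow> bool" where
  "integral_ring R \<longleftrightarrow> 1 \<in> R \<and> (\<forall>x\<in>R. \<forall>y\<in>R. x - y \<in> R \<and> x * y \<in> R) \<and> (\<forall>x\<in>R. nrm x \<in> \<int> \<and> tr x \<in> \<int>)"

lemma quat_alg_inner_Rats:
  assumes "a < 0" "b < 0" "x \<in> quat_alg a b" "y \<in> quat_alg a b"
  shows "x \<bullet> y \<in> \<rat>"
proof -
  have sq: "sqrt s * sqrt s = s" if "0 \<le> s" for s :: real using that by simp
  have sq3: "sqrt (- of_rat a) * sqrt (- of_rat a) = (- of_rat a :: real)"
    "sqrt (- of_rat b) * sqrt (- of_rat b) = (- of_rat b :: real)"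
    "sqrt (of_rat a * of_rat b) * sqrt (of_rat a * of_rat b) = (of_rat a * of_rat b :: real)"
    using assms(1,2) by (intro sq; simp add: mult_nonpos_nonpos)+
  obtain x1 x2 x3 x4 where x: "x = Quat (of_rat x1) (of_rat x2 * sqrt (- of_rat a))
      (of_rat x3 * sqrt (- of_rat b)) (of_rat x4 * sqrt (of_rat a * of_rat b))"
    using assms(3) unfolding quat_alg_def by blast
  obtain y1 y2 y3 y4 where y: "y = Quat (of_rat y1) (of_rat y2 * sqrt (- of_rat a))
      (of_rat y3 * sqrt (- of_rat b)) (of_rat y4 * sqrt (of_rat a * of_rat b))"
    using assms(4) unfolding quat_alg_def by blast
  have "x \<bullet> y = of_rat x1 * of_rat y1 + of_rat x2 * of_rat y2 * (sqrt (- of_rat a) * sqrt (- of_rat a))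
      + of_rat x3 * of_rat y3 * (sqrt (- of_rat b) * sqrt (- of_rat b))
      + of_rat x4 * of_rat y4 * (sqrt (of_rat a * of_rat b) * sqrt (of_rat a * of_rat b))"
    unfolding x y inner_quat_def quat.sel by (simp only: mult_ac)
  also have "\<dots> \<in> \<rat>" unfolding sq3 by (intro Rats_add Rats_mult Rats_minus_iff[THEN iffD2] Rats_of_rat)
  finally show ?thesis .
qed

lemma order_integral_ring:
  assumes R: "is_order A R" and rat: "\<And>x y. x \<in> A \<Longrightarrow> y \<in> A \<Longrightarrow> x \<bullet> y \<in> \<rat>"
  shows "integral_ring R"
proof -
  obtain F where F: "finite F" "R = zspan F" using R by (auto simp: is_order_def)
  have R1: "1 \<in> R" and Rd: "\<And>x y. x \<in> R \<Longrightarrow> y \<in> R \<Longrightarrow> x - y \<in> R" and Rm: "\<And>x y. x \<in> R \<Longrightarrow> y \<in> R \<Longrightarrow> x * y \<in> R"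
    and RA: "R \<subseteq> A" using R by (auto simp: is_order_def)
  have FR: "F \<subseteq> R"
  proof
    fix b assume "b \<in> F"
    then have "b \<in> zspan F"
      unfolding zspan_def mem_Collect_eq by (intro exI[of _ "{b}"] exI[of _ "\<lambda>_. 1"]) auto
    then show "b \<in> R" using F(2) by simp
  qed
  have nrm: "nrm x \<in> \<int>" if x: "x \<in> R" for x
  proof (rule nrm_Ints_if_powers_in_combinations[OF F(1), of "\<lambda>b. b"])
    show "i \<bullet> j \<in> \<rat>" if "i \<in> F" "j \<in> F" for i j using that FR RA rat by blast
    fix k
    have "x ^ k \<in> R" by (induction k) (simp_all add: R1 Rm x)
    then obtain T and c :: "quat \<Rightarrow> int" where T: "T \<subseteq> F" "x ^ k = (\<Sum>b\<in>T. of_int (c b) * b)"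
      unfolding F(2) zspan_def by auto
    have "x ^ k = (\<Sum>b\<in>F. of_int (if b \<in> T then c b else 0) * b)"
      unfolding T(2) using T(1) F(1) by (intro sum.mono_neutral_cong_left) auto
    also have "\<dots> = (\<Sum>b\<in>F. of_int (if b \<in> T then c b else 0) *\<^sub>R b)"
      by (intro sum.cong refl) (metis of_real_of_int_eq scaleR_conv_of_real)
    finally show "\<exists>c :: quat \<Rightarrow> int. x ^ k = (\<Sum>i\<in>F. of_int (c i) *\<^sub>R i)"
      by - (rule exI[where x = "\<lambda>b. if b \<in> T then c b else 0"])
  qed
  have "tr x \<in> \<int>" if x: "x \<in> R" for x
  proof -
    have "0 - x \<in> R" using Rd[OF Rd[OF R1 R1] x] by simp
    then have "1 + x \<in> R" using Rd[OF R1, of "0 - x"] by simp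
    then show ?thesis using nrm x by (simp add: tr_eq_nrm)
  qed
  then show ?thesis using nrm R1 Rd Rm by (simp add: integral_ring_def)
qed

subsection \<open>Imaginary quadratic fields\<close>

lemma quat_of_complex_hom:
  "quat_of_complex (z - w) = quat_of_complex z - quat_of_complex w"
  "quat_of_complex (z + w) = quat_of_complex z + quat_of_complex w"
  "quat_of_complex (z * w) = quat_of_complex z * quat_of_complex w"
  "quat_of_complex 1 = 1" "quat_of_complex 0 = 0"
  "quat_of_complex (of_int k * z) = of_int k *\<^sub>R quat_of_complex z"
  by (simp_all add: quat_of_complex_def quat_ops)

lemma quat_of_complex_power: "quat_of_complex (z ^ k) = quat_of_complex z ^ k"
  by (induction k) (simp_all add: quat_of_complex_hom)

lemma quat_of_complex_sum: "quat_of_complex (\<Sum>i\<in>I. f i) = (\<Sum>i\<in>I. quat_of_complex (f i))"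
  by (induction I rule: infinite_finite_induct) (simp_all add: quat_of_complex_hom)

lemma imag_quad_field_mult:
  assumes d: "0 < d" and z: "z \<in> imag_quad_field d" "w \<in> imag_quad_field d"
  shows "z * w \<in> imag_quad_field d"
proof -
  obtain x y x' y' where zw: "z = Complex (of_rat x) (of_rat y * sqrt (of_rat d))"
    "w = Complex (of_rat x') (of_rat y' * sqrt (of_rat d))"
    using z by (auto simp: imag_quad_field_def)
  have sq: "sqrt (of_rat d) * sqrt (of_rat d) = (of_rat d :: real)" using d by simp
  have "z * w = Complex (of_rat (x * x' - y * y' * d)) (of_rat (x * y' + y * x') * sqrt (of_rat d))"
    unfolding zw complex_eq_iff using sq
    by (simp add: of_rat_mult of_rat_diff of_rat_add algebra_simps)
  then show ?thesis by (auto simp: imag_quad_field_def)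
qed

lemma imag_quad_field_diff:
  assumes "z \<in> imag_quad_field d" "w \<in> imag_quad_field d"
  shows "z - w \<in> imag_quad_field d"
proof -
  obtain x y x' y' where zw: "z = Complex (of_rat x) (of_rat y * sqrt (of_rat d))"
    "w = Complex (of_rat x') (of_rat y' * sqrt (of_rat d))"
    using assms by (auto simp: imag_quad_field_def)
  have "z - w = Complex (of_rat (x - x')) (of_rat (y - y') * sqrt (of_rat d))"
    unfolding zw by (simp add: complex_eq_iff of_rat_diff algebra_simps)
  then show ?thesis by (auto simp: imag_quad_field_def)
qed

lemma imag_quad_field_one: "1 \<in> imag_quad_field d"
  unfolding imag_quad_field_def by (auto simp: complex_eq_iff intro!: exI[of _ 1] exI[of _ 0])

lemma imag_quad_field_inner_Rats:
  assumes d: "0 < d" and z: "z \<in> imag_quad_field d" "w \<in> imag_quad_field d"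
  shows "Im z * Im w \<in> \<rat>" "quat_of_complex z \<bullet> quat_of_complex w \<in> \<rat>"
proof -
  obtain x y x' y' where zw: "z = Complex (of_rat x) (of_rat y * sqrt (of_rat d))"
    "w = Complex (of_rat x') (of_rat y' * sqrt (of_rat d))"
    using z by (auto simp: imag_quad_field_def)
  have "sqrt (of_rat d) * sqrt (of_rat d) = (of_rat d :: real)" using d by simp
  then have "Im z * Im w = of_rat (y * y' * d)"
    unfolding zw by (simp add: of_rat_mult algebra_simps)
  then show "Im z * Im w \<in> \<rat>" by simp
  then show "quat_of_complex z \<bullet> quat_of_complex w \<in> \<rat>"
    using zw by (simp add: inner_quat_def quat_of_complex_def)
qed

text \<open>The integer combinations of the powers of \<open>z\<close> below the degree of a monic
  polynomial are closed under multiplication by \<open>z\<close>, so they contain all powers of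
  \<open>z\<close> and of \<open>1 + z\<close>. The second norm yields the trace by
  polarization.\<close>

lemma algebraic_int_nrm_tr:
  assumes d: "0 < d" and z: "z \<in> imag_quad_field d" "algebraic_int z"
  shows "nrm (quat_of_complex z) \<in> \<int>" "tr (quat_of_complex z) \<in> \<int>"
proof -
  obtain p where p: "poly (map_poly of_int p) z = 0" "lead_coeff p = 1"
    using z(2) by (auto simp: algebraic_int_altdef_ipoly)
  define m where "m = degree p"
  define S where "S = {\<Sum>i<m. of_int (c i) * z ^ i | c :: nat \<Rightarrow> int. True}"
  have S_I: "(\<Sum>i<m. of_int (c i) * z ^ i) \<in> S" for c unfolding S_def by blast
  have S_add: "x + y \<in> S" if xy: "x \<in> S" "y \<in> S" for x y
  proof -
    obtain c c' where "x = (\<Sum>i<m. of_int (c i) * z ^ i)" "y = (\<Sum>i<m. of_int (c' i) * z ^ i)"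
      using xy unfolding S_def by blast
    then have "x + y = (\<Sum>i<m. of_int (c i + c' i) * z ^ i)" by (simp add: sum.distrib distrib_right)
    then show ?thesis using S_I by metis
  qed
  have S_scale: "of_int k * x \<in> S" if xS: "x \<in> S" for k x
  proof -
    obtain c where "x = (\<Sum>i<m. of_int (c i) * z ^ i)" using xS unfolding S_def by blast
    then have "of_int k * x = (\<Sum>i<m. of_int (k * c i) * z ^ i)" by (simp add: sum_distrib_left mult.assoc)
    then show ?thesis using S_I by metis
  qed
  have S_0: "0 \<in> S" using S_I[of "\<lambda>_. 0"] by simp
  have S_sum: "(\<Sum>i\<in>I. of_int (c i) * f i) \<in> S" if "\<And>i. i \<in> I \<Longrightarrow> f i \<in> S" for I f and c :: "nat \<Rightarrow> int"
    using that by (induction I rule: infinite_finite_induct) (auto simp: S_0 S_add S_scale)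
  have small: "z ^ i \<in> S" if "i < m" for i
  proof -
    have "(\<Sum>j<m. of_int (if j = i then 1 else 0) * z ^ j) = (\<Sum>j<m. if j = i then z ^ j else 0)"
      by (rule sum.cong) auto
    also have "\<dots> = z ^ i" using that by simp
    finally show ?thesis using S_I by metis
  qed
  have "0 = (\<Sum>i\<le>m. of_int (coeff p i) * z ^ i)"
    using p(1) by (simp add: poly_altdef degree_map_poly coeff_map_poly m_def)
  also have "\<dots> = (\<Sum>i<m. of_int (coeff p i) * z ^ i) + z ^ m"
    using p(2) by (simp add: lessThan_Suc_atMost[symmetric] m_def)
  finally have zm: "z ^ m = - (\<Sum>i<m. of_int (coeff p i) * z ^ i)"
    by (metis add.inverse_unique)
  have "z ^ m = (\<Sum>i<m. of_int (- coeff p i) * z ^ i)" unfolding zm by (simp add: sum_negf)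
  then have top: "z ^ m \<in> S" using S_I by metis
  have mult_z: "z * x \<in> S" if xS: "x \<in> S" for x
  proof -
    obtain c where "x = (\<Sum>i<m. of_int (c i) * z ^ i)" using xS unfolding S_def by blast
    then have "z * x = (\<Sum>i<m. of_int (c i) * z ^ Suc i)" by (simp add: sum_distrib_left mult_ac)
    also have "\<dots> \<in> S"
    proof (rule S_sum)
      fix i assume "i \<in> {..<m}"
      then show "z ^ Suc i \<in> S" using small[of "Suc i"] top by (cases "Suc i = m") auto
    qed
    finally show ?thesis .
  qed
  have "m \<noteq> 0"
  proof
    assume "m = 0"
    then show False using zm by simp
  qed
  then have S_1: "1 \<in> S" using small[of 0] by simp
  have zi: "z ^ i \<in> imag_quad_field d" for i
    by (induction i) (simp_all add: imag_quad_field_one imag_quad_field_mult[OF d] z(1))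
  have nrmS: "nrm (quat_of_complex x) \<in> \<int>" if x: "\<And>k. x ^ k \<in> S" for x
  proof (rule nrm_Ints_if_powers_in_combinations[of "{..<m}" "\<lambda>i. quat_of_complex (z ^ i)"])
    show "quat_of_complex (z ^ i) \<bullet> quat_of_complex (z ^ j) \<in> \<rat>" for i j
      using imag_quad_field_inner_Rats(2)[OF d zi zi] .
    fix k
    obtain c where c: "x ^ k = (\<Sum>i<m. of_int (c i) * z ^ i)" using x[of k] unfolding S_def by blast
    have "quat_of_complex x ^ k = (\<Sum>i<m. of_int (c i) *\<^sub>R quat_of_complex (z ^ i))"
      unfolding quat_of_complex_power[symmetric] c quat_of_complex_sum
      by (intro sum.cong refl) (rule quat_of_complex_hom)
    then show "\<exists>c :: nat \<Rightarrow> int. quat_of_complex x ^ k = (\<Sum>i<m. of_int (c i) *\<^sub>R quat_of_complex (z ^ i))" by blast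
  qed simp
  have "z ^ k \<in> S" for k by (induction k) (simp_all add: S_1 mult_z)
  then show 1: "nrm (quat_of_complex z) \<in> \<int>" by (rule nrmS)
  have "(1 + z) ^ k \<in> S" for k
    by (induction k) (simp_all add: S_1 mult_z S_add distrib_right)
  then have "nrm (quat_of_complex (1 + z)) \<in> \<int>" by (rule nrmS)
  then show "tr (quat_of_complex z) \<in> \<int>" using 1 by (simp add: tr_eq_nrm quat_of_complex_hom)
qed

text \<open>\<open>z\<close> is a root of X^2 - tr X + nrm.\<close>

lemma algebraic_int_if_nrm_tr:
  assumes "nrm (quat_of_complex z) \<in> \<int>" "tr (quat_of_complex z) \<in> \<int>"
  shows "algebraic_int z"
proof -
  obtain k l :: int where k: "nrm (quat_of_complex z) = of_int k" and l: "tr (quat_of_complex z) = of_int l"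
    using assms by (auto elim!: Ints_cases)
  have N: "(Re z)\<^sup>2 + (Im z)\<^sup>2 = of_int k"
    using k by (simp add: nrm_eq_inner inner_quat_def quat_of_complex_def power2_eq_square)
  have T: "2 * Re z = of_int l"
    using l by (simp add: tr_eq_Re quat_of_complex_def)
  have "poly [:of_int k, - of_int l, 1:] z = 0"
    using N T by (simp add: complex_eq_iff algebra_simps power2_eq_square flip: T N)
  then show ?thesis
    by (rule algebraic_int.intros[rotated 2]) (auto simp: coeff_pCons split: nat.split)
qed

lemma int_square_of_rational:
  fixes s :: real
  assumes "s \<in> \<rat>" "s\<^sup>2 \<in> \<int>" shows "s \<in> \<int>"
proof -
  have "algebraic_int (s\<^sup>2)" using assms(2) by (rule int_imp_algebraic_int)
  then have "algebraic_int s" by (rule algebraic_int_root[where p = "monom 1 2"]) (auto simp: poly_monom degree_monom_eq coeff_monom)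
  then show ?thesis using assms(1) rational_algebraic_int_is_int by blast
qed

text \<open>Integrality is tested by norm and trace, so closure reduces to the trace of
  \<open>z\<close> times the conjugate of \<open>w\<close> being an integer; this is
  \<open>polar\<close>.\<close>

lemma imag_quad_order_integral_ring:
  assumes d: "0 < d"
  shows "integral_ring (quat_of_complex ` {z \<in> imag_quad_field d. algebraic_int z})"
proof -
  let ?q = quat_of_complex
  have Nz: "nrm (?q z) = (Re z)\<^sup>2 + (Im z)\<^sup>2" and Tz: "tr (?q z) = 2 * Re z" for z
    by (simp_all add: nrm_eq_inner inner_quat_def quat_of_complex_def power2_eq_square tr_eq_Re)
  have polar: "2 * (Re z * Re w + Im z * Im w) \<in> \<int>"
    if z: "z \<in> imag_quad_field d" "algebraic_int z" and w: "w \<in> imag_quad_field d" "algebraic_int w" for z w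
  proof -
    obtain N T N' T' :: int where NT: "(Re z)\<^sup>2 + (Im z)\<^sup>2 = of_int N" "2 * Re z = of_int T"
      "(Re w)\<^sup>2 + (Im w)\<^sup>2 = of_int N'" "2 * Re w = of_int T'"
      using algebraic_int_nrm_tr[OF d z] algebraic_int_nrm_tr[OF d w] unfolding Nz Tz by (auto elim!: Ints_cases)
    \<comment> \<open>A rational number with integral square, hence an integer. The square also
      determines its parity, which is that of \<open>T * T'\<close>, and this removes the
      denominator 2 below.\<close>
    define s where "s = 4 * (Im z * Im w)"
    have "s \<in> \<rat>" unfolding s_def using imag_quad_field_inner_Rats(1)[OF d z(1) w(1)] by simp
    have "s\<^sup>2 = (4 * (Im z)\<^sup>2) * (4 * (Im w)\<^sup>2)" by (simp add: s_def power2_eq_square)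
    also have "4 * (Im z)\<^sup>2 = of_int (4 * N - T\<^sup>2)" by (simp flip: NT add: power2_eq_square algebra_simps)
    also have "4 * (Im w)\<^sup>2 = of_int (4 * N' - T'\<^sup>2)" by (simp flip: NT add: power2_eq_square algebra_simps)
    finally have s2: "s\<^sup>2 = of_int ((4 * N - T\<^sup>2) * (4 * N' - T'\<^sup>2))" by simp
    then have "s \<in> \<int>" using int_square_of_rational[OF \<open>s \<in> \<rat>\<close>] by simp
    then obtain k :: int where k: "s = of_int k" by (rule Ints_cases)
    have "k\<^sup>2 = (4 * N - T\<^sup>2) * (4 * N' - T'\<^sup>2)" using s2 unfolding k by (metis of_int_eq_iff of_int_power)
    then have "even (k\<^sup>2) \<longleftrightarrow> even ((4 * N - T\<^sup>2) * (4 * N' - T'\<^sup>2))" by simp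
    then have "even k \<longleftrightarrow> even (T * T')" by simp
    then have "even (T * T' + k)" by simp
    then obtain j where j: "T * T' + k = 2 * j" by blast
    have "2 * (Re z * Re w + Im z * Im w) = ((2 * Re z) * (2 * Re w) + s) / 2" by (simp add: s_def)
    also have "\<dots> = of_int (T * T' + k) / 2" unfolding NT k by simp
    also have "\<dots> = of_int j" unfolding j by simp
    finally show ?thesis by simp
  qed
  have main: "z - w \<in> imag_quad_field d \<and> algebraic_int (z - w) \<and> z * w \<in> imag_quad_field d \<and> algebraic_int (z * w)"
    if z: "z \<in> imag_quad_field d" "algebraic_int z" and w: "w \<in> imag_quad_field d" "algebraic_int w" for z w
  proof -
    note ints = algebraic_int_nrm_tr[OF d z] algebraic_int_nrm_tr[OF d w] polar[OF z w]
    have "nrm (?q (z - w)) = nrm (?q z) + nrm (?q w) - 2 * (Re z * Re w + Im z * Im w)"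
      by (simp add: Nz power2_eq_square algebra_simps)
    then have 1: "nrm (?q (z - w)) \<in> \<int>" using ints by simp
    have "tr (?q (z - w)) = tr (?q z) - tr (?q w)" by (simp add: Tz)
    then have 2: "tr (?q (z - w)) \<in> \<int>" using ints by simp
    have 3: "nrm (?q (z * w)) \<in> \<int>" using ints by (simp add: quat_of_complex_hom nrm_mult)
    have "tr (?q (z * w)) = tr (?q z) * tr (?q w) - 2 * (Re z * Re w + Im z * Im w)"
      by (simp add: Tz algebra_simps)
    then have 4: "tr (?q (z * w)) \<in> \<int>" using ints by simp
    show ?thesis
      using algebraic_int_if_nrm_tr[OF 1 2] algebraic_int_if_nrm_tr[OF 3 4]
        imag_quad_field_diff[OF z(1) w(1)] imag_quad_field_mult[OF d z(1) w(1)] by blast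
  qed
  have "x - y \<in> ?q ` {z \<in> imag_quad_field d. algebraic_int z} \<and> x * y \<in> ?q ` {z \<in> imag_quad_field d. algebraic_int z}"
    if xy: "x \<in> ?q ` {z \<in> imag_quad_field d. algebraic_int z}" "y \<in> ?q ` {z \<in> imag_quad_field d. algebraic_int z}" for x y
  proof -
    obtain z w where z: "z \<in> imag_quad_field d" "algebraic_int z" "x = ?q z"
      and w: "w \<in> imag_quad_field d" "algebraic_int w" "y = ?q w" using xy by blast
    have "x - y = ?q (z - w)" "x * y = ?q (z * w)" using z w by (simp_all add: quat_of_complex_hom)
    then show ?thesis using main[OF z(1,2) w(1,2)] by blast
  qed
  moreover have "1 \<in> ?q ` {z \<in> imag_quad_field d. algebraic_int z}"
    using imag_quad_field_one quat_of_complex_hom(4) by (intro image_eqI[of _ _ 1]) auto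
  ultimately show ?thesis
    using algebraic_int_nrm_tr[OF d] unfolding integral_ring_def by blast
qed

theorem is_RZ_integral_ring:
  assumes "is_RZ n R" shows "integral_ring R"
proof -
  consider d where "0 < d" "R = quat_of_complex ` {z \<in> imag_quad_field d. algebraic_int z}"
    | a b where "a < 0" "b < 0" "is_order (quat_alg a b) R"
    using assms unfolding is_RZ_def maximal_ddag_order_def ddag_order_def maximal_order_def by blast
  then show ?thesis
  proof cases
    case 1
    then show ?thesis using imag_quad_order_integral_ring by simp
  next
    case 2
    show ?thesis by (rule order_integral_ring[OF 2(3)]) (rule quat_alg_inner_Rats[OF 2(1,2)])
  qed
qed

section \<open>Rings with a covering vector\<close>

lemma RR_plus_iff:
  "x \<in> RR_plus 3 \<longleftrightarrow> qJ x = 0 \<and> qK x = 0"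
  "x \<in> RR_plus 4 \<longleftrightarrow> qK x = 0"
  "x \<in> RR_plus 5"
proof -
  have *: "x \<in> RR_plus n \<longleftrightarrow> x = (\<Sum>b\<in>plus_basis n. (x \<bullet> b) *\<^sub>R b)" for n
    using RR_plus_expand[of x n] lincomb_RR_plus[of n "\<lambda>b. x \<bullet> b"] unfolding lincomb_def by metis
  show "x \<in> RR_plus 3 \<longleftrightarrow> qJ x = 0 \<and> qK x = 0" "x \<in> RR_plus 4 \<longleftrightarrow> qK x = 0" "x \<in> RR_plus 5"
    unfolding * by (auto simp: plus_basis_def inner_quat_def quat_eq_iff quat_ops)
qed

lemma is_RZ_cases:
  assumes "is_RZ n R"
  obtains "n = 3" "R \<subseteq> RR_plus n" | "n = 4" "ddag ` R = R" | "n = 5"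
proof -
  have "R \<subseteq> RR_plus 3" if "R = quat_of_complex ` {z \<in> imag_quad_field d. algebraic_int z}" for d
    unfolding that by (auto simp: RR_plus_iff quat_of_complex_def)
  then show thesis using assms that
    unfolding is_RZ_def maximal_ddag_order_def ddag_order_def by blast
qed

lemma RZ_plus_eq:
  assumes "is_RZ n R" shows "RZ_plus n R = R \<inter> RR_plus n"
  using assms
proof (cases rule: is_RZ_cases)
  case 2
  then show ?thesis by (auto simp: RZ_plus_def RR_plus_iff ddag_def quat_eq_iff)
qed (auto simp: RZ_plus_def RR_plus_iff)

lemma qRe_diff: "qRe (x - y) = qRe x - qRe y" and qRe_scaleR: "qRe (r *\<^sub>R x) = r * qRe x"
  by (simp_all add: quat_ops)

locale covering_ring =
  fixes n :: nat and R :: "quat set" and u :: quat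
  assumes RZ: "is_RZ n R" and ncv: "normalized_covering_vector n R u"
begin

abbreviation "V \<equiv> RR_plus n"
abbreviation "L \<equiv> RZ_plus n R"

lemma R_ring: "integral_ring R" using RZ by (rule is_RZ_integral_ring)
lemma R_1: "1 \<in> R" and R_diff: "x \<in> R \<Longrightarrow> y \<in> R \<Longrightarrow> x - y \<in> R" and R_mult: "x \<in> R \<Longrightarrow> y \<in> R \<Longrightarrow> x * y \<in> R"
  and R_nrm: "x \<in> R \<Longrightarrow> nrm x \<in> \<int>" and R_tr: "x \<in> R \<Longrightarrow> tr x \<in> \<int>"
  using R_ring by (auto simp: integral_ring_def)

lemma R_discrete: "discrete_group R"
proof
  show "0 \<in> R" using R_diff[OF R_1 R_1] by simp
  fix x assume x: "x \<in> R" "x \<noteq> 0"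
  have "0 < nrm x" using x(2) by (simp add: nrm_eq_inner)
  then have "1 \<le> nrm x" using R_nrm[OF x(1)] by (auto elim!: Ints_cases)
  then show "1 \<le> norm x" using power2_le_imp_le[of 1 "norm x"] by (simp add: nrm_eq_norm)
qed (fact R_diff)

interpretation R: discrete_group R by (rule R_discrete)

lemma R_of_int: "of_int k \<in> R"
  using R.M_scale_int[OF R_1, of k] by (metis of_int_mult_quat mult.right_neutral)

lemma R_qcnj: "x \<in> R \<Longrightarrow> qcnj x \<in> R"
proof -
  assume x: "x \<in> R"
  obtain k :: int where k: "tr x = of_int k" using R_tr[OF x] by (auto elim: Ints_cases)
  have "qcnj x = of_real (tr x) - x" by (simp add: tr_eq)
  also have "\<dots> = of_int k - x" unfolding k by simp
  finally show ?thesis using R_diff[OF R_of_int x] by simp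
qed

lemma R_inner: "x \<in> R \<Longrightarrow> y \<in> R \<Longrightarrow> 2 * (x \<bullet> y) \<in> \<int>"
  unfolding inner_eq_tr using R_tr R_mult R_qcnj by simp

lemma L_eq: "L = R \<inter> V" using RZ by (rule RZ_plus_eq)

lemma L_R: "L \<subseteq> R" and L_V: "L \<subseteq> V" using L_eq by auto

lemma L_discrete: "discrete_group L"
  using R_discrete subspace_0[OF subspace_RR_plus] subspace_diff[OF subspace_RR_plus]
  unfolding L_eq discrete_group_def by auto

sublocale discrete_group L by (rule L_discrete)

lemma n_cases: "n = 3 \<or> n = 4 \<or> n = 5" using RZ by (auto simp: is_RZ_def)

lemma one_V: "1 \<in> V" using n_cases by (auto simp: RR_plus_iff quat_ops)

lemma one_L: "1 \<in> L" using R_1 one_V L_eq by simp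

lemma qcnj_V: "x \<in> V \<Longrightarrow> qcnj x \<in> V" using n_cases by (auto simp: RR_plus_iff qcnj_def)

lemma u_facts: "u \<in> V" "u \<noteq> 0" "qRe u = 0" "u \<in> L"
  using ncv by (auto simp: normalized_covering_vector_def covering_vector_def)

lemma near_lattice_point:
  assumes "x \<in> V" "u \<bullet> x = 0" obtains p where "p \<in> L" "u \<bullet> p = 0" "norm (x - p) < 1"
proof -
  have "hyp n u \<subseteq> (\<Union>p \<in> hyp n u \<inter> R. ball p 1)"
    using ncv by (simp add: normalized_covering_vector_def covering_vector_def)
  then obtain p where "p \<in> hyp n u \<inter> R" "x \<in> ball p 1" using assms by (auto simp: hyp_def)
  then show thesis using that[of p] by (auto simp: hyp_def L_eq dist_norm norm_minus_commute)
qed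

lemma plane_lattice_iff: "x \<in> plane_lattice n R u \<longleftrightarrow> x \<in> L \<and> u \<bullet> x = 0"
  using L_V by (auto simp: plane_lattice_def hyp_def)

lemma zspan_insert:
  assumes "\<tau> \<notin> plane_lattice n R u"
  shows "zspan (insert \<tau> (plane_lattice n R u)) = {of_int k *\<^sub>R \<tau> + x | k x. x \<in> plane_lattice n R u}"
proof (intro equalityI subsetI)
  let ?P = "plane_lattice n R u"
  fix x assume "x \<in> zspan (insert \<tau> ?P)"
  then obtain T and c :: "quat \<Rightarrow> int" where T: "finite T" "T \<subseteq> insert \<tau> ?P" "x = (\<Sum>b\<in>T. of_int (c b) *\<^sub>R b)"
    by (auto simp: zspan_def of_int_mult_quat)
  define y where "y = (\<Sum>b\<in>T - {\<tau>}. of_int (c b) *\<^sub>R b)"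
  have sub: "T - {\<tau>} \<subseteq> ?P" using T(2) by auto
  have "y \<in> L" unfolding y_def using sub by (intro M_sum) (auto simp: plane_lattice_iff)
  moreover have "u \<bullet> y = 0" unfolding y_def inner_sum_right
    by (rule sum.neutral) (use sub in \<open>auto simp: plane_lattice_iff\<close>)
  ultimately have y: "y \<in> ?P" by (simp add: plane_lattice_iff)
  have "x = of_int (if \<tau> \<in> T then c \<tau> else 0) *\<^sub>R \<tau> + y"
    using T(1) by (auto simp: T(3) y_def sum.remove)
  then show "x \<in> {of_int k *\<^sub>R \<tau> + x | k x. x \<in> ?P}" using y by blast
next
  let ?P = "plane_lattice n R u"
  fix x assume "x \<in> {of_int k *\<^sub>R \<tau> + x | k x. x \<in> ?P}"
  then obtain k y where y: "y \<in> ?P" "x = of_int k *\<^sub>R \<tau> + y" by blast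
  have "y \<noteq> \<tau>" using y(1) assms by blast
  then have "x = (\<Sum>b\<in>{\<tau>, y}. of_int (if b = \<tau> then k else 1) * b)"
    using y by (simp add: of_int_mult_quat)
  then show "x \<in> zspan (insert \<tau> ?P)"
    unfolding zspan_def mem_Collect_eq
    using y(1) by (intro exI[of _ "{\<tau>, y}"] exI[of _ "\<lambda>b. if b = \<tau> then k else 1"]) auto
qed

text \<open>The form \<open>2 * (u \<bullet> x)\<close> is integral on \<open>L\<close>. An element
  with the least positive value generates \<open>L\<close> together with the plane lattice, by
  division with remainder; \<open>u\<close> itself shows that positive values occur.\<close>

lemma exists_packing_shift: "\<exists>\<tau>. packing_shift n R u \<tau>"
proof -
  define P where "P m \<longleftrightarrow> 0 < m \<and> (\<exists>x\<in>L. 2 * (u \<bullet> x) = real m)" for m :: nat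
  have ints: "\<exists>k :: int. 2 * (u \<bullet> x) = of_int k" if "x \<in> L" for x
    using R_inner[of u x] that u_facts(4) L_R by (auto elim!: Ints_cases)
  have "P (nat k)" if "2 * (u \<bullet> u) = of_int k" for k
  proof -
    have "0 < u \<bullet> u" using u_facts(2) by simp
    then have "0 < k" using that by (metis of_int_0_less_iff mult_pos_pos zero_less_numeral)
    then show ?thesis using that u_facts(4) by (auto simp: P_def intro!: bexI[of _ u])
  qed
  then have "\<exists>m. P m" using ints[OF u_facts(4)] by blast
  define m where "m = (LEAST m. P m)"
  have Pm: "P m" unfolding m_def by (rule LeastI_ex) fact
  then obtain \<tau> where \<tau>: "\<tau> \<in> L" "2 * (u \<bullet> \<tau>) = real m" "0 < m" by (auto simp: P_def)
  have not_P: "\<tau> \<notin> plane_lattice n R u" using \<tau> by (auto simp: plane_lattice_iff)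
  have "zspan (insert \<tau> (plane_lattice n R u)) = L"
    unfolding zspan_insert[OF not_P]
  proof (intro equalityI subsetI)
    fix x assume "x \<in> {of_int k *\<^sub>R \<tau> + x | k x. x \<in> plane_lattice n R u}"
    then show "x \<in> L" using \<tau>(1) by (auto simp: plane_lattice_iff intro!: M_add M_scale_int)
  next
    fix x assume x: "x \<in> L"
    obtain k :: int where k: "2 * (u \<bullet> x) = of_int k" using ints[OF x] by blast
    define q where "q = k div int m"
    define y where "y = x - of_int q *\<^sub>R \<tau>"
    have yL: "y \<in> L" unfolding y_def using x \<tau>(1) by (intro M_diff M_scale_int)
    have "2 * (u \<bullet> y) = 2 * (u \<bullet> x) - of_int q * (2 * (u \<bullet> \<tau>))" by (simp add: y_def inner_diff_right)
    also have "\<dots> = of_int (k - q * int m)" using k \<tau>(2) by simp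
    also have "k - q * int m = k mod int m" by (simp add: q_def minus_div_mult_eq_mod)
    finally have uy: "2 * (u \<bullet> y) = of_int (k mod int m)" .
    have "k mod int m = 0"
    proof (rule ccontr)
      assume "k mod int m \<noteq> 0"
      moreover have "0 \<le> k mod int m" using \<tau>(3) by simp
      ultimately have pos: "0 < k mod int m" by linarith
      have "real (nat (k mod int m)) = of_int (k mod int m)" using pos by simp
      then have "P (nat (k mod int m))" using uy yL pos unfolding P_def by auto
      then have "m \<le> nat (k mod int m)" unfolding m_def by (rule Least_le)
      then have "int m \<le> k mod int m" using pos by (simp add: le_nat_iff)
      moreover have "k mod int m < int m" using \<tau>(3) by simp
      ultimately show False by linarith
    qed
    then have "y \<in> plane_lattice n R u" using uy yL by (simp add: plane_lattice_iff)
    moreover have "x = of_int q *\<^sub>R \<tau> + y" by (simp add: y_def)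
    ultimately show "x \<in> {of_int k *\<^sub>R \<tau> + x | k x. x \<in> plane_lattice n R u}" by blast
  qed
  moreover have "\<tau> \<in> Int_sphere (S_plane n u)" using \<tau> L_V by (auto simp: Int_sphere_def S_plane_def)
  ultimately show ?thesis using \<tau>(1) by (auto simp: packing_shift_def)
qed

end

locale covering_shift = covering_ring +
  fixes \<tau> :: quat
  assumes shift: "packing_shift n R u \<tau>"
begin

definition "e = (1 / norm u) *\<^sub>R u"
definition "h = e \<bullet> \<tau>"

lemma \<tau>_L: "\<tau> \<in> L" and \<tau>_pos: "0 < u \<bullet> \<tau>"
  using shift by (auto simp: packing_shift_def Int_sphere_def S_plane_def)

lemma norm_e: "norm e = 1" and e_V: "e \<in> V"
  using u_facts subspace_scale[OF subspace_RR_plus u_facts(1)] by (auto simp: e_def)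

lemma u_eq: "u = norm u *\<^sub>R e" using u_facts(2) by (simp add: e_def)

lemma u_inner: "u \<bullet> x = norm u * (e \<bullet> x)" by (subst u_eq) simp

lemma e_inner_0: "e \<bullet> x = 0 \<longleftrightarrow> u \<bullet> x = 0" using u_facts(2) by (simp add: u_inner)

lemma h_pos: "0 < h" using \<tau>_pos u_facts(2) unfolding h_def u_inner by (simp add: zero_less_mult_iff)

lemma e_Re: "qRe e = 0" using u_facts by (simp add: e_def quat_ops)

lemma e_one: "e \<bullet> 1 = 0" by (simp add: inner_quat_one e_Re)

lemma lattice_height:
  assumes "x \<in> L" shows "\<exists>k::int. e \<bullet> x = of_int k * h"
proof -
  have "\<tau> \<notin> plane_lattice n R u" using \<tau>_pos by (simp add: plane_lattice_iff)
  then have "x \<in> {of_int k *\<^sub>R \<tau> + x | k x. x \<in> plane_lattice n R u}"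
    using assms shift zspan_insert by (simp add: packing_shift_def)
  then obtain k y where "x = of_int k *\<^sub>R \<tau> + y" "u \<bullet> y = 0" by (auto simp: plane_lattice_iff)
  then have "e \<bullet> x = of_int k * h" by (simp add: inner_add_right e_inner_0 h_def)
  then show ?thesis by blast
qed

lemma near_plane_point:
  assumes "x \<in> V" "e \<bullet> x = 0" shows "\<exists>p\<in>L. e \<bullet> p = 0 \<and> norm (x - p) < 1"
  using near_lattice_point[OF assms(1)] assms(2) unfolding e_inner_0 by blast

text \<open>\<open>u\<close> is a lattice vector whose height is its own length, a positive multiple
  of \<open>h\<close>.\<close>

lemma h_le_norm_u: "h \<le> norm u"
proof -
  obtain k :: int where k: "e \<bullet> u = of_int k * h" using lattice_height u_facts(4) by blast
  have "e \<bullet> u = norm u" using norm_e by (subst u_eq) (simp add: norm_eq_1)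
  then have nu: "norm u = of_int k * h" using k by simp
  moreover have "0 < norm u" using u_facts(2) by simp
  ultimately have "0 < k" using h_pos by (metis of_int_0_less_iff zero_less_mult_pos2)
  then have "(1::real) \<le> of_int k" by simp
  then have "1 * h \<le> of_int k * h" using h_pos by (intro mult_right_mono) auto
  then show ?thesis using nu by simp
qed

section \<open>Short independent elements and the discriminant\<close>

lemma gram_det_le_set:
  assumes B: "zbasis B R" and B': "finite B'" "independent B'" "B' \<subseteq> R" "R \<subseteq> span B'"
    "\<And>b. b \<in> B' \<Longrightarrow> norm b \<le> r" "card B' = CARD('k::finite)"
  shows "\<bar>gram_det B\<bar> \<le> fact CARD('k) * (2 * r\<^sup>2) ^ CARD('k)"
proof -
  obtain f :: "'k \<Rightarrow> quat" where f: "bij_betw f UNIV B'"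
    using finite_same_card_bij[of "UNIV :: 'k set" B'] B' by auto
  then have "range f = B'" "inj f" by (auto simp: bij_betw_def)
  then show ?thesis
    using discrete_group.gram_det_le[OF R_discrete B, of f r] B' by auto
qed

text \<open>Outside dimension 3 the plane contains a unit vector orthogonal to 1. A lattice point at
  distance below 1 from it cannot be real, because all real numbers have distance at least 1 from
  that vector.\<close>

lemma exists_short_nonreal:
  assumes "n \<noteq> 3"
  obtains l where "l \<in> L" "e \<bullet> l = 0" "norm l < 2" "l \<notin> span {1}"
proof -
  have "\<exists>y. y \<in> V \<and> qRe y = 0 \<and> u \<bullet> y = 0 \<and> norm y = 1"
  proof (cases "qI u = 0 \<and> qJ u = 0")
    case True
    then have "u \<bullet> Quat 0 1 0 0 = 0" "norm (Quat 0 1 0 0) = 1"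
      by (simp_all add: inner_quat_def norm_quat_def)
    moreover have "Quat 0 1 0 0 \<in> V" using n_cases assms by (auto simp: RR_plus_iff)
    ultimately show ?thesis by (intro exI[of _ "Quat 0 1 0 0"]) auto
  next
    case False
    \<comment> \<open>Orthogonal to 1 and to \<open>u\<close>; its last coordinate is 0, so it lies
      in the ambient space in dimension 4 as well.\<close>
    let ?y = "Quat 0 (- qJ u) (qI u) 0"
    have "?y \<noteq> 0" using False by (auto simp: quat_eq_iff quat_ops)
    moreover have "?y \<in> V" using n_cases assms by (auto simp: RR_plus_iff)
    moreover have "u \<bullet> ?y = 0" by (simp add: inner_quat_def)
    ultimately show ?thesis
      by (intro exI[of _ "(1 / norm ?y) *\<^sub>R ?y"]) (auto simp: scaleR_quat_def[of _ ?y, symmetric]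
          intro: subspace_scale[OF subspace_RR_plus], simp_all add: scaleR_quat_def)
  qed
  then obtain y where y: "y \<in> V" "qRe y = 0" "u \<bullet> y = 0" "norm y = 1" by blast
  obtain l where l: "l \<in> L" "u \<bullet> l = 0" "norm (y - l) < 1" using near_lattice_point[OF y(1,3)] .
  have "norm l \<le> norm y + norm (y - l)" using norm_triangle_sub[of l y] by (simp add: norm_minus_commute)
  then have "norm l < 2" using y(4) l(3) by simp
  moreover have "l \<notin> span {1}"
  proof
    assume "l \<in> span {1}"
    then obtain c where c: "l = c *\<^sub>R 1" by (auto simp: span_singleton)
    have "(norm (y - l))\<^sup>2 = (norm y)\<^sup>2 + c\<^sup>2"
      using y(2) quat.sel(1)[of 1 0 0 0, folded one_quat_def] unfolding c power2_norm_eq_inner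
      by (simp add: inner_diff_left inner_diff_right inner_quat_one power2_eq_square qRe_diff qRe_scaleR)
    then have "1\<^sup>2 \<le> (norm (y - l))\<^sup>2" using y(4) by simp
    then have "1 \<le> norm (y - l)" by (rule power2_le_imp_le) simp
    then show False using l(3) by simp
  qed
  ultimately show thesis using that l by (simp add: e_inner_0)
qed

text \<open>Subtract from \<tau> a lattice point near its projection to the plane; what is left
  deviates from \<open>h *\<^sub>R e\<close> by less than 1.\<close>

lemma exists_short_shift:
  obtains t where "t \<in> L" "e \<bullet> t = h" "norm t < h + 1"
proof -
  have ee: "e \<bullet> e = 1" using norm_e by (simp add: norm_eq_1)
  have "\<tau> - h *\<^sub>R e \<in> V"
    using \<tau>_L L_V e_V subspace_diff[OF subspace_RR_plus] subspace_scale[OF subspace_RR_plus] by auto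
  moreover have "e \<bullet> (\<tau> - h *\<^sub>R e) = 0" by (simp add: inner_diff_right ee flip: h_def)
  ultimately obtain p where p: "p \<in> L" "e \<bullet> p = 0" "norm (\<tau> - h *\<^sub>R e - p) < 1" using near_plane_point by blast
  have "norm (\<tau> - p) \<le> norm (h *\<^sub>R e) + norm (\<tau> - h *\<^sub>R e - p)"
    using norm_triangle_ineq[of "h *\<^sub>R e" "\<tau> - h *\<^sub>R e - p"] by (simp add: algebra_simps)
  then have "norm (\<tau> - p) < h + 1" using p(3) norm_e h_pos by simp
  then show thesis using that[of "\<tau> - p"] M_diff[OF \<tau>_L p(1)] p(2) by (simp add: inner_diff_right h_def)
qed

text \<open>\<open>l t\<close> is a combination \<open>a + b l + c t\<close> only if \<open>(l - c) t = a + b l\<close>, which would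
  put \<open>t\<close> into the plane spanned by \<open>1\<close> and \<open>l\<close>.\<close>

lemma mult_notin_span:
  assumes l: "e \<bullet> l = 0" "l \<notin> span {1}" and t: "e \<bullet> t = h"
  shows "l * t \<notin> span {1, l, t}"
proof
  assume "l * t \<in> span {1, l, t}"
  then obtain a b c where abc: "l * t = a *\<^sub>R 1 + b *\<^sub>R l + c *\<^sub>R t"
    by (force simp: span_insert algebra_simps)
  define w where "w = l - c *\<^sub>R 1"
  have wt: "w * t = a *\<^sub>R 1 + b *\<^sub>R l" using abc by (simp add: w_def left_diff_distrib)
  have "nrm w *\<^sub>R t = qcnj w * (w * t)"
    unfolding nrm_def qcnj_def by (simp add: quat_eq_iff quat_ops algebra_simps)
  also have "\<dots> = qcnj (l - c *\<^sub>R 1) * (a *\<^sub>R 1 + b *\<^sub>R l)" by (simp only: wt) (simp only: w_def)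
  also have "\<dots> = (a * (tr l - c) + b * nrm l) *\<^sub>R 1 - (a + b * c) *\<^sub>R l"
    by (simp add: quat_eq_iff quat_ops qcnj_def tr_def nrm_def algebra_simps)
  finally have "nrm w *\<^sub>R t = (a * (tr l - c) + b * nrm l) *\<^sub>R 1 - (a + b * c) *\<^sub>R l" .
  then have "e \<bullet> (nrm w *\<^sub>R t) = 0" by (simp add: inner_diff_right inner_add_right l(1) e_one)
  then have "nrm w = 0" using t h_pos by simp
  then have "l = c *\<^sub>R 1" by (simp add: nrm_eq_inner w_def)
  then show False using l(2) by (auto simp: span_singleton)
qed

text \<open>The constants come from four elements of norm at most r = 2 (h + 1), the bound for
  \<open>l * t\<close>: a factor 4! and Gram entries of size at most 2 r^2 = 8 (h + 1)^2. In
  dimension 4 the ring has rank 4 while \<open>1\<close>, \<open>l\<close>, \<open>t\<close> already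
  span the ambient space; there \<open>l * t\<close> supplies the direction outside it.\<close>

lemma disc_le: "\<bar>disc R\<bar> \<le> 24 * (8 * (h + 1)\<^sup>2) ^ 4"
proof -
  define B where "B = (SOME B. zbasis B R)"
  have B: "zbasis B R" unfolding B_def by (rule someI_ex) (rule discrete_group.exists_zbasis[OF R_discrete])
  have disc: "disc R = gram_det B" by (simp add: disc_def B_def)
  obtain t where t: "t \<in> L" "e \<bullet> t = h" "norm t < h + 1" by (rule exists_short_shift)
  have ht: "e \<bullet> x = 0" if "x \<in> span S" "\<And>y. y \<in> S \<Longrightarrow> e \<bullet> y = 0" for x S
    using that(1) by (induction rule: span_induct_alt) (auto simp: that(2) inner_add_right)
  have eq: "2 * (2 * (h + 1))\<^sup>2 = 8 * (h + 1)\<^sup>2" by (simp add: power2_eq_square algebra_simps)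
  have big: "1 \<le> 8 * (h + 1)\<^sup>2"
    using h_pos one_le_power[of "h + 1" 2] by linarith
  show ?thesis
  proof (cases "n = 3")
    case True
    have ind: "independent {t, 1}"
      using ht[of t "{1}"] t(2) h_pos e_one by (auto simp: independent_insert)
    have "t \<noteq> 1" using t(2) h_pos e_one by auto
    then have card: "card {t, 1} = 2" by simp
    have "dim V \<le> card (plus_basis n)" unfolding RR_plus_def dim_span
      by (rule dim_le_card'[OF finite_plus_basis])
    then have "dim V \<le> card {t, 1}" unfolding card by (simp add: True plus_basis_def)
    then have span: "V \<subseteq> span {t, 1}"
      using t(1) L_V one_V ind by (intro card_ge_dim_independent) auto
    have "R \<subseteq> V" using RZ True by (cases rule: is_RZ_cases) auto
    then have "R \<subseteq> span {t, 1}" using span by blast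
    moreover have "norm b \<le> 2 * (h + 1)" if "b \<in> {t, 1}" for b
      using that t(3) h_pos by (auto simp: norm_quat_one)
    ultimately have "\<bar>gram_det B\<bar> \<le> fact CARD(2) * (2 * (2 * (h + 1))\<^sup>2) ^ CARD(2)"
      using B ind t(1) L_R one_L card by (intro gram_det_le_set[where B' = "{t, 1}"]) auto
    also have "\<dots> = 2 * (8 * (h + 1)\<^sup>2) ^ 2" unfolding eq by simp
    \<comment> \<open>The rank 2 bound is raised to the common form, which is possible since
      \<open>8 * (h + 1)\<^sup>2\<close> is at least 1.\<close>
    also have "\<dots> \<le> 24 * (8 * (h + 1)\<^sup>2) ^ 4"
      using big by (intro mult_mono power_increasing) auto
    finally show ?thesis using disc by simp
  next
    case False
    obtain l where l: "l \<in> L" "e \<bullet> l = 0" "norm l < 2" "l \<notin> span {1}" using exists_short_nonreal[OF False] .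
    have nt: "t \<notin> span {l, 1}" using ht[of t "{l, 1}"] t(2) h_pos e_one l(2) by auto
    have nlt: "l * t \<notin> span {t, l, 1}" using mult_notin_span[OF l(2,4) t(2)] by (simp add: insert_commute)
    have ind: "independent {l * t, t, l, 1}"
      using l(4) nt nlt by (auto simp: independent_insert)
    have "l \<noteq> 1" "t \<noteq> l" "t \<noteq> 1" "l * t \<noteq> t" "l * t \<noteq> l" "l * t \<noteq> 1"
      using l(4) nt nlt span_base[of _ "{1}"] span_base[of _ "{l, 1}"] span_base[of _ "{t, l, 1}"] by auto
    then have card: "card {l * t, t, l, 1} = 4" by simp
    have sub: "{l * t, t, l, 1} \<subseteq> R" using R_mult[of l t] t(1) l(1) L_R R_1 by blast
    have "dim (UNIV :: quat set) = 4" by (simp add: Basis_quat_def)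
    then have "UNIV \<subseteq> span {l * t, t, l, 1}"
      using card ind by (intro card_ge_dim_independent) auto
    moreover have "norm b \<le> 2 * (h + 1)" if "b \<in> {l * t, t, l, 1}" for b
    proof -
      have "norm (l * t) \<le> 2 * (h + 1)"
        unfolding norm_quat_mult using l(3) t(3) h_pos by (intro mult_mono) auto
      then show ?thesis using that t(3) l(3) h_pos by (auto simp: norm_quat_one)
    qed
    ultimately have "\<bar>gram_det B\<bar> \<le> fact CARD(4) * (2 * (2 * (h + 1))\<^sup>2) ^ CARD(4)"
      using B ind sub card
      by (intro gram_det_le_set[where B' = "{l * t, t, l, 1}"]) auto
    also have "\<dots> = 24 * (8 * (h + 1)\<^sup>2) ^ 4" unfolding eq by (simp add: fact_numeral)
    finally show ?thesis using disc by simp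
  qed
qed

lemma h_gt_if_disc:
  assumes "\<bar>disc R\<bar> > 24 * (8 * (a + 1)\<^sup>2) ^ 4" "0 \<le> a" shows "a < h"
proof (rule ccontr)
  assume "\<not> a < h"
  then have "24 * (8 * (h + 1)\<^sup>2) ^ 4 \<le> 24 * (8 * (a + 1)\<^sup>2) ^ 4"
    using h_pos by (intro mult_left_mono power_mono) auto
  then show False using assms disc_le by linarith
qed

lemma slab: "10 < h \<Longrightarrow> slab V L e \<tau> h"
  by unfold_locales
    (use subspace_RR_plus L_V M_diff R_nrm L_R e_V norm_e \<tau>_L lattice_height near_plane_point in
      \<open>auto simp: nrm_eq_inner h_def\<close>)

end

section \<open>The groups\<close>

definition mat2 :: "'a \<Rightarrow> 'a \<Rightarrow> 'a \<Rightarrow> 'a \<Rightarrow> 'a::zero^2^2" where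
  "mat2 a b c d = vector [vector [a, b], vector [c, d]]"

lemma mat2_nth [simp]:
  "mat2 a b c d $ 1 $ 1 = a" "mat2 a b c d $ 1 $ 2 = b" "mat2 a b c d $ 2 $ 1 = c" "mat2 a b c d $ 2 $ 2 = d"
  by (simp_all add: mat2_def)

lemma mat2_eq_iff: "A = B \<longleftrightarrow> A $ 1 $ 1 = B $ 1 $ 1 \<and> A $ 1 $ 2 = B $ 1 $ 2 \<and> A $ 2 $ 1 = B $ 2 $ 1 \<and> A $ 2 $ 2 = B $ 2 $ 2"
  for A B :: "'a^2^2"
  by (auto simp: vec_eq_iff forall_2)

lemma mat2_expand: "M = mat2 (M $ 1 $ 1) (M $ 1 $ 2) (M $ 2 $ 1) (M $ 2 $ 2)" for M :: "'a::zero^2^2"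
  by (simp add: mat2_eq_iff)

lemma mat2_mult_nth: "(A ** B) $ i $ j = A $ i $ 1 * B $ 1 $ j + A $ i $ 2 * B $ 2 $ j" for A B :: "'a::semiring_1^2^2"
  by (simp add: matrix_matrix_mult_def sum_2)

lemma mat2_mult: "mat2 a b c d ** mat2 a' b' c' d' = mat2 (a * a' + b * c') (a * b' + b * d') (c * a' + d * c') (c * b' + d * d')"
  for a :: "'a::semiring_1"
  by (simp add: mat2_eq_iff mat2_mult_nth)

lemma mat2_one: "mat 1 = (mat2 1 0 0 1 :: 'a::semiring_1^2^2)"
  by (simp add: mat2_eq_iff mat_def)

lemma mat_over_iff: "M \<in> mat_over R \<longleftrightarrow> M $ 1 $ 1 \<in> R \<and> M $ 1 $ 2 \<in> R \<and> M $ 2 $ 1 \<in> R \<and> M $ 2 $ 2 \<in> R"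
  by (auto simp: mat_over_def forall_2)

subsection \<open>The block determinant\<close>

lemma UNIV_2_times_2: "(UNIV :: (2 \<times> 2) set) = {(1, 1), (1, 2), (2, 1), (2, 2)}"
  by (auto simp: UNIV_Times_UNIV[symmetric] UNIV_2)

lemma quat_to_mat_add: "quat_to_mat (x + y) = quat_to_mat x + quat_to_mat y"
  by (simp add: mat2_eq_iff quat_to_mat_def quat_ops complex_eq_iff)

lemma block_mat_mult: "block_mat (A ** B) = block_mat A ** block_mat B"
proof -
  have "block_mat (A ** B) $ r $ c = (block_mat A ** block_mat B) $ r $ c" for r c
  proof -
    have "block_mat (A ** B) $ r $ c
        = (quat_to_mat (A $ fst r $ 1) ** quat_to_mat (B $ 1 $ fst c)
           + quat_to_mat (A $ fst r $ 2) ** quat_to_mat (B $ 2 $ fst c)) $ snd r $ snd c"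
      by (simp add: block_mat_def mat2_mult_nth quat_to_mat_add quat_to_mat_mult)
    also have "\<dots> = (block_mat A ** block_mat B) $ r $ c"
      by (simp add: mat2_mult_nth) (simp add: block_mat_def matrix_matrix_mult_def UNIV_2_times_2)
    finally show ?thesis .
  qed
  then show ?thesis by (simp only: vec_eq_iff) blast
qed

lemma quat_to_mat_zero: "quat_to_mat 0 = 0"
  by (simp add: mat2_eq_iff quat_to_mat_def quat_ops complex_eq_iff)

lemma block_mat_one: "block_mat (mat 1) = mat 1"
proof -
  have "block_mat (mat 1) $ r $ c = (mat 1 :: complex^(2 \<times> 2)^(2 \<times> 2)) $ r $ c" for r c
    by (cases r; cases c) (auto simp: block_mat_def mat_def quat_to_mat_one quat_to_mat_zero)
  then show ?thesis by (simp only: vec_eq_iff) blast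
qed

text \<open>Laplace expansion with the index pairs in lexicographic order. The entries enter through
  \<open>f\<close>, so that block entries can be substituted afterwards.\<close>

lemma det_2_times_2:
  fixes A :: "complex^(2 \<times> 2)^(2 \<times> 2)"
  assumes "\<And>i j k l. A $ (i, j) $ (k, l) = f i j k l"
  shows "det A =
    f 1 1 1 1 * (f 1 2 1 2 * (f 2 1 2 1 * f 2 2 2 2 - f 2 1 2 2 * f 2 2 2 1)
      - f 1 2 2 1 * (f 2 1 1 2 * f 2 2 2 2 - f 2 1 2 2 * f 2 2 1 2)
      + f 1 2 2 2 * (f 2 1 1 2 * f 2 2 2 1 - f 2 1 2 1 * f 2 2 1 2))
  - f 1 1 1 2 * (f 1 2 1 1 * (f 2 1 2 1 * f 2 2 2 2 - f 2 1 2 2 * f 2 2 2 1)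
      - f 1 2 2 1 * (f 2 1 1 1 * f 2 2 2 2 - f 2 1 2 2 * f 2 2 1 1)
      + f 1 2 2 2 * (f 2 1 1 1 * f 2 2 2 1 - f 2 1 2 1 * f 2 2 1 1))
  + f 1 1 2 1 * (f 1 2 1 1 * (f 2 1 1 2 * f 2 2 2 2 - f 2 1 2 2 * f 2 2 1 2)
      - f 1 2 1 2 * (f 2 1 1 1 * f 2 2 2 2 - f 2 1 2 2 * f 2 2 1 1)
      + f 1 2 2 2 * (f 2 1 1 1 * f 2 2 1 2 - f 2 1 1 2 * f 2 2 1 1))
  - f 1 1 2 2 * (f 1 2 1 1 * (f 2 1 1 2 * f 2 2 2 1 - f 2 1 2 1 * f 2 2 1 2)
      - f 1 2 1 2 * (f 2 1 1 1 * f 2 2 2 1 - f 2 1 2 1 * f 2 2 1 1)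
      + f 1 2 2 1 * (f 2 1 1 1 * f 2 2 1 2 - f 2 1 1 2 * f 2 2 1 1))"
proof -
  have f4: "finite {(1, 2), (2, 1), (2, 2) :: 2 \<times> 2}" "((1, 1) :: 2 \<times> 2) \<notin> {(1, 2), (2, 1), (2, 2)}" by auto
  have f3: "finite {(2, 1), (2, 2) :: 2 \<times> 2}" "((1, 2) :: 2 \<times> 2) \<notin> {(2, 1), (2, 2)}" by auto
  have f2: "finite {(2, 2) :: 2 \<times> 2}" "((2, 1) :: 2 \<times> 2) \<notin> {(2, 2)}" by auto
  show ?thesis
    unfolding det_def UNIV_2_times_2
    unfolding sum_over_permutations_insert[OF f4] sum_over_permutations_insert[OF f3]
      sum_over_permutations_insert[OF f2] permutes_sing
    by (simp add: sign_swap_id permutation_swap_id permutation_compose sign_compose sign_id assms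
        transpose_def algebra_simps)
qed

lemma block_mat_nth: "block_mat M $ (i, j) $ (k, l) = quat_to_mat (M $ i $ k) $ j $ l"
  by (simp add: block_mat_def)

lemma quat_to_mat_nth:
  "quat_to_mat x $ 1 $ 1 = Complex (qRe x) (qI x)" "quat_to_mat x $ 1 $ 2 = Complex (qJ x) (qK x)"
  "quat_to_mat x $ 2 $ 1 = Complex (- qJ x) (qK x)" "quat_to_mat x $ 2 $ 2 = Complex (qRe x) (- qI x)"
  by (simp_all add: quat_to_mat_def)

lemma nrm_explicit: "nrm x = qRe x * qRe x + qI x * qI x + qJ x * qJ x + qK x * qK x"
  by (simp add: nrm_eq_inner inner_quat_def)

lemma quat_to_mat_minor:
  "quat_to_mat x $ 1 $ 1 * quat_to_mat x $ 2 $ 2 - quat_to_mat x $ 1 $ 2 * quat_to_mat x $ 2 $ 1 = of_real (nrm x)"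
  by (simp add: quat_to_mat_nth nrm_explicit complex_eq_iff algebra_simps)

lemma det_block_triangular:
  "det (block_mat (mat2 a b 0 d)) = of_real (nrm a * nrm d)"
  "det (block_mat (mat2 a 0 c d)) = of_real (nrm a * nrm d)"
  "det (block_mat (mat2 0 b c 0)) = of_real (nrm b * nrm c)"
  unfolding of_real_mult quat_to_mat_minor[symmetric]
  by (subst det_2_times_2[OF block_mat_nth], simp add: quat_to_mat_zero algebra_simps)+

lemma qcnj_mult_self: "qcnj x * x = of_real (nrm x)" "x * qcnj x = of_real (nrm x)"
  by (simp_all add: nrm_explicit qcnj_def of_real_def quat_eq_iff quat_ops algebra_simps)

lemma nrm_scaleR: "nrm (r *\<^sub>R x) = r\<^sup>2 * nrm x"
  by (simp add: nrm_eq_inner power2_eq_square)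

lemma nrm_qcnj: "nrm (qcnj x) = nrm x"
  by (simp add: nrm_explicit qcnj_def)

lemma nrm_eq_0: "nrm x = 0 \<longleftrightarrow> x = 0"
  by (simp add: nrm_eq_inner)

text \<open>The determinant of the complex block matrix in terms of the quaternion entries, known as
  the Study determinant; for c \<noteq> 0 it equals nrm c times the norm of b - a c^-1 d.\<close>

definition study_det :: "quat \<Rightarrow> quat \<Rightarrow> quat \<Rightarrow> quat \<Rightarrow> real" where
  "study_det a b c d = nrm a * nrm d + nrm b * nrm c - 2 * (b \<bullet> (a * qcnj c * d))"

text \<open>For c \<noteq> 0 the matrix is an antidiagonal one between two unipotent upper
  triangular ones, as in the Bruhat decomposition, and all three have block determinants known from
  \<open>det_block_triangular\<close>.\<close>

lemma det_block_mat: "det (block_mat (mat2 a b c d)) = of_real (study_det a b c d)"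
proof (cases "c = 0")
  case True
  have "nrm 0 = 0" "qcnj 0 = 0" by (simp_all add: nrm_explicit qcnj_def quat_ops)
  then show ?thesis using True by (simp add: det_block_triangular study_det_def)
next
  case False
  then have nc: "nrm c \<noteq> 0" by (simp add: nrm_eq_0)
  define r where "r = 1 / nrm c"
  define i where "i = r *\<^sub>R qcnj c"
  have ic: "i * c = 1" "c * i = 1"
    using nc by (simp_all add: i_def r_def qcnj_mult_self flip: of_real_def) (simp_all add: of_real_def)
  let ?b = "b - a * i * d"
  have "mat2 a b c d = mat2 1 (a * i) 0 1 ** (mat2 0 ?b c 0 ** mat2 1 (i * d) 0 1)"
    unfolding mat2_mult by (simp add: mat2_eq_iff ic mult.assoc) (simp add: ic mult.assoc[symmetric])
  then have "det (block_mat (mat2 a b c d)) = of_real (nrm ?b * nrm c)"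
    by (simp add: block_mat_mult det_mul det_block_triangular nrm_one)
  also have "nrm ?b * nrm c = study_det a b c d"
  proof -
    have "a * i * d = r *\<^sub>R (a * qcnj c * d)" by (simp add: i_def)
    then have "nrm ?b = nrm b - 2 * r * (b \<bullet> (a * qcnj c * d)) + r\<^sup>2 * nrm (a * qcnj c * d)"
      unfolding nrm_eq_inner by (simp add: inner_diff_left inner_diff_right inner_commute power2_eq_square)
    also have "nrm (a * qcnj c * d) = nrm a * nrm c * nrm d" by (simp add: nrm_mult nrm_qcnj)
    finally show ?thesis using nc by (simp add: study_det_def r_def power2_eq_square field_simps)
  qed
  finally show ?thesis .
qed

text \<open>A quaternionic adjugate: its entries are polynomials in the entries and their
  conjugates, so they stay in the ring and provide inverses in dimension 5. On the diagonal the
  mixed terms are a quaternion plus its conjugate, hence real.\<close>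

lemma study_adjugate:
  "mat2 (nrm d *\<^sub>R qcnj a - qcnj c * d * qcnj b) (nrm b *\<^sub>R qcnj c - qcnj a * b * qcnj d)
     (nrm c *\<^sub>R qcnj b - qcnj d * c * qcnj a) (nrm a *\<^sub>R qcnj d - qcnj b * a * qcnj c) ** mat2 a b c d
   = mat2 (of_real (study_det a b c d)) 0 0 (of_real (study_det a b c d))"
proof -
  have assoc: "x * y * qcnj z * z = nrm z *\<^sub>R (x * y)" for x y z
    by (simp add: mult.assoc qcnj_mult_self of_real_def)
  have re: "x + qcnj x = of_real (2 * qRe x)" for x
    by (simp add: quat_eq_iff quat_ops of_real_def qcnj_def)
  have anti: "qcnj (x * y) = qcnj y * qcnj x" "qcnj (qcnj x) = x" for x y
    by (simp_all add: quat_eq_iff quat_ops qcnj_def algebra_simps)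
  have 1: "qRe (qcnj a * b * qcnj d * c) = b \<bullet> (a * qcnj c * d)"
    "qRe (qcnj b * a * qcnj c * d) = b \<bullet> (a * qcnj c * d)"
    by (simp_all add: quat_ops qcnj_def inner_quat_def algebra_simps)
  have s1: "qcnj c * d * qcnj b * a + qcnj a * b * qcnj d * c = of_real (2 * (b \<bullet> (a * qcnj c * d)))"
    using re[of "qcnj a * b * qcnj d * c", unfolded 1] by (simp add: anti mult.assoc add.commute)
  have s2: "qcnj d * c * qcnj a * b + qcnj b * a * qcnj c * d = of_real (2 * (b \<bullet> (a * qcnj c * d)))"
    using re[of "qcnj b * a * qcnj c * d", unfolded 1] by (simp add: anti mult.assoc add.commute)
  have "(nrm d *\<^sub>R qcnj a - qcnj c * d * qcnj b) * a + (nrm b *\<^sub>R qcnj c - qcnj a * b * qcnj d) * c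
      = nrm d *\<^sub>R (qcnj a * a) + nrm b *\<^sub>R (qcnj c * c) - (qcnj c * d * qcnj b * a + qcnj a * b * qcnj d * c)"
    by (simp add: left_diff_distrib)
  also have "\<dots> = of_real (study_det a b c d)"
    unfolding s1 by (simp add: qcnj_mult_self study_det_def of_real_def scaleR_diff_left scaleR_add_left mult.commute)
  finally have e11: "(nrm d *\<^sub>R qcnj a - qcnj c * d * qcnj b) * a + (nrm b *\<^sub>R qcnj c - qcnj a * b * qcnj d) * c
      = of_real (study_det a b c d)" .
  have "(nrm c *\<^sub>R qcnj b - qcnj d * c * qcnj a) * b + (nrm a *\<^sub>R qcnj d - qcnj b * a * qcnj c) * d
      = nrm c *\<^sub>R (qcnj b * b) + nrm a *\<^sub>R (qcnj d * d) - (qcnj d * c * qcnj a * b + qcnj b * a * qcnj c * d)"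
    by (simp add: left_diff_distrib)
  also have "\<dots> = of_real (study_det a b c d)"
    unfolding s2 by (simp add: qcnj_mult_self study_det_def of_real_def scaleR_diff_left scaleR_add_left mult.commute)
  finally have e22: "(nrm c *\<^sub>R qcnj b - qcnj d * c * qcnj a) * b + (nrm a *\<^sub>R qcnj d - qcnj b * a * qcnj c) * d
      = of_real (study_det a b c d)" .
  have e12: "(nrm d *\<^sub>R qcnj a - qcnj c * d * qcnj b) * b + (nrm b *\<^sub>R qcnj c - qcnj a * b * qcnj d) * d = 0"
    by (simp add: left_diff_distrib assoc)
  have e21: "(nrm c *\<^sub>R qcnj b - qcnj d * c * qcnj a) * a + (nrm a *\<^sub>R qcnj d - qcnj b * a * qcnj c) * c = 0"
    by (simp add: left_diff_distrib assoc)
  show ?thesis unfolding mat2_mult e11 e12 e21 e22 ..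
qed

section \<open>The involutions and the equations of the three groups\<close>

lemma ddag_simps:
  "ddag (x + y) = ddag x + ddag y" "ddag (x - y) = ddag x - ddag y" "ddag (- x) = - ddag x"
  "ddag (x * y) = ddag y * ddag x" "ddag (ddag x) = x" "ddag 0 = 0" "ddag 1 = 1"
  "ddag (qcnj x) = qcnj (ddag x)" "ddag (r *\<^sub>R x) = r *\<^sub>R ddag x"
  by (simp_all add: ddag_def qcnj_def quat_ops quat_eq_iff algebra_simps)

lemma nrm_ddag: "nrm (ddag x) = nrm x"
  by (simp add: nrm_explicit ddag_def)

lemma qcnj_simps: "qcnj (x * y) = qcnj y * qcnj x" "qcnj (qcnj x) = x" "qcnj (x + y) = qcnj x + qcnj y"
  "qcnj (- x) = - qcnj x" "qcnj 1 = 1" "qcnj 0 = 0" "qcnj (r *\<^sub>R x) = r *\<^sub>R qcnj x"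
  by (simp_all add: quat_eq_iff quat_ops qcnj_def algebra_simps)

lemma ddag_hat_mat2: "ddag_hat (mat2 a b c d) = mat2 (ddag d) (- ddag b) (- ddag c) (ddag a)"
  by (simp add: ddag_hat_def mat2_def)

lemma ddag_hat_mult: "ddag_hat (A ** B) = ddag_hat B ** ddag_hat A"
proof -
  obtain a b c d a' b' c' d' where "A = mat2 a b c d" "B = mat2 a' b' c' d'" using mat2_expand by metis
  then show ?thesis by (simp add: mat2_mult ddag_hat_mat2 ddag_simps add.commute)
qed

lemma ddag_hat_ddag_hat: "ddag_hat (ddag_hat A) = A"
proof -
  obtain a b c d where "A = mat2 a b c d" using mat2_expand by metis
  then show ?thesis by (simp add: ddag_hat_mat2 ddag_simps)
qed

lemma complex_of_quat_hom:
  "complex_of_quat (x + y) = complex_of_quat x + complex_of_quat y"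
  "complex_of_quat (- x) = - complex_of_quat x"
  "complex_of_quat 1 = 1"
  "x \<in> RR_plus 3 \<Longrightarrow> y \<in> RR_plus 3 \<Longrightarrow> complex_of_quat (x * y) = complex_of_quat x * complex_of_quat y"
  by (simp_all add: complex_of_quat_def quat_ops complex_eq_iff RR_plus_iff)

lemma complex_of_quat_inject:
  "x \<in> RR_plus 3 \<Longrightarrow> y \<in> RR_plus 3 \<Longrightarrow> complex_of_quat x = complex_of_quat y \<longleftrightarrow> x = y"
  by (auto simp: complex_of_quat_def quat_eq_iff RR_plus_iff)

lemma RR_plus_3_mult: "x \<in> RR_plus 3 \<Longrightarrow> y \<in> RR_plus 3 \<Longrightarrow> x * y \<in> RR_plus 3"
  and RR_plus_3_commute: "x \<in> RR_plus 3 \<Longrightarrow> y \<in> RR_plus 3 \<Longrightarrow> x * y = y * x"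
  by (simp_all add: RR_plus_iff quat_ops quat_eq_iff)

lemma det_complex_mat2:
  assumes "a \<in> RR_plus 3" "b \<in> RR_plus 3" "c \<in> RR_plus 3" "d \<in> RR_plus 3"
  shows "det ((\<chi> i j. complex_of_quat (mat2 a b c d $ i $ j)) :: complex^2^2) = 1 \<longleftrightarrow> a * d - b * c = 1"
proof -
  have "a * d - b * c \<in> RR_plus 3" "1 \<in> RR_plus 3" using assms by (simp_all add: RR_plus_iff quat_ops)
  moreover have "det ((\<chi> i j. complex_of_quat (mat2 a b c d $ i $ j)) :: complex^2^2) = complex_of_quat (a * d - b * c)"
    using assms complex_of_quat_hom(1)[of "a * d" "- (b * c)"] by (simp add: det_2 complex_of_quat_hom)
  ultimately show ?thesis using complex_of_quat_inject complex_of_quat_hom(3) by metis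
qed

context covering_ring
begin

lemma GZ3_iff:
  assumes "n = 3"
  shows "mat2 a b c d \<in> GZ_set n R \<longleftrightarrow> a \<in> R \<and> b \<in> R \<and> c \<in> R \<and> d \<in> R \<and> a * d - b * c = 1"
proof -
  have "R \<subseteq> RR_plus 3" using RZ assms by (cases rule: is_RZ_cases) auto
  then show ?thesis using assms det_complex_mat2[of a b c d] by (auto simp: GZ_set_def mat_over_iff)
qed

lemma GZ4_iff:
  assumes "n = 4"
  shows "M \<in> GZ_set n R \<longleftrightarrow> M \<in> mat_over R \<and> ddag_hat M ** M = mat 1 \<and> M ** ddag_hat M = mat 1"
  using assms by (simp add: GZ_set_def)

lemma GZ5_iff:
  assumes "n = 5"
  shows "mat2 a b c d \<in> GZ_set n R \<longleftrightarrow> a \<in> R \<and> b \<in> R \<and> c \<in> R \<and> d \<in> R \<and> study_det a b c d = 1"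
  using assms by (simp add: GZ_set_def mat_over_iff det_block_mat of_real_eq_1_iff)

lemma R_add: "x \<in> R \<Longrightarrow> y \<in> R \<Longrightarrow> x + y \<in> R"
  using discrete_group.M_add[OF R_discrete] .

lemma R_uminus: "x \<in> R \<Longrightarrow> - x \<in> R"
  using discrete_group.M_uminus[OF R_discrete] .

lemma R_0: "0 \<in> R" using discrete_group.M_0[OF R_discrete] .

lemma R_scale_nrm: "x \<in> R \<Longrightarrow> y \<in> R \<Longrightarrow> nrm y *\<^sub>R x \<in> R"
  using discrete_group.M_scale_int[OF R_discrete] R_nrm by (metis Ints_cases)

lemma mat_over_mult: "A \<in> mat_over R \<Longrightarrow> B \<in> mat_over R \<Longrightarrow> A ** B \<in> mat_over R"
  by (simp add: mat_over_iff mat2_mult_nth R_add R_mult)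

text \<open>Inverses are the adjugate in the commutative case, \<open>ddag_hat\<close> in dimension
  4, and the quaternionic adjugate in dimension 5, where multiplicativity of the block determinant
  puts it into the group.\<close>

lemma group_GZ: "group (GZ n R)"
proof (rule groupI)
  show "\<one>\<^bsub>GZ n R\<^esub> \<in> carrier (GZ n R)"
  proof -
    consider "n = 3" | "n = 4" | "n = 5" using n_cases by blast
    then have "mat 1 \<in> GZ_set n R"
    proof cases
      case 1
      then show ?thesis using R_1 R_0 unfolding mat2_one GZ3_iff[OF 1] by simp
    next
      case 2
      then show ?thesis using R_1 R_0 unfolding GZ4_iff[OF 2]
        by (simp add: mat2_one mat_over_iff ddag_hat_mat2 mat2_mult ddag_simps)
    next
      case 3
      then show ?thesis using R_1 R_0 unfolding mat2_one GZ5_iff[OF 3]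
        by (simp add: study_det_def nrm_one nrm_eq_0[THEN iffD2])
    qed
    then show ?thesis by (simp add: GZ_def)
  qed
  show "A \<otimes>\<^bsub>GZ n R\<^esub> B \<in> carrier (GZ n R)" if AB: "A \<in> carrier (GZ n R)" "B \<in> carrier (GZ n R)" for A B
  proof -
    have A: "A \<in> GZ_set n R" and B: "B \<in> GZ_set n R" using AB by (simp_all add: GZ_def)
    have over: "A ** B \<in> mat_over R" using A B mat_over_mult by (auto simp: GZ_set_def split: if_splits)
    consider "n = 3" | "n = 4" | "n = 5" using n_cases by blast
    then have "A ** B \<in> GZ_set n R"
    proof cases
      case 1
      have sub: "R \<subseteq> RR_plus 3" using RZ 1 by (cases rule: is_RZ_cases) auto
      let ?c = "\<lambda>M :: quat^2^2. (\<chi> i j. complex_of_quat (M $ i $ j)) :: complex^2^2"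
      have AR: "A $ i $ j \<in> RR_plus 3" "B $ i $ j \<in> RR_plus 3" for i j
        using A B sub 1 by (auto simp: GZ_set_def mat_over_def)
      have "?c (A ** B) = ?c A ** ?c B"
        by (simp add: mat2_eq_iff mat2_mult_nth complex_of_quat_hom AR)
      then show ?thesis using A B over 1 by (simp add: GZ_set_def det_mul)
    next
      case 2
      have "ddag_hat (A ** B) ** (A ** B) = ddag_hat B ** (ddag_hat A ** A) ** B"
        by (simp add: ddag_hat_mult matrix_mul_assoc)
      moreover have "(A ** B) ** ddag_hat (A ** B) = A ** (B ** ddag_hat B) ** ddag_hat A"
        by (simp add: ddag_hat_mult matrix_mul_assoc)
      ultimately show ?thesis using A B over unfolding GZ4_iff[OF 2] by simp
    next
      case 3
      then show ?thesis using A B over by (simp add: GZ_set_def block_mat_mult det_mul)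
    qed
    then show ?thesis by (simp add: GZ_def)
  qed
  show "\<exists>B\<in>carrier (GZ n R). B \<otimes>\<^bsub>GZ n R\<^esub> A = \<one>\<^bsub>GZ n R\<^esub>" if "A \<in> carrier (GZ n R)" for A
  proof -
    have A: "A \<in> GZ_set n R" using that by (simp add: GZ_def)
    obtain a b c d where M: "A = mat2 a b c d" using mat2_expand by metis
    have abcd: "a \<in> R" "b \<in> R" "c \<in> R" "d \<in> R" using A unfolding M by (auto simp: GZ_set_def mat_over_iff split: if_splits)
    consider "n = 3" | "n = 4" | "n = 5" using n_cases by blast
    then have "\<exists>B\<in>GZ_set n R. B ** A = mat 1"
    proof cases
      case 1
      have sub: "R \<subseteq> RR_plus 3" using RZ 1 by (cases rule: is_RZ_cases) auto
      have com: "x * y = y * x" if "x \<in> R" "y \<in> R" for x y using sub that RR_plus_3_commute by blast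
      have det: "a * d - b * c = 1" using A unfolding M GZ3_iff[OF 1] by simp
      have "mat2 d (- b) (- c) a \<in> GZ_set n R"
        unfolding GZ3_iff[OF 1] using abcd R_uminus det com[of d a] com[of c b] by (simp add: com)
      moreover have "mat2 d (- b) (- c) a ** A = mat 1"
        unfolding M mat2_mult mat2_one using det com[OF abcd(4) abcd(1)] com[OF abcd(4) abcd(2)] com[OF abcd(3) abcd(1)] com[OF abcd(3) abcd(2)]
        by simp
      ultimately show ?thesis by blast
    next
      case 2
      have dR: "ddag x \<in> R" if "x \<in> R" for x
        using RZ that 2 by (cases rule: is_RZ_cases) auto
      have "ddag_hat A \<in> GZ_set n R"
        using A abcd dR R_uminus unfolding GZ4_iff[OF 2] ddag_hat_ddag_hat
        by (simp add: M ddag_hat_mat2 mat_over_iff)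
      moreover have "ddag_hat A ** A = mat 1" using A unfolding GZ4_iff[OF 2] by blast
      ultimately show ?thesis by blast
    next
      case 3
      let ?B = "mat2 (nrm d *\<^sub>R qcnj a - qcnj c * d * qcnj b) (nrm b *\<^sub>R qcnj c - qcnj a * b * qcnj d)
     (nrm c *\<^sub>R qcnj b - qcnj d * c * qcnj a) (nrm a *\<^sub>R qcnj d - qcnj b * a * qcnj c)"
      have sd: "study_det a b c d = 1" using A unfolding M GZ5_iff[OF 3] by simp
      have BA: "?B ** A = mat 1" unfolding M study_adjugate sd mat2_one by simp
      have "det (block_mat ?B) * det (block_mat A) = 1"
        unfolding det_mul[symmetric] block_mat_mult[symmetric] BA block_mat_one by simp
      then have "det (block_mat ?B) = 1" using A 3 by (simp add: GZ_set_def)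
      moreover have "?B \<in> mat_over R"
        using abcd by (simp add: mat_over_iff R_diff R_mult R_qcnj R_scale_nrm)
      ultimately have "?B \<in> GZ_set n R" using 3 by (simp add: GZ_set_def)
      then show ?thesis using BA by blast
    qed
    then show ?thesis by (simp add: GZ_def)
  qed
qed (simp_all add: GZ_def matrix_mul_assoc)

lemma EZ_subgroup: "subgroup (EZ n R) (GZ n R)"
  unfolding EZ_def by (rule group.generate_is_subgroup[OF group_GZ]) (auto simp: GZ_def)

end

section \<open>The packing\<close>

text \<open>A linear lift of a point map. The factor may depend on the point, but its positivity
  keeps the signs of linear forms, by which spheres and their interiors are described.\<close>

definition represents :: "(quat lspace \<Rightarrow> quat lspace) \<Rightarrow> (quat option \<Rightarrow> quat option) \<Rightarrow> bool" where
  "represents T g \<longleftrightarrow> (\<forall>z. \<exists>\<mu>>0. T (hat z) = \<mu> *\<^sub>R hat (g z))"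

lemma represents_id: "represents id id"
  unfolding represents_def by (auto intro: exI[of _ 1])

lemma represents_comp:
  assumes "represents S f" "represents T g" "linear S" shows "represents (S \<circ> T) (f \<circ> g)"
  unfolding represents_def
proof
  fix z
  obtain \<mu> where \<mu>: "0 < \<mu>" "T (hat z) = \<mu> *\<^sub>R hat (g z)" using assms(2) unfolding represents_def by blast
  obtain \<nu> where \<nu>: "0 < \<nu>" "S (hat (g z)) = \<nu> *\<^sub>R hat (f (g z))" using assms(1) unfolding represents_def by blast
  show "\<exists>\<mu>>0. (S \<circ> T) (hat z) = \<mu> *\<^sub>R hat ((f \<circ> g) z)"
    using \<mu> \<nu> by (intro exI[of _ "\<mu> * \<nu>"]) (simp add: linear_scale[OF assms(3)] del: hat_simps)
qed

lemma represents_finv: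
  assumes "represents T g" "linear T" "bij T" "linear (finv T)" "bij g" shows "represents (finv T) (finv g)"
  unfolding represents_def
proof
  fix z
  obtain \<mu> where \<mu>: "0 < \<mu>" "T (hat (finv g z)) = \<mu> *\<^sub>R hat (g (finv g z))"
    using assms(1) unfolding represents_def by blast
  have "g (finv g z) = z" using assms(5) by (simp add: bij_is_surj surj_f_inv_f)
  then have "hat (finv g z) = finv T (\<mu> *\<^sub>R hat z)" using \<mu>(2) assms(3) by (metis bij_inv_eq_iff)
  then have "finv T (hat z) = (1 / \<mu>) *\<^sub>R hat (finv g z)"
    using \<mu>(1) by (simp add: linear_scale[OF assms(4)] del: hat_simps)
  then show "\<exists>\<mu>>0. finv T (hat z) = \<mu> *\<^sub>R hat (finv g z)" using \<mu>(1) by (intro exI[of _ "1 / \<mu>"]) simp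
qed

lemma represents_translation: "represents (l_trans w) (translation w)"
  unfolding represents_def
proof
  fix z
  have "l_trans w (hat z) = 1 *\<^sub>R hat (translation w z)"
    by (cases z) (simp_all add: l_trans_def translation_def algebra_simps inner_commute)
  then show "\<exists>\<mu>>0. l_trans w (hat z) = \<mu> *\<^sub>R hat (translation w z)" by (intro exI[of _ 1]) simp
qed

lemma represents_inversion:
  "represents (l_trans p \<circ> (l_invert \<circ> l_trans (- p))) (inversion p)"
  unfolding represents_def
proof
  fix z
  show "\<exists>\<mu>>0. (l_trans p \<circ> (l_invert \<circ> l_trans (- p))) (hat z) = \<mu> *\<^sub>R hat (inversion p z)"
  proof (cases z)
    case None
    then show ?thesis by (intro exI[of _ 1]) (simp add: inversion_def l_trans_def l_invert_def)
  next
    case (Some x)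
    define y where "y = x - p"
    have t: "l_trans (- p) (hat (Some x)) = (1, y, y \<bullet> y)"
      by (simp add: y_def l_trans_def algebra_simps inner_commute)
    have eq: "(l_trans p \<circ> (l_invert \<circ> l_trans (- p))) (hat z) = l_trans p (y \<bullet> y, y, 1)"
      using Some t by (simp add: l_invert_def del: hat_simps)
    show ?thesis
    proof (cases "y = 0")
      case True
      then have "x = p" by (simp add: y_def)
      then show ?thesis using Some True unfolding eq
        by (intro exI[of _ 1]) (simp add: inversion_def l_trans_def)
    next
      case False
      then have "x \<noteq> p" by (simp add: y_def)
      have yy: "0 < y \<bullet> y" using False by simp
      have inv: "inversion p z = Some (p + (1 / (y \<bullet> y)) *\<^sub>R y)"
        using Some \<open>x \<noteq> p\<close> by (simp add: inversion_def y_def power2_norm_eq_inner)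
      have "l_trans p (y \<bullet> y, y, 1) = (y \<bullet> y) *\<^sub>R hat (inversion p z)"
        using yy unfolding inv
        by (simp add: l_trans_def algebra_simps inner_commute)
      then show ?thesis using yy unfolding eq by blast
    qed
  qed
qed

lemma bij_translation: "bij (translation w)"
  by (rule o_bij[of "translation (- w)"]) (auto simp: translation_def fun_eq_iff option.map_comp o_def option.map_ident)

lemma inversion_inversion: "inversion p (inversion p z) = z"
proof (cases z)
  case (Some x)
  show ?thesis
  proof (cases "x = p")
    case False
    then have n: "norm (x - p) \<noteq> 0" by simp
    let ?y = "(1 / (norm (x - p))\<^sup>2) *\<^sub>R (x - p)"
    have "norm ?y = 1 / norm (x - p)" using n by (simp add: power2_eq_square)
    then have "(1 / (norm ?y)\<^sup>2) *\<^sub>R ?y = x - p" using n by (simp add: power_divide)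
    moreover have "?y \<noteq> 0" using False by simp
    ultimately show ?thesis using Some False by (simp add: inversion_def)
  qed (simp add: Some inversion_def)
qed (simp add: inversion_def)

lemma bij_inversion: "bij (inversion p)"
  by (rule o_bij[of "inversion p"]) (auto simp: fun_eq_iff inversion_inversion)

lemma Bij_UNIV: "g \<in> Bij UNIV \<longleftrightarrow> bij g"
  by (simp add: Bij_def)

lemma act_comp: "act (f \<circ> g) S = act f (act g S)"
  by (simp add: act_def image_comp)

lemma act_translation_0: "act (translation 0) S = S"
proof -
  have "translation 0 = id" by (simp add: translation_def fun_eq_iff option.map_ident)
  then show ?thesis by (simp add: act_def)
qed

lemma translation_comp: "translation v \<circ> translation w = translation (w + v)"
  by (auto simp: translation_def fun_eq_iff option.map_comp o_def add.assoc)

lemma Int_sphere_translation: "Int_sphere (act (translation w) S) = (\<lambda>y. y + (- w)) -` Int_sphere S"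
proof -
  have "y \<in> Int_sphere (act (translation w) S) \<longleftrightarrow> Some (y - w) \<in> snd S" for y
  proof
    assume "y \<in> Int_sphere (act (translation w) S)"
    then obtain z where "z \<in> snd S" "Some y = translation w z" by (auto simp: Int_sphere_def act_def)
    then show "Some (y - w) \<in> snd S" by (cases z) (auto simp: translation_def)
  next
    assume "Some (y - w) \<in> snd S"
    then show "y \<in> Int_sphere (act (translation w) S)"
      by (auto simp: Int_sphere_def act_def translation_def intro!: image_eqI[of _ _ "Some (y - w)"])
  qed
  then show ?thesis by (auto simp: Int_sphere_def)
qed

lemma sign_sets_cong:
  fixes f g :: "'a \<Rightarrow> real"
  assumes "\<And>x. x \<in> E \<Longrightarrow> f x = g x"
  shows "({x \<in> E. f x = 0}, {x \<in> E. f x < 0}) = ({x \<in> E. g x = 0}, {x \<in> E. g x < 0})"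
  using assms by auto

section \<open>The spheres of the packing as images of two half-spaces\<close>

locale wide_shift = covering_shift +
  assumes h_gt_10: "10 < h"
begin

sublocale S: slab V L e \<tau> h by (rule slab[OF h_gt_10])

abbreviation "\<Lambda> \<equiv> plane_lattice n R u"
abbreviation "G \<equiv> Gamma n R u \<tau>"

lemma \<Lambda>_iff: "w \<in> \<Lambda> \<longleftrightarrow> w \<in> L \<and> e \<bullet> w = 0"
  by (simp add: plane_lattice_iff e_inner_0)

abbreviation "side_gen \<equiv> map_gen (S.side_grp True \<union> S.side_grp False)"

lemma map_gen_side_grp:
  assumes "T \<in> side_gen" shows "T \<in> S.LG" "finv T \<in> side_gen"
proof -
  show "T \<in> S.LG"
    using assms
  proof (induction rule: map_gen.induct)
    case map_gen_id
    then show ?case using S.LG_group unfolding map_group_def by blast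
  next
    case (map_gen_comp a w)
    then have "a \<in> S.LG" by (auto simp: S.side_grp_def)
    then show ?case using S.LG_comp map_gen_comp by blast
  qed
  have "bij f \<and> finv f \<in> S.side_grp True \<union> S.side_grp False"
    if "f \<in> S.side_grp True \<union> S.side_grp False" for f
    using that S.map_group_side_grp[of True] S.map_group_side_grp[of False] unfolding map_group_def by blast
  then show "finv T \<in> side_gen" using map_gen_inv assms by blast
qed

text \<open>Carries the packing group over to the linear setting of
  \<open>half_space_images\<close>. Bijectivity is part of the claim because product and inverse in
  \<open>BijGroup\<close> are composition and inverse map only on bijections.\<close>

lemma Gamma_represented:
  assumes "g \<in> G"
  shows "bij g \<and> (\<exists>T\<in>side_gen. represents T g)"
proof -
  let ?gens = "translation ` \<Lambda> \<union> inversion ` {p \<in> L. p \<in> hyp n u \<or> p - \<tau> \<in> hyp n u}"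
  have gen: "bij g \<and> (\<exists>T\<in>side_gen. represents T g)" if g: "g \<in> ?gens" for g
  proof -
    consider w where "w \<in> \<Lambda>" "g = translation w"
      | p where "p \<in> L" "p \<in> hyp n u" "g = inversion p" | p where "p \<in> L" "p - \<tau> \<in> hyp n u" "g = inversion p"
      using g by blast
    then show ?thesis
    proof cases
      case 1
      then have "l_trans w \<in> S.side_grp True" by (intro S.l_trans_side_grp) (auto simp: \<Lambda>_iff)
      then have "l_trans w \<in> side_gen" by (intro map_gen_incl) blast
      then show ?thesis using 1 represents_translation bij_translation by blast
    next
      case 2
      then have "S.fl True (hat (Some p)) = 0" using e_inner_0 by (simp add: S.fl_def hyp_def)
      then have "l_trans p \<circ> (l_invert \<circ> l_trans (- p)) \<in> S.side_grp True"
        by (intro S.inversion_side_grp 2)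
      then have "l_trans p \<circ> (l_invert \<circ> l_trans (- p)) \<in> side_gen" by (intro map_gen_incl) blast
      then show ?thesis using 2 represents_inversion bij_inversion by blast
    next
      case 3
      then have "e \<bullet> (p - \<tau>) = 0" using e_inner_0 by (simp add: hyp_def)
      then have "e \<bullet> p = h" by (simp add: inner_diff_right h_def)
      then have "S.fl False (hat (Some p)) = 0" by (simp add: S.fl_def)
      then have "l_trans p \<circ> (l_invert \<circ> l_trans (- p)) \<in> S.side_grp False"
        by (intro S.inversion_side_grp 3)
      then have "l_trans p \<circ> (l_invert \<circ> l_trans (- p)) \<in> side_gen" by (intro map_gen_incl) blast
      then show ?thesis using 3 represents_inversion bij_inversion by blast
    qed
  qed
  have "g \<in> generate (BijGroup UNIV) ?gens" using assms by (simp add: Gamma_def)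
  then show ?thesis
  proof (induction rule: generate.induct)
    case one
    have "(\<one>\<^bsub>BijGroup UNIV\<^esub>) = (id :: quat option \<Rightarrow> quat option)" by (simp add: BijGroup_def fun_eq_iff)
    then show ?case using represents_id map_gen.map_gen_id bij_id by metis
  next
    case (incl h)
    then show ?case by (rule gen)
  next
    case (inv h)
    obtain T where T: "bij h" "T \<in> side_gen" "represents T h" using gen[OF inv] by blast
    have eq: "inv\<^bsub>BijGroup UNIV\<^esub> h = finv h" using T(1) by (simp add: inv_BijGroup Bij_UNIV restrict_def)
    have "represents (finv T) (finv h)"
      using T S.LG_D(1,2) map_gen_side_grp[OF T(2)] map_gen_side_grp(1)[OF map_gen_side_grp(2)[OF T(2)]]
      by (intro represents_finv) auto
    then show ?case unfolding eq using map_gen_side_grp(2)[OF T(2)] bij_imp_bij_inv[OF T(1)] by blast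
  next
    case (eng h1 h2)
    obtain T1 where T1: "bij h1" "T1 \<in> side_gen" "represents T1 h1" using eng.IH(1) by blast
    obtain T2 where T2: "bij h2" "T2 \<in> side_gen" "represents T2 h2" using eng.IH(2) by blast
    have eq: "h1 \<otimes>\<^bsub>BijGroup UNIV\<^esub> h2 = h1 \<circ> h2"
      using T1(1) T2(1) by (simp add: BijGroup_def Bij_UNIV compose_def fun_eq_iff)
    show ?case
      unfolding eq using represents_comp[OF T1(3) T2(3) S.LG_D(1)[OF map_gen_side_grp(1)[OF T1(2)]]] map_gen_mult[OF T1(2) T2(2)]
        bij_comp[OF T2(1) T1(1)] by blast
  qed
qed

text \<open>The two bounding planes in a common form, with the interior on the negative side of
  \<open>fl j\<close>. Infinity lies on both, as \<open>fl j\<close> vanishes at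
  \<open>e_inf\<close>.\<close>

definition base :: "bool \<Rightarrow> osphere" where
  "base j = ({z \<in> ext_space n. S.fl j (hat z) = 0}, {z \<in> ext_space n. S.fl j (hat z) < 0})"

lemma ext_space_iff: "z \<in> ext_space n \<longleftrightarrow> hat z \<in> S.WV"
  using subspace_0[OF subspace_RR_plus] by (cases z) (auto simp: ext_space_def S.WV_def)

lemma fl_hat: "S.fl True (hat (Some z)) = e \<bullet> z" "S.fl False (hat (Some z)) = h - e \<bullet> z"
  by (simp_all add: S.fl_def)

lemma base_planes_eq: "base_planes n u \<tau> = {base True, base False}"
proof -
  have pos: "0 < norm u" using u_facts by simp
  have sgn: "u \<bullet> x = 0 \<longleftrightarrow> e \<bullet> x = 0" "0 < u \<bullet> x \<longleftrightarrow> 0 < e \<bullet> x" for x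
    using pos by (simp_all add: u_inner zero_less_mult_iff)
  have fst_T: "fst (S_plane n u) = fst (base True)"
    by (auto simp: S_plane_def base_def hyp_def sgn ext_space_def fl_hat S.fl_e_inf simp del: hat_simps(2))
  have 1: "op_sphere n (S_plane n u) = base True"
  proof -
    have "ext_space n - fst (S_plane n u) - snd (S_plane n u) = snd (base True)"
      unfolding fst_T by (auto simp: S_plane_def base_def sgn ext_space_def fl_hat S.fl_e_inf simp del: hat_simps(2))
    then show ?thesis unfolding op_sphere_def fst_T by (simp add: prod_eq_iff)
  qed
  have tV: "\<tau> \<in> V" using \<tau>_L L_V by blast
  have shift_image: "translation \<tau> ` (Some ` {x \<in> V. P (e \<bullet> x)}) = Some ` {x \<in> V. P (e \<bullet> x - h)}" for P
  proof (intro equalityI subsetI)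
    fix z assume "z \<in> translation \<tau> ` (Some ` {x \<in> V. P (e \<bullet> x)})"
    then obtain x where x: "x \<in> V" "P (e \<bullet> x)" "z = Some (x + \<tau>)" by (auto simp: translation_def)
    then show "z \<in> Some ` {x \<in> V. P (e \<bullet> x - h)}"
      using subspace_add[OF subspace_RR_plus x(1) tV] by (auto simp: inner_add_right h_def)
  next
    fix z assume "z \<in> Some ` {x \<in> V. P (e \<bullet> x - h)}"
    then obtain x where x: "x \<in> V" "P (e \<bullet> x - h)" "z = Some x" by auto
    have "z = translation \<tau> (Some (x - \<tau>))" using x by (simp add: translation_def)
    moreover have "x - \<tau> \<in> V" using subspace_diff[OF subspace_RR_plus x(1) tV] .
    moreover have "P (e \<bullet> (x - \<tau>))" using x(2) by (simp add: inner_diff_right h_def)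
    ultimately show "z \<in> translation \<tau> ` (Some ` {x \<in> V. P (e \<bullet> x)})" by blast
  qed
  have 2: "act (translation \<tau>) (S_plane n u) = base False"
  proof -
    have "translation \<tau> ` fst (S_plane n u) = insert None (Some ` {x \<in> V. e \<bullet> x - h = 0})"
      using shift_image[of "\<lambda>x. x = 0"] by (simp add: S_plane_def hyp_def sgn) (simp add: translation_def)
    also have "\<dots> = fst (base False)"
      by (auto simp: base_def ext_space_def fl_hat S.fl_e_inf simp del: hat_simps(2))
    finally have a: "translation \<tau> ` fst (S_plane n u) = fst (base False)" .
    have "translation \<tau> ` snd (S_plane n u) = Some ` {x \<in> V. 0 < e \<bullet> x - h}"
      using shift_image[of "\<lambda>x. 0 < x"] by (simp add: S_plane_def sgn)
    also have "\<dots> = snd (base False)"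
      by (auto simp: base_def ext_space_def fl_hat S.fl_e_inf simp del: hat_simps(2))
    finally show ?thesis using a by (simp add: act_def prod_eq_iff)
  qed
  show ?thesis unfolding base_planes_def 1 2 ..
qed

text \<open>Pulling \<open>fl j\<close> back by the inverse lift describes the image sphere by the
  sign of one linear form on the cone; disjointness and measurability are read off from that
  form.\<close>

lemma act_base:
  assumes g: "bij g" "represents T g" "T \<in> S.LG"
  shows "act g (base j) =
    ({y \<in> ext_space n. S.fl j (finv T (hat y)) = 0}, {y \<in> ext_space n. S.fl j (finv T (hat y)) < 0})"
proof -
  have step: "\<exists>\<mu>>0. finv T (hat (g z)) = \<mu> *\<^sub>R hat z" for z
  proof -
    obtain \<mu> where \<mu>: "0 < \<mu>" "T (hat z) = \<mu> *\<^sub>R hat (g z)" using g(2) unfolding represents_def by blast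
    then have "hat z = \<mu> *\<^sub>R finv T (hat (g z))"
      using S.LG_finv(2)[OF g(3)] linear_scale[OF S.LG_D(1)[OF S.LG_finv(1)[OF g(3)]]] by metis
    then have "finv T (hat (g z)) = (1 / \<mu>) *\<^sub>R hat z" using \<mu>(1) by simp
    then show ?thesis using \<mu>(1) by (intro exI[of _ "1 / \<mu>"]) simp
  qed
  have ext: "g z \<in> ext_space n \<longleftrightarrow> z \<in> ext_space n" for z
  proof -
    have cone: "\<mu> *\<^sub>R x \<in> S.WV \<longleftrightarrow> x \<in> S.WV" if "0 < \<mu>" for \<mu> x
      using that subspace_scale[OF subspace_RR_plus, of "lv x" n \<mu>]
        subspace_scale[OF subspace_RR_plus, of "\<mu> *\<^sub>R lv x" n "1 / \<mu>"] by (auto simp: S.WV_def)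
    obtain \<mu> where \<mu>: "0 < \<mu>" "T (hat z) = \<mu> *\<^sub>R hat (g z)" using g(2) unfolding represents_def by blast
    have "T (hat z) \<in> S.WV \<longleftrightarrow> hat z \<in> S.WV"
      using S.LG_WV[OF g(3)] S.LG_WV[OF S.LG_finv(1)[OF g(3)]] S.LG_finv(2)[OF g(3)] by metis
    then show ?thesis unfolding ext_space_iff using \<mu> cone by metis
  qed
  have sgn: "S.fl j (finv T (hat (g z))) = 0 \<longleftrightarrow> S.fl j (hat z) = 0"
    "S.fl j (finv T (hat (g z))) < 0 \<longleftrightarrow> S.fl j (hat z) < 0" for z
    using step[of z] by (auto simp: S.fl_scaleR mult_less_0_iff)
  have img: "g ` {z \<in> ext_space n. P (S.fl j (hat z))} = {y \<in> ext_space n. P (S.fl j (finv T (hat y)))}"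
    if P: "\<And>z. P (S.fl j (finv T (hat (g z)))) \<longleftrightarrow> P (S.fl j (hat z))" for P
  proof (intro equalityI subsetI)
    fix y assume y: "y \<in> {y \<in> ext_space n. P (S.fl j (finv T (hat y)))}"
    have "y = g (finv g y)" using g(1) by (simp add: bij_is_surj surj_f_inv_f)
    then show "y \<in> g ` {z \<in> ext_space n. P (S.fl j (hat z))}"
      using y P[of "finv g y"] ext[of "finv g y"] by (auto intro!: image_eqI[of _ g "finv g y"])
  qed (auto simp: ext P)
  have "g ` {z \<in> ext_space n. S.fl j (hat z) = 0} = {y \<in> ext_space n. S.fl j (finv T (hat y)) = 0}"
    by (rule img[of "\<lambda>x. x = 0"]) (rule sgn(1))
  moreover have "g ` {z \<in> ext_space n. S.fl j (hat z) < 0} = {y \<in> ext_space n. S.fl j (finv T (hat y)) < 0}"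
    by (rule img[of "\<lambda>x. x < 0"]) (rule sgn(2))
  ultimately show ?thesis by (simp only: act_def base_def fst_conv snd_conv)
qed

lemma fl_finv:
  assumes "T \<in> S.LG" "\<And>x. x \<in> S.WV \<Longrightarrow> S.fl j (T x) = S.fl j x" "x \<in> S.WV"
  shows "S.fl j (finv T x) = S.fl j x"
  using assms(2)[OF S.LG_WV[OF S.LG_finv(1)[OF assms(1)] assms(3)]] S.LG_finv(3)[OF assms(1)] by simp

lemma Int_act_base:
  assumes g: "bij g" "represents T g" "T \<in> S.LG"
  shows "Int_sphere (act g (base j)) = {y \<in> V. S.fl j (finv T (hat (Some y))) < 0}"
  unfolding act_base[OF g] by (auto simp: Int_sphere_def ext_space_def simp del: hat_simps)

lemma packing_iff: "A \<in> packing n R u \<tau> \<longleftrightarrow> (\<exists>g\<in>G. \<exists>j. A = act g (base j))"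
  unfolding packing_def base_planes_eq mem_Collect_eq insert_iff empty_iff by (metis (full_types))

lemma finv_hat_Some:
  assumes T: "T \<in> S.LG" and y: "y \<in> V" "S.fl j (finv T (hat (Some y))) < 0"
  obtains \<mu> z where "0 < \<mu>" "z \<in> V" "finv T (hat (Some y)) = \<mu> *\<^sub>R hat (Some z)" "S.fl j (hat (Some z)) < 0"
proof -
  obtain \<mu> z' where \<mu>: "0 < \<mu>" "finv T (hat (Some y)) = \<mu> *\<^sub>R hat z'" using S.LG_hat[OF S.LG_finv(1)[OF T]] by metis
  then have neg: "S.fl j (hat z') < 0" using y(2) by (simp add: S.fl_scaleR mult_less_0_iff del: hat_simps)
  then obtain z where z: "z' = Some z" by (cases z') (auto simp: S.fl_e_inf)
  have "z \<in> V" using S.scaled_hat_WV[OF \<mu>(1), of z] S.LG_WV[OF S.LG_finv(1)[OF T] S.hat_WV[OF y(1)]] \<mu>(2) z by metis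
  then show thesis using that \<mu> z neg by blast
qed

text \<open>The quotient \<open>W\<close> of the lifts takes some point behind plane
  \<open>j\<close> to a point behind plane \<open>i\<close>. Either \<open>W\<close> preserves the
  form of plane \<open>j\<close>, and the spheres agree; or it shrinks that half-space into the
  strip between the planes, which is behind neither of them.\<close>

lemma packing_disjoint:
  assumes A: "A \<in> packing n R u \<tau>" "A' \<in> packing n R u \<tau>" and y: "y \<in> Int_sphere A" "y \<in> Int_sphere A'"
  shows "A = A'"
proof -
  obtain g i where g: "g \<in> G" "A = act g (base i)" using A(1) packing_iff by blast
  obtain g' j where g': "g' \<in> G" "A' = act g' (base j)" using A(2) packing_iff by blast
  obtain T where T: "bij g" "T \<in> side_gen" "represents T g" using Gamma_represented[OF g(1)] by blast
  obtain T' where T': "bij g'" "T' \<in> side_gen" "represents T' g'" using Gamma_represented[OF g'(1)] by blast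
  note TL = map_gen_side_grp(1)[OF T(2)] and TL' = map_gen_side_grp(1)[OF T'(2)]
  have yV: "y \<in> V" and yi: "S.fl i (finv T (hat (Some y))) < 0" and yj: "S.fl j (finv T' (hat (Some y))) < 0"
    using y unfolding g(2) g'(2) Int_act_base[OF T(1,3) TL] Int_act_base[OF T'(1,3) TL'] by auto
  obtain \<mu> z where z: "0 < \<mu>" "z \<in> V" "finv T' (hat (Some y)) = \<mu> *\<^sub>R hat (Some z)" "S.fl j (hat (Some z)) < 0"
    using finv_hat_Some[OF TL' yV yj] .
  define W where "W = finv T \<circ> T'"
  have WM: "W \<in> side_gen" unfolding W_def by (intro map_gen_mult map_gen_side_grp(2) T T')
  note WL = map_gen_side_grp(1)[OF WM]
  have W_eq: "W (finv T' x) = finv T x" for x by (simp add: W_def S.LG_finv(3)[OF TL'])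
  have "\<mu> * S.fl i (W (hat (Some z))) = S.fl i (finv T (hat (Some y)))"
    using W_eq[of "hat (Some y)"] z(3) linear_scale[OF S.LG_D(1)[OF WL]] by (metis S.fl_scaleR)
  then have Wi: "S.fl i (W (hat (Some z))) < 0" using yi z(1) by (metis mult_less_0_iff less_asym)
  from S.half_space_images[OF WM, of j] show ?thesis
  proof
    assume pres: "\<forall>x\<in>S.WV. S.fl j (W x) = S.fl j x"
    have "i = j"
    proof (rule ccontr)
      \<comment> \<open>The two forms add up to \<open>h\<close> times a nonnegative first
        coordinate, so no point is behind both planes.\<close>
      assume "i \<noteq> j"
      then have i: "i = (\<not> j)" by auto
      obtain \<nu> w where w: "0 < \<nu>" "W (hat (Some z)) = \<nu> *\<^sub>R hat w" using S.LG_hat[OF WL] by metis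
      have "0 \<le> lA (hat w)" by (cases w) auto
      then have "0 \<le> lA (W (hat (Some z)))" using w by (simp del: hat_simps)
      then have "0 \<le> h * lA (W (hat (Some z)))" using h_pos by simp
      moreover have "S.fl j (W (hat (Some z))) < 0" using pres S.hat_WV[OF z(2)] z(4) by auto
      ultimately show False using Wi unfolding i S.fl_not by linarith
    qed
    have "S.fl i (finv T (hat x)) = S.fl j (finv T' (hat x))" if "x \<in> ext_space n" for x
    proof -
      have "finv T' (hat x) \<in> S.WV"
        using S.LG_WV[OF S.LG_finv(1)[OF TL']] that unfolding ext_space_iff by blast
      then have "S.fl j (W (finv T' (hat x))) = S.fl j (finv T' (hat x))" using pres by blast
      then show ?thesis unfolding W_eq \<open>i = j\<close> .
    qed
    then show ?thesis
      unfolding g(2) g'(2) act_base[OF T(1,3) TL] act_base[OF T'(1,3) TL'] by (rule sign_sets_cong)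
  next
    assume "\<exists>k. S.shrinks W j k"
    then obtain k \<nu> w where w: "0 < \<nu>" "W (hat (Some z)) = \<nu> *\<^sub>R hat (Some w)"
      "0 < S.fl k (hat (Some w))" "S.fl k (hat (Some w)) \<le> 1"
      using z(2,4) unfolding S.shrinks_def by blast
    have "0 < S.fl (\<not> k) (hat (Some w))" using w(4) h_gt_10 by (simp add: S.fl_not)
    then have "0 < S.fl i (hat (Some w))" using w(3) by (cases i; cases k) auto
    then show ?thesis using Wi w(1) unfolding w(2) S.fl_scaleR by (simp add: mult_less_0_iff del: hat_simps)
  qed
qed

text \<open>A sphere other than the two planes comes from a shrinking element, so its interior is
  within 1 of a point \<open>q\<close> of one of the planes. By the covering property a translation
  brings \<open>q\<close> within 1 of 0 or of \<tau>.\<close>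

lemma packing_bounded:
  assumes A: "A \<in> packing n R u \<tau>" "A \<notin> base_planes n u \<tau>"
  obtains w where "w \<in> \<Lambda>" "Int_sphere (act (translation w) A) \<subseteq> ball 0 2 \<union> ball \<tau> 2"
proof -
  obtain g j where g: "g \<in> G" "A = act g (base j)" using A(1) packing_iff by blast
  obtain T where T: "bij g" "T \<in> side_gen" "represents T g"
    using Gamma_represented[OF g(1)] by blast
  note TL = map_gen_side_grp(1)[OF T(2)]
  have "\<not> (\<forall>x\<in>S.WV. S.fl j (T x) = S.fl j x)"
  proof
    assume "\<forall>x\<in>S.WV. S.fl j (T x) = S.fl j x"
    then have "S.fl j (finv T (hat x)) = S.fl j (hat x)" if "x \<in> ext_space n" for x
      using fl_finv[OF TL] that unfolding ext_space_iff by blast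
    then have "A = base j" unfolding g(2) act_base[OF T(1,3) TL] unfolding base_def
      by (rule sign_sets_cong)
    then show False using A(2) unfolding base_planes_eq by (cases j) auto
  qed
  then obtain k where "S.shrinks T j k" using S.half_space_images[OF T(2)] by blast
  then obtain q where q: "q \<in> V" "S.fl k (hat (Some q)) = 0"
    and near: "\<And>z. z \<in> V \<Longrightarrow> S.fl j (hat (Some z)) < 0 \<Longrightarrow>
      \<exists>\<mu>>0. \<exists>y\<in>V. T (hat (Some z)) = \<mu> *\<^sub>R hat (Some y) \<and> norm (y - q) \<le> 1"
    unfolding S.shrinks_def by blast
  have near_q: "norm (y - q) \<le> 1" if "y \<in> Int_sphere A" for y
  proof -
    have yV: "y \<in> V" and yj: "S.fl j (finv T (hat (Some y))) < 0"
      using that unfolding g(2) Int_act_base[OF T(1,3) TL] by auto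
    obtain \<mu> z where z: "0 < \<mu>" "z \<in> V" "finv T (hat (Some y)) = \<mu> *\<^sub>R hat (Some z)" "S.fl j (hat (Some z)) < 0"
      using finv_hat_Some[OF TL yV yj] .
    obtain \<nu> y' where y': "0 < \<nu>" "T (hat (Some z)) = \<nu> *\<^sub>R hat (Some y')" "norm (y' - q) \<le> 1"
      using near[OF z(2,4)] by blast
    have "1 *\<^sub>R hat (Some y) = (\<mu> * \<nu>) *\<^sub>R hat (Some y')"
      using S.LG_finv(3)[OF TL, of "hat (Some y)"] z(3) y'(2) linear_scale[OF S.LG_D(1)[OF TL]]
      by (simp del: hat_simps)
    then have "y = y'" using hat_ray_eqD zero_less_one by blast
    then show ?thesis using y' by simp
  qed
  define c where "c = (if k then 0 else \<tau>)"
  have "e \<bullet> q = (if k then 0 else h)" using q(2) by (cases k) (simp_all add: fl_hat del: hat_simps)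
  then have "e \<bullet> (q - c) = 0" by (cases k) (simp_all add: c_def inner_diff_right flip: h_def)
  moreover have "q - c \<in> V"
    using q(1) \<tau>_L L_V subspace_diff[OF subspace_RR_plus] by (auto simp: c_def)
  ultimately obtain p where p: "p \<in> L" "e \<bullet> p = 0" "norm (q - c - p) < 1" using near_plane_point by blast
  have "Int_sphere (act (translation (- p)) A) \<subseteq> ball c 2"
  proof
    fix x assume "x \<in> Int_sphere (act (translation (- p)) A)"
    then have "norm (x + p - q) \<le> 1" using near_q[of "x + p"] by (simp add: Int_sphere_translation)
    moreover have "norm (x - c) \<le> norm (x + p - q) + norm (q - c - p)"
      using norm_triangle_ineq[of "x + p - q" "q - c - p"] by simp
    ultimately show "x \<in> ball c 2" using p(3) by (simp add: dist_norm norm_minus_commute)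
  qed
  moreover have "ball c 2 \<subseteq> ball 0 2 \<union> ball \<tau> 2" by (auto simp: c_def)
  moreover have "- p \<in> \<Lambda>" using p M_uminus by (simp add: \<Lambda>_iff)
  ultimately show thesis using that by blast
qed

lemma packing_Int_measurable:
  assumes "A \<in> packing n R u \<tau>" shows "Int_sphere A \<in> sets borel"
proof -
  obtain g j where g: "g \<in> G" "A = act g (base j)" using assms packing_iff by blast
  obtain T where T: "bij g" "T \<in> side_gen" "represents T g"
    using Gamma_represented[OF g(1)] by blast
  note TL = map_gen_side_grp(1)[OF T(2)]
  have "continuous_on UNIV (finv T)"
    using S.LG_D(1)[OF S.LG_finv(1)[OF TL]] by (simp add: linear_continuous_on linear_conv_bounded_linear)
  then have cT: "continuous_on UNIV (\<lambda>y. finv T (1, y, y \<bullet> y))"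
    by (rule continuous_on_compose2[where g = "finv T"]) (auto intro!: continuous_intros)
  have cont: "continuous_on UNIV (\<lambda>y. S.fl j (finv T (hat (Some y))))"
    unfolding hat_simps S.fl_def by (cases j) (auto intro!: continuous_intros cT)
  then have "open {y. S.fl j (finv T (hat (Some y))) < 0}"
    by (intro open_Collect_less) (auto intro: continuous_intros)
  then have "V \<inter> {y. S.fl j (finv T (hat (Some y))) < 0} \<in> sets borel"
    using borel_closed[OF closed_RR_plus] by (intro sets.Int) auto
  moreover have "Int_sphere A = V \<inter> {y. S.fl j (finv T (hat (Some y))) < 0}"
    unfolding g(2) Int_act_base[OF T(1,3) TL] by auto
  ultimately show ?thesis by simp
qed

lemma packing_translation:
  assumes "A \<in> packing n R u \<tau>" "w \<in> \<Lambda>" shows "act (translation w) A \<in> packing n R u \<tau>"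
proof -
  obtain g j where g: "g \<in> G" "A = act g (base j)" using assms packing_iff by blast
  have "translation w \<in> G" unfolding Gamma_def using assms(2) by (intro generate.incl) auto
  then have "translation w \<otimes>\<^bsub>BijGroup UNIV\<^esub> g \<in> G" using g(1) unfolding Gamma_def by (rule generate.eng)
  moreover have "translation w \<otimes>\<^bsub>BijGroup UNIV\<^esub> g = translation w \<circ> g"
    using Gamma_represented[OF g(1)] bij_translation by (simp add: BijGroup_def Bij_UNIV compose_def fun_eq_iff)
  ultimately show ?thesis unfolding packing_iff g(2) act_comp[symmetric] by auto
qed

text \<open>Translations along the plane lie in both side groups and fix both bounding planes, so
  the translation orbit of any other sphere contains neither of them.\<close>

lemma base_translation:
  assumes "A \<in> base_planes n u \<tau>" "w \<in> \<Lambda>" shows "act (translation w) A = A"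
proof -
  obtain j where j: "A = base j" using assms(1) unfolding base_planes_eq by blast
  have side: "l_trans w \<in> S.side_grp j" using assms(2) by (intro S.l_trans_side_grp) (auto simp: \<Lambda>_iff)
  then have TL: "l_trans w \<in> S.LG" by (simp add: S.side_grp_def)
  have "S.fl j (finv (l_trans w) (hat x)) = S.fl j (hat x)" if "x \<in> ext_space n" for x
    using fl_finv[OF TL] side that unfolding ext_space_iff S.side_grp_def by blast
  then show ?thesis
    unfolding j act_base[OF bij_translation represents_translation TL] unfolding base_def
    by (rule sign_sets_cong)
qed

section \<open>Translation orbits, covolume and density\<close>

definition orbit :: "osphere \<Rightarrow> osphere set" where
  "orbit A = {act (translation w) A | w. w \<in> \<Lambda>}"

lemma \<Lambda>_group: "v \<in> \<Lambda> \<Longrightarrow> w \<in> \<Lambda> \<Longrightarrow> v + w \<in> \<Lambda>" "w \<in> \<Lambda> \<Longrightarrow> - w \<in> \<Lambda>" "0 \<in> \<Lambda>"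
  using M_add M_uminus M_0 by (auto simp: \<Lambda>_iff inner_add_right)

lemma orbit_refl: "A \<in> orbit A"
  unfolding orbit_def using act_translation_0[of A] \<Lambda>_group(3) by force

lemma orbit_eq:
  assumes "w \<in> \<Lambda>" shows "orbit (act (translation w) A) = orbit A"
proof -
  have sub: "orbit (act (translation v) B) \<subseteq> orbit B" if "v \<in> \<Lambda>" for v B
    unfolding orbit_def using \<Lambda>_group(1)[OF that] by (auto simp: act_comp[symmetric] translation_comp)
  have "A = act (translation (- w)) (act (translation w) A)"
    by (simp add: act_comp[symmetric] translation_comp act_translation_0)
  then show ?thesis using sub[OF assms] sub[OF \<Lambda>_group(2)[OF assms]] by (metis subset_antisym)
qed

text \<open>One translate from each orbit is placed inside the two balls. Translates from different
  orbits are different spheres, hence have disjoint interiors, and the total is at most the volume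
  of the two balls, 256 each.\<close>

lemma orbit_volume_le:
  "(\<Sum>\<^sub>\<infinity>Q\<in>packing_orbits n R u \<tau>. emeasure (vol n) (Int_sphere (SOME A. A \<in> Q))) \<le> 512"
proof -
  let ?O = "packing_orbits n R u \<tau>" and ?P = "packing n R u \<tau> - base_planes n u \<tau>"
  define r where "r Q = (SOME A. A \<in> Q)" for Q :: "osphere set"
  have r: "r Q \<in> ?P \<and> orbit (r Q) = Q" if QO: "Q \<in> ?O" for Q
  proof -
    obtain A where A: "A \<in> ?P" "Q = orbit A" using QO unfolding packing_orbits_def orbit_def by blast
    have "r Q \<in> Q" unfolding r_def A(2) by (rule someI) (rule orbit_refl)
    then obtain w where w: "w \<in> \<Lambda>" "r Q = act (translation w) A" unfolding A(2) orbit_def by blast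
    have "r Q \<notin> base_planes n u \<tau>"
    proof
      assume b: "r Q \<in> base_planes n u \<tau>"
      have "A = act (translation (- w)) (r Q)"
        unfolding w(2) by (simp add: act_comp[symmetric] translation_comp act_translation_0)
      then have "A = r Q" using base_translation[OF b \<Lambda>_group(2)[OF w(1)]] by simp
      then show False using A b by simp
    qed
    then show ?thesis using packing_translation w A orbit_eq by simp
  qed
  have "\<exists>w. w \<in> \<Lambda> \<and> Int_sphere (act (translation w) (r Q)) \<subseteq> ball 0 2 \<union> ball \<tau> 2" if "Q \<in> ?O" for Q
    using r[OF that] packing_bounded by blast
  then obtain w where w: "\<And>Q. Q \<in> ?O \<Longrightarrow> w Q \<in> \<Lambda>"
    "\<And>Q. Q \<in> ?O \<Longrightarrow> Int_sphere (act (translation (w Q)) (r Q)) \<subseteq> ball 0 2 \<union> ball \<tau> 2" by metis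
  define A where "A Q = Int_sphere (act (translation (w Q)) (r Q))" for Q
  have "emeasure (vol n) (Int_sphere (r Q)) = emeasure (vol n) (A Q)" if Q: "Q \<in> ?O" for Q
  proof -
    have "- w Q \<in> V" using \<Lambda>_group(2)[OF w(1)[OF Q]] L_V by (auto simp: \<Lambda>_iff)
    moreover have "Int_sphere (r Q) \<in> sets borel" using r[OF Q] packing_Int_measurable by blast
    ultimately show ?thesis unfolding A_def Int_sphere_translation by (rule vol_translate[symmetric])
  qed
  then have "(\<Sum>\<^sub>\<infinity>Q\<in>?O. emeasure (vol n) (Int_sphere (r Q))) = (\<Sum>\<^sub>\<infinity>Q\<in>?O. emeasure (vol n) (A Q))"
    by (intro infsum_cong) auto
  also have "\<dots> \<le> emeasure (vol n) (ball 0 2 \<union> ball \<tau> 2)"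
  proof (rule infsum_emeasure_disjoint_le)
    show "disjoint_family_on A ?O"
      unfolding disjoint_family_on_def
    proof (intro ballI impI, rule ccontr)
      fix Q Q' assume Q: "Q \<in> ?O" "Q' \<in> ?O" "Q \<noteq> Q'" "A Q \<inter> A Q' \<noteq> {}"
      then obtain y where "y \<in> A Q" "y \<in> A Q'" by blast
      then have "act (translation (w Q)) (r Q) = act (translation (w Q')) (r Q')"
        unfolding A_def using r[OF Q(1)] r[OF Q(2)] w(1)[OF Q(1)] w(1)[OF Q(2)]
        by (intro packing_disjoint packing_translation) auto
      then show False using orbit_eq[OF w(1)[OF Q(1)]] orbit_eq[OF w(1)[OF Q(2)]] r[OF Q(1)] r[OF Q(2)] Q(3) by metis
    qed
    show "A Q \<in> sets (vol n)" if "Q \<in> ?O" for Q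
      using r[OF that] w(1)[OF that] packing_translation packing_Int_measurable by (auto simp: A_def)
    show "A Q \<subseteq> ball 0 2 \<union> ball \<tau> 2" if "Q \<in> ?O" for Q using w(2)[OF that] by (simp add: A_def)
  qed auto
  also have "\<dots> \<le> emeasure (vol n) (ball 0 2) + emeasure (vol n) (ball \<tau> 2)"
    by (rule emeasure_subadditive) auto
  also have "\<dots> \<le> 256 + 256"
    using \<tau>_L L_V subspace_0[OF subspace_RR_plus] by (intro add_mono vol_ball_le) auto
  finally show ?thesis by (simp add: r_def)
qed

text \<open>In the plane, the covering property scaled by \<epsilon> gives points of
  \<open>span L\<close> within \<epsilon> of any vector, and a subspace is closed. The transversal
  direction is supplied by \<tau>.\<close>

lemma V_span_L: "V \<subseteq> span L"
proof
  fix x assume x: "x \<in> V"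
  define y where "y = x - (e \<bullet> x / h) *\<^sub>R \<tau>"
  have yV: "y \<in> V" unfolding y_def using x \<tau>_L L_V
    by (intro subspace_diff[OF subspace_RR_plus] subspace_scale[OF subspace_RR_plus]) auto
  have ey: "e \<bullet> y = 0" using h_pos by (simp add: y_def inner_diff_right flip: h_def)
  have "y \<in> closure (span L)"
    unfolding closure_approachable
  proof (intro allI impI)
    fix \<epsilon> :: real assume \<epsilon>: "0 < \<epsilon>"
    have "(1 / \<epsilon>) *\<^sub>R y \<in> V" "e \<bullet> ((1 / \<epsilon>) *\<^sub>R y) = 0" using yV ey subspace_scale[OF subspace_RR_plus] by auto
    then obtain p where p: "p \<in> L" "norm ((1 / \<epsilon>) *\<^sub>R y - p) < 1" using near_plane_point by blast
    have "norm (y - \<epsilon> *\<^sub>R p) = norm (\<epsilon> *\<^sub>R ((1 / \<epsilon>) *\<^sub>R y - p))" using \<epsilon> by (simp add: scaleR_diff_right)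
    also have "\<dots> < \<epsilon>" using p(2) \<epsilon> by simp
    finally have "dist (\<epsilon> *\<^sub>R p) y < \<epsilon>" by (simp add: dist_norm norm_minus_commute)
    then show "\<exists>z\<in>span L. dist z y < \<epsilon>" using p(1) by (intro bexI[of _ "\<epsilon> *\<^sub>R p"] span_scale span_base)
  qed
  then have "y \<in> span L" by (simp add: closed_subspace)
  moreover have "x = y + (e \<bullet> x / h) *\<^sub>R \<tau>" by (simp add: y_def)
  ultimately show "x \<in> span L" using \<tau>_L by (metis span_add span_scale span_base)
qed

lemma covol_ge: "ennreal ((h - 1) / 256) \<le> covol n L"
proof -
  define B where "B = (SOME B. zbasis B L)"
  have B: "zbasis B L" unfolding B_def by (rule someI_ex) (rule exists_zbasis)
  have fin: "finite B" using B by (simp add: zbasis_def)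
  have ind: "independent B" by (rule zbasis_independent[OF B])
  have BL: "B \<subseteq> L" by (rule zbasis_subset[OF B])
  have "span L \<subseteq> span B" using zbasis_span[OF B] by (simp add: span_minimal)
  moreover have "span B \<subseteq> V" using BL L_V by (intro span_minimal subspace_RR_plus) auto
  ultimately have spanB: "span B = V" using V_span_L by blast
  \<comment> \<open>The number of unit balls stacked over one period; rounding down costs at most 1,
    whence the \<open>h - 1\<close>.\<close>
  define N where "N = nat \<lfloor>h\<rfloor>"
  have N: "h - 1 \<le> real N" "real N \<le> h" using h_pos unfolding N_def by linarith+
  have "ennreal ((h - 1) / 256) \<le> ennreal (real N / 256)" using N by (intro ennreal_leI) simp
  also have "\<dots> \<le> emeasure (vol n) {\<Sum>b\<in>B. t b *\<^sub>R b | t. \<forall>b\<in>B. 0 \<le> t b \<and> t b < 1}"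
  proof (rule emeasure_parallelepiped_ge_slab[OF fin ind spanB e_V norm_e N(2)])
    fix c :: "quat \<Rightarrow> int" assume c: "\<exists>b\<in>B. c b \<noteq> 0"
    define x where "x = (\<Sum>b\<in>B. of_int (c b) *\<^sub>R b)"
    have xL: "x \<in> L" unfolding x_def using BL by (intro M_sum) auto
    have "x \<noteq> 0"
    proof
      assume "x = 0"
      then have "(\<Sum>b\<in>B. of_int (c b) * b) = 0" by (simp add: x_def of_int_mult_quat)
      then have "\<forall>b\<in>B. c b = 0" using B unfolding zbasis_def by blast
      then show False using c by blast
    qed
    then have "1 \<le> norm x" using xL M_norm by blast
    obtain k :: int where k: "e \<bullet> x = of_int k * h" using lattice_height[OF xL] by blast
    have "e \<bullet> x = 0 \<or> h \<le> \<bar>e \<bullet> x\<bar>"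
    proof (cases "k = 0")
      case False
      then have "1 \<le> \<bar>k\<bar>" by linarith
      then have "1 * h \<le> \<bar>of_int k\<bar> * h" using h_pos by (intro mult_right_mono) (simp_all flip: of_int_abs)
      then show ?thesis using k h_pos by (simp add: abs_mult)
    qed (simp add: k)
    then show "let x = (\<Sum>b\<in>B. of_int (c b) *\<^sub>R b) in e \<bullet> x = 0 \<and> 1 \<le> norm x \<or> h \<le> \<bar>e \<bullet> x\<bar>"
      using \<open>1 \<le> norm x\<close> unfolding Let_def x_def by blast
  qed
  also have "\<dots> = covol n L" by (simp add: covol_def B_def Let_def)
  finally show ?thesis .
qed

text \<open>131072 = 512 * 256: the volume of the two balls divided by a covolume of at least (h -
  1) / 256.\<close>

theorem packing_density_le: "packing_density n R u \<tau> \<le> ennreal (131072 / (h - 1))"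
proof -
  have h1: "0 < h - 1" using h_gt_10 by simp
  have c: "ennreal ((h - 1) / 256) \<le> covol n L" by (rule covol_ge)
  have "1 = ennreal ((h - 1) / 256) * ennreal (256 / (h - 1))"
    using h1 by (simp add: ennreal_mult[symmetric])
  also have "\<dots> \<le> covol n L * ennreal (256 / (h - 1))" by (rule mult_right_mono[OF c]) simp
  finally have "1 \<le> covol n L * ennreal (256 / (h - 1))" .
  moreover have "0 < covol n L" using h1 by (intro less_le_trans[OF _ c]) simp
  ultimately have "1 / covol n L \<le> ennreal (256 / (h - 1))"
    by (intro divide_le_posI_ennreal) (simp_all add: mult.commute)
  then have "packing_density n R u \<tau> \<le> ennreal (256 / (h - 1)) * 512"
    unfolding packing_density_def using orbit_volume_le by (intro mult_mono) auto
  also have "\<dots> = ennreal (131072 / (h - 1))"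
    using h1 ennreal_mult[of "256 / (h - 1)" 512] by simp
  finally show ?thesis .
qed

end

section \<open>The elementary subgroup\<close>

text \<open>For y \<noteq> 0 this is \<open>nrm y\<close> times \<open>hat\<close> of the point x
  y^-1, and for y = 0 a multiple of \<open>e_inf\<close>. The coordinates are the entries of the
  column times its conjugate transpose, so that matrices act linearly on them.\<close>

definition column_vec :: "quat \<Rightarrow> quat \<Rightarrow> quat lspace" where
  "column_vec x y = (nrm y, x * qcnj y, nrm x)"

text \<open>Tested on all columns, so that products and inverses of matrices pass to the linear maps
  without reference to points.\<close>

definition acts_as :: "quat^2^2 \<Rightarrow> (quat lspace \<Rightarrow> quat lspace) \<Rightarrow> bool" where
  "acts_as M T \<longleftrightarrow> (\<forall>x y. column_vec (M $ 1 $ 1 * x + M $ 1 $ 2 * y) (M $ 2 $ 1 * x + M $ 2 $ 2 * y) = T (column_vec x y))"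

lemma acts_as_mult: "acts_as M S \<Longrightarrow> acts_as N T \<Longrightarrow> acts_as (M ** N) (S \<circ> T)"
  unfolding acts_as_def mat2_mult_nth o_apply
proof (intro allI)
  fix x y
  assume M: "\<forall>x y. column_vec (M $ 1 $ 1 * x + M $ 1 $ 2 * y) (M $ 2 $ 1 * x + M $ 2 $ 2 * y) = S (column_vec x y)"
    and N: "\<forall>x y. column_vec (N $ 1 $ 1 * x + N $ 1 $ 2 * y) (N $ 2 $ 1 * x + N $ 2 $ 2 * y) = T (column_vec x y)"
  show "column_vec ((M $ 1 $ 1 * N $ 1 $ 1 + M $ 1 $ 2 * N $ 2 $ 1) * x + (M $ 1 $ 1 * N $ 1 $ 2 + M $ 1 $ 2 * N $ 2 $ 2) * y)
      ((M $ 2 $ 1 * N $ 1 $ 1 + M $ 2 $ 2 * N $ 2 $ 1) * x + (M $ 2 $ 1 * N $ 1 $ 2 + M $ 2 $ 2 * N $ 2 $ 2) * y) = S (T (column_vec x y))"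
    using M[rule_format, of "N $ 1 $ 1 * x + N $ 1 $ 2 * y" "N $ 2 $ 1 * x + N $ 2 $ 2 * y"] N[rule_format, of x y]
    by (simp add: distrib_left distrib_right mult.assoc add_ac)
qed

lemma acts_as_one: "acts_as (mat 1) id"
  by (simp add: acts_as_def mat2_one)

lemma acts_as_inverse:
  assumes "acts_as M T" "M ** N = mat 1" "bij T" shows "acts_as N (finv T)"
  unfolding acts_as_def
proof (intro allI)
  fix x y
  let ?x = "N $ 1 $ 1 * x + N $ 1 $ 2 * y" and ?y = "N $ 2 $ 1 * x + N $ 2 $ 2 * y"
  have "M $ 1 $ 1 * ?x + M $ 1 $ 2 * ?y = (M ** N) $ 1 $ 1 * x + (M ** N) $ 1 $ 2 * y"
    "M $ 2 $ 1 * ?x + M $ 2 $ 2 * ?y = (M ** N) $ 2 $ 1 * x + (M ** N) $ 2 $ 2 * y"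
    by (simp_all add: mat2_mult_nth distrib_left distrib_right mult.assoc add_ac)
  then have "column_vec x y = T (column_vec ?x ?y)"
    using assms(1)[unfolded acts_as_def, rule_format, of ?x ?y] by (simp add: assms(2) mat2_one)
  then show "column_vec ?x ?y = finv T (column_vec x y)" using assms(3) by (metis bij_inv_eq_iff)
qed

lemma inner_mult_right: "(x * z) \<bullet> (y * z) = nrm z * (x \<bullet> y)"
  by (simp add: inner_quat_def nrm_explicit quat_ops algebra_simps)

lemma inner_mult_qcnj: "(x * qcnj y) \<bullet> z = x \<bullet> (z * y)"
  by (simp add: inner_quat_def qcnj_def quat_ops algebra_simps)

text \<open>For diagonal entries of norm 1 the inverse of \<delta> is its conjugate, so z \<mapsto>
  (\<alpha> z + \<beta>) \<delta>^-1 is a rotation followed by a translation.\<close>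

lemma acts_as_upper:
  assumes "nrm \<alpha> = 1" "nrm \<delta> = 1"
  shows "acts_as (mat2 \<alpha> \<beta> 0 \<delta>) (l_trans (\<beta> * qcnj \<delta>) \<circ> l_rot (\<lambda>v. \<alpha> * v * qcnj \<delta>))"
  unfolding acts_as_def mat2_nth o_apply
proof (intro allI)
  fix x y
  have yy: "y * qcnj y = of_real (nrm y)" by (rule qcnj_mult_self)
  have "(\<alpha> * x + \<beta> * y) * qcnj (\<delta> * y) = \<alpha> * (x * qcnj y) * qcnj \<delta> + \<beta> * (y * qcnj y) * qcnj \<delta>"
    by (simp add: qcnj_simps distrib_right mult.assoc)
  also have "\<beta> * (y * qcnj y) * qcnj \<delta> = nrm y *\<^sub>R (\<beta> * qcnj \<delta>)" unfolding yy by (simp add: of_real_def)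
  finally have v: "(\<alpha> * x + \<beta> * y) * qcnj (\<delta> * y) = \<alpha> * (x * qcnj y) * qcnj \<delta> + nrm y *\<^sub>R (\<beta> * qcnj \<delta>)" .
  have "(\<alpha> * (x * qcnj y) * qcnj \<delta>) \<bullet> (\<beta> * qcnj \<delta>) = (\<alpha> * (x * qcnj y)) \<bullet> \<beta>"
    by (simp add: inner_mult_right nrm_qcnj assms)
  also have "\<dots> = (\<alpha> * x) \<bullet> (\<beta> * y)" by (simp add: inner_mult_qcnj flip: mult.assoc)
  finally have i: "(\<alpha> * (x * qcnj y) * qcnj \<delta>) \<bullet> (\<beta> * qcnj \<delta>) = (\<alpha> * x) \<bullet> (\<beta> * y)" .
  have "nrm (\<alpha> * x + \<beta> * y) = nrm (\<alpha> * x) + 2 * ((\<alpha> * x) \<bullet> (\<beta> * y)) + nrm (\<beta> * y)"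
    unfolding nrm_eq_inner by (simp add: inner_add_left inner_add_right inner_commute)
  then have N: "nrm (\<alpha> * x + \<beta> * y) = nrm x + 2 * ((\<alpha> * x) \<bullet> (\<beta> * y)) + nrm y * nrm \<beta>"
    using assms by (simp add: nrm_mult)
  have "(\<beta> * qcnj \<delta>) \<bullet> (\<beta> * qcnj \<delta>) = nrm \<beta>"
    unfolding nrm_eq_inner[symmetric] by (simp add: nrm_mult nrm_qcnj assms)
  then show "column_vec (\<alpha> * x + \<beta> * y) (0 * x + \<delta> * y) = l_trans (\<beta> * qcnj \<delta>) (l_rot (\<lambda>v. \<alpha> * v * qcnj \<delta>) (column_vec x y))"
    using v i N assms by (simp add: column_vec_def l_trans_def l_rot_def nrm_mult)
qed

lemma norm_eq_sqrt_nrm: "norm x = sqrt (nrm x)"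
  by (simp add: nrm_eq_norm)

lemma nrm_uminus: "nrm (- x) = nrm x"
  by (simp add: nrm_eq_inner)

text \<open>The map z \<mapsto> - z^-1 is the reflection z \<mapsto> \<open>- qcnj z\<close>
  followed by inversion in the unit sphere.\<close>

lemma acts_as_swap: "acts_as (mat2 0 (- 1) 1 0) (l_invert \<circ> l_rot (\<lambda>v. - qcnj v))"
  by (simp add: acts_as_def column_vec_def l_invert_def l_rot_def qcnj_simps nrm_uminus)

lemma acts_as_uminus: "acts_as (- M) T \<longleftrightarrow> acts_as M T"
proof -
  have "column_vec (- x) (- y) = column_vec x y" for x y
    by (simp add: column_vec_def qcnj_simps nrm_eq_inner)
  then have "column_vec (- p * x - q * y) (- r * x - s * y) = column_vec (p * x + q * y) (r * x + s * y)"
    for p q r s x y by (metis minus_add_distrib mult_minus_left diff_conv_add_uminus)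
  then show ?thesis by (simp add: acts_as_def)
qed

lemma Ints_mult_eq_1:
  fixes a b :: real
  assumes "a \<in> \<int>" "b \<in> \<int>" "0 \<le> a" "a * b = 1" shows "a = 1 \<and> b = 1"
proof -
  obtain k l :: int where kl: "a = of_int k" "b = of_int l" using assms by (auto elim!: Ints_cases)
  have "of_int (k * l) = (1::real)" using assms kl by simp
  then have "k * l = 1" by (simp only: of_int_eq_1_iff)
  moreover have "0 \<le> k" using assms(3) kl by simp
  ultimately have "k = 1 \<and> l = 1" using zmult_eq_1_iff by force
  then show ?thesis using kl by simp
qed

lemma nrm_nonneg: "0 \<le> nrm x" by (simp add: nrm_eq_inner)

context covering_ring
begin

text \<open>The norms of the diagonal entries are nonnegative integers with product 1. The last
  claim collects what makes the rotation and translation parts of triangular matrices compatible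
  with \<open>ddag\<close> in dimension 4.\<close>

lemma triangular_units:
  assumes M: "mat2 \<alpha> \<beta> \<gamma> \<delta> \<in> GZ_set n R" and tri: "\<beta> = 0 \<or> \<gamma> = 0"
  shows "\<alpha> \<in> R" "\<beta> \<in> R" "\<gamma> \<in> R" "\<delta> \<in> R" "nrm \<alpha> = 1" "nrm \<delta> = 1"
    "n = 4 \<Longrightarrow> qcnj \<delta> = ddag \<alpha> \<and> ddag (\<beta> * ddag \<alpha>) = \<beta> * ddag \<alpha> \<and> ddag (\<gamma> * ddag \<delta>) = \<gamma> * ddag \<delta>"
proof -
  show R: "\<alpha> \<in> R" "\<beta> \<in> R" "\<gamma> \<in> R" "\<delta> \<in> R"
    using M by (auto simp: GZ_set_def mat_over_iff split: if_splits)
  have z: "\<beta> * x * \<gamma> = 0" "\<gamma> * x * \<beta> = 0" "\<beta> * \<gamma> = 0" for x using tri by auto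
  have four: "\<alpha> * ddag \<delta> - \<beta> * ddag \<gamma> = 1 \<and> \<beta> * ddag \<alpha> = \<alpha> * ddag \<beta> \<and> \<gamma> * ddag \<delta> = \<delta> * ddag \<gamma>" if n: "n = 4"
  proof -
    have "mat2 \<alpha> \<beta> \<gamma> \<delta> ** ddag_hat (mat2 \<alpha> \<beta> \<gamma> \<delta>) = mat2 1 0 0 1"
      using M unfolding GZ4_iff[OF n] mat2_one by blast
    then show ?thesis unfolding ddag_hat_mat2 mat2_mult by (simp add: mat2_eq_iff)
  qed
  have ad4: "\<alpha> * ddag \<delta> = 1" if n: "n = 4" using four[OF n] tri by (auto simp: ddag_simps)
  have "nrm \<alpha> * nrm \<delta> = 1"
  proof -
    consider "n = 3" | "n = 4" | "n = 5" using n_cases by blast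
    then show ?thesis
    proof cases
      case 1
      then have "\<alpha> * \<delta> = 1" using M z unfolding GZ3_iff[OF 1] by simp
      then show ?thesis using nrm_mult[of \<alpha> \<delta>] by (simp add: nrm_one)
    next
      case 2
      then show ?thesis using ad4[OF 2] nrm_mult[of \<alpha> "ddag \<delta>"] by (simp add: nrm_one nrm_ddag)
    next
      case 3
      have "nrm 0 = 0" "qcnj 0 = 0" by (simp_all add: nrm_eq_0 qcnj_simps)
      then show ?thesis using M tri unfolding GZ5_iff[OF 3] study_det_def by auto
    qed
  qed
  then show nrm: "nrm \<alpha> = 1" "nrm \<delta> = 1"
    using Ints_mult_eq_1[OF R_nrm[OF R(1)] R_nrm[OF R(4)] nrm_nonneg] by blast+
  assume n: "n = 4"
  have "qcnj \<alpha> * (\<alpha> * ddag \<delta>) = ddag \<delta>" by (simp add: qcnj_mult_self nrm flip: mult.assoc)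
  then have "ddag \<delta> = qcnj \<alpha>" using ad4[OF n] by simp
  then have "ddag (ddag \<delta>) = ddag (qcnj \<alpha>)" by simp
  then have "qcnj \<delta> = ddag \<alpha>" by (simp add: ddag_simps qcnj_simps)
  then show "qcnj \<delta> = ddag \<alpha> \<and> ddag (\<beta> * ddag \<alpha>) = \<beta> * ddag \<alpha> \<and> ddag (\<gamma> * ddag \<delta>) = \<gamma> * ddag \<delta>"
    using four[OF n] by (simp add: ddag_simps)
qed

lemma V_iff_ddag: "n = 4 \<Longrightarrow> x \<in> V \<longleftrightarrow> ddag x = x"
  by (auto simp: RR_plus_iff ddag_def quat_eq_iff)

text \<open>In dimension 4 the map is v \<mapsto> \<alpha> v \<open>ddag \<alpha>\<close>, which
  sends elements fixed by \<open>ddag\<close> to such elements.\<close>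

lemma rotation_preserves:
  assumes \<alpha>: "\<alpha> \<in> R" "\<delta> \<in> R" "n = 4 \<Longrightarrow> qcnj \<delta> = ddag \<alpha>"
  shows "x \<in> V \<Longrightarrow> \<alpha> * x * qcnj \<delta> \<in> V" "x \<in> L \<Longrightarrow> \<alpha> * x * qcnj \<delta> \<in> L"
proof -
  show V: "\<alpha> * x * qcnj \<delta> \<in> V" if x: "x \<in> V" for x
  proof -
    consider "n = 3" | "n = 4" | "n = 5" using n_cases by blast
    then show ?thesis
    proof cases
      case 1
      have "R \<subseteq> V" using RZ 1 by (cases rule: is_RZ_cases) auto
      then show ?thesis using x \<alpha>(1,2) R_qcnj[OF \<alpha>(2)] RR_plus_3_mult 1 by blast
    next
      case 2
      then show ?thesis using x \<alpha>(3) unfolding V_iff_ddag[OF 2] by (simp add: ddag_simps mult.assoc)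
    next
      case 3
      then show ?thesis by (simp add: RR_plus_iff)
    qed
  qed
  show "\<alpha> * x * qcnj \<delta> \<in> L" if "x \<in> L"
    using that V[of x] \<alpha>(1,2) R_mult R_qcnj unfolding L_eq by auto
qed

end

context wide_shift
begin

abbreviation "refl_gen \<equiv> map_gen (S.refl_grp True \<union> S.refl_grp False)"

lemma upper_refl_gen:
  assumes u: "\<alpha> \<in> R" "\<beta> \<in> R" "\<delta> \<in> R" "nrm \<alpha> = 1" "nrm \<delta> = 1"
    and 4: "n = 4 \<Longrightarrow> qcnj \<delta> = ddag \<alpha> \<and> ddag (\<beta> * ddag \<alpha>) = \<beta> * ddag \<alpha>"
  shows "l_trans (\<beta> * qcnj \<delta>) \<circ> l_rot (\<lambda>v. \<alpha> * v * qcnj \<delta>) \<in> refl_gen"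
proof -
  have bL: "\<beta> * qcnj \<delta> \<in> L"
  proof -
    have "\<beta> * qcnj \<delta> \<in> V"
    proof -
      consider "n = 3" | "n = 4" | "n = 5" using n_cases by blast
      then show ?thesis
      proof cases
        case 1
        have "R \<subseteq> V" using RZ 1 by (cases rule: is_RZ_cases) auto
        then show ?thesis using R_mult[OF u(2) R_qcnj[OF u(3)]] by blast
      next
        case 2
        then show ?thesis using 4 unfolding V_iff_ddag[OF 2] by simp
      qed (simp add: RR_plus_iff)
    qed
    then show ?thesis using R_mult[OF u(2) R_qcnj[OF u(3)]] by (simp add: L_eq)
  qed
  have inv: "n = 4 \<Longrightarrow> qcnj (qcnj \<delta>) = ddag (qcnj \<alpha>)" using 4 by (simp add: ddag_simps)
  have "l_rot (\<lambda>v. \<alpha> * v * qcnj \<delta>) \<in> S.LG"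
  proof (rule S.l_rot_LG[where g = "\<lambda>v. qcnj \<alpha> * v * qcnj (qcnj \<delta>)"])
    show "linear (\<lambda>v. \<alpha> * v * qcnj \<delta>)"
      by (rule linearI) (simp_all add: distrib_left distrib_right)
    show "norm (\<alpha> * x * qcnj \<delta>) = norm x" for x
      by (simp add: norm_quat_mult norm_eq_sqrt_nrm nrm_qcnj nrm_mult u)
    show "\<alpha> * (qcnj \<alpha> * x * qcnj (qcnj \<delta>)) * qcnj \<delta> = x" for x
    proof -
      have "\<alpha> * (qcnj \<alpha> * x * qcnj (qcnj \<delta>)) * qcnj \<delta> = (\<alpha> * qcnj \<alpha>) * x * (\<delta> * qcnj \<delta>)"
        by (simp add: qcnj_simps mult.assoc)
      then show ?thesis by (simp add: qcnj_mult_self u)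
    qed
    show "qcnj \<alpha> * (\<alpha> * x * qcnj \<delta>) * qcnj (qcnj \<delta>) = x" for x
    proof -
      have "qcnj \<alpha> * (\<alpha> * x * qcnj \<delta>) * qcnj (qcnj \<delta>) = (qcnj \<alpha> * \<alpha>) * x * (qcnj \<delta> * \<delta>)"
        by (simp add: qcnj_simps mult.assoc)
      then show ?thesis by (simp add: qcnj_mult_self u)
    qed
  qed (use rotation_preserves[OF u(1,3)] rotation_preserves[OF R_qcnj[OF u(1)] R_qcnj[OF u(3)] inv] 4 in blast)+
  then have "l_trans (\<beta> * qcnj \<delta>) \<circ> l_rot (\<lambda>v. \<alpha> * v * qcnj \<delta>) \<in> S.LG"
    using S.LG_comp S.l_trans_LG[OF bL] by blast
  moreover have "(l_trans (\<beta> * qcnj \<delta>) \<circ> l_rot (\<lambda>v. \<alpha> * v * qcnj \<delta>)) e_inf = e_inf"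
    by (simp add: l_trans_def l_rot_def)
  ultimately have "l_trans (\<beta> * qcnj \<delta>) \<circ> l_rot (\<lambda>v. \<alpha> * v * qcnj \<delta>) \<in> S.refl_grp False"
    unfolding S.refl_grp_def by simp
  then show ?thesis by (intro map_gen_incl) blast
qed

text \<open>Here it matters that \<open>u\<close> has real part 0: \<open>- qcnj\<close> changes
  only the real coordinate, so it keeps the height above the plane, and so does the inversion
  centred at 0.\<close>

lemma swap_refl_gen: "l_invert \<circ> l_rot (\<lambda>v. - qcnj v) \<in> refl_gen"
proof -
  have "l_rot (\<lambda>v. - qcnj v) \<in> S.LG"
  proof (rule S.l_rot_LG[where g = "\<lambda>v. - qcnj v"])
    show "linear (\<lambda>v. - qcnj v)" by (rule linearI) (simp_all add: qcnj_simps)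
    show "norm (- qcnj x) = norm x" for x
      by (simp add: norm_eq_sqrt_nrm nrm_qcnj nrm_uminus del: norm_minus_cancel)
    show "- qcnj x \<in> L" if "x \<in> L" for x
      using that R_uminus R_qcnj qcnj_V subspace_neg[OF subspace_RR_plus] by (simp add: L_eq)
    then show "- qcnj x \<in> L" if "x \<in> L" for x using that .
    show "- qcnj x \<in> V" if "x \<in> V" for x
      using that qcnj_V subspace_neg[OF subspace_RR_plus] by simp
    then show "- qcnj x \<in> V" if "x \<in> V" for x using that .
  qed (simp_all add: qcnj_simps)
  then have "l_invert \<circ> l_rot (\<lambda>v. - qcnj v) \<in> S.LG" using S.LG_comp S.l_invert_LG by blast
  moreover have "e \<bullet> lv ((l_invert \<circ> l_rot (\<lambda>v. - qcnj v)) x) = 1 * (e \<bullet> lv x)" for x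
    using e_Re by (simp add: l_invert_def l_rot_def inner_quat_def qcnj_def quat_ops)
  ultimately have "l_invert \<circ> l_rot (\<lambda>v. - qcnj v) \<in> S.refl_grp True"
    unfolding S.refl_grp_def if_True by (intro CollectI conjI exI[of _ 1]) (assumption, simp_all)
  then show ?thesis by (intro map_gen_incl) blast
qed

lemma triangular_acts:
  assumes M: "M \<in> GZ_set n R" "M $ 2 $ 1 = 0 \<or> M $ 1 $ 2 = 0"
  shows "\<exists>T\<in>refl_gen. acts_as M T"
proof -
  obtain \<alpha> \<beta> \<gamma> \<delta> where eq: "M = mat2 \<alpha> \<beta> \<gamma> \<delta>" using mat2_expand by metis
  have tri: "\<beta> = 0 \<or> \<gamma> = 0" using M(2) by (auto simp: eq)
  note units = triangular_units[OF M(1)[unfolded eq] tri]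
  show ?thesis
  proof (cases "\<gamma> = 0")
    case True
    have "acts_as M (l_trans (\<beta> * qcnj \<delta>) \<circ> l_rot (\<lambda>v. \<alpha> * v * qcnj \<delta>))"
      unfolding eq True by (rule acts_as_upper[OF units(5,6)])
    then show ?thesis using upper_refl_gen[OF units(1,2,4,5,6)] units(7) by blast
  next
    case False
    then have b: "\<beta> = 0" using tri by blast
    define W where "W = (mat2 0 (- 1) 1 0 :: quat^2^2)"
    have cond: "qcnj \<alpha> = ddag \<delta> \<and> ddag (- \<gamma> * ddag \<delta>) = - \<gamma> * ddag \<delta>" if "n = 4"
    proof -
      have "ddag (qcnj \<delta>) = \<alpha>" using units(7)[OF that] by (simp add: ddag_simps)
      then have "qcnj \<alpha> = ddag \<delta>" by (metis ddag_simps(8) qcnj_simps(2))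
      then show ?thesis using units(7)[OF that] by (simp add: ddag_simps)
    qed
    \<comment> \<open>Conjugation by \<open>W\<close> turns upper triangular matrices into lower
      triangular ones. The square of \<open>W\<close> is -1, whence the sign, which does not affect
      the action.\<close>
    have "acts_as (W ** (mat2 \<delta> (- \<gamma>) 0 \<alpha> ** W)) ((l_invert \<circ> l_rot (\<lambda>v. - qcnj v)) \<circ>
        ((l_trans (- \<gamma> * qcnj \<alpha>) \<circ> l_rot (\<lambda>v. \<delta> * v * qcnj \<alpha>)) \<circ> (l_invert \<circ> l_rot (\<lambda>v. - qcnj v))))"
      unfolding W_def by (intro acts_as_mult acts_as_swap acts_as_upper units)
    moreover have "W ** (mat2 \<delta> (- \<gamma>) 0 \<alpha> ** W) = - M"
      unfolding W_def eq b mat2_mult by (simp add: mat2_eq_iff)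
    ultimately have "acts_as M ((l_invert \<circ> l_rot (\<lambda>v. - qcnj v)) \<circ>
        ((l_trans (- \<gamma> * qcnj \<alpha>) \<circ> l_rot (\<lambda>v. \<delta> * v * qcnj \<alpha>)) \<circ> (l_invert \<circ> l_rot (\<lambda>v. - qcnj v))))"
      by (simp only: acts_as_uminus)
    moreover have "(l_invert \<circ> l_rot (\<lambda>v. - qcnj v)) \<circ>
        ((l_trans (- \<gamma> * qcnj \<alpha>) \<circ> l_rot (\<lambda>v. \<delta> * v * qcnj \<alpha>)) \<circ> (l_invert \<circ> l_rot (\<lambda>v. - qcnj v))) \<in> refl_gen"
      by (intro map_gen_mult swap_refl_gen upper_refl_gen units R_uminus cond)
    ultimately show ?thesis by blast
  qed
qed

lemma EZ_acts:
  assumes "M \<in> EZ n R" shows "\<exists>T\<in>refl_gen. acts_as M T"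
  using assms unfolding EZ_def
proof (induction rule: generate.induct)
  case one
  show ?case using acts_as_one map_gen.map_gen_id by (auto simp: GZ_def)
next
  case (incl M)
  then show ?case using triangular_acts by blast
next
  case (inv M)
  then obtain T where T: "T \<in> refl_gen" "acts_as M T" using triangular_acts by blast
  have inv_closed: "bij f \<and> finv f \<in> S.refl_grp True \<union> S.refl_grp False"
    if "f \<in> S.refl_grp True \<union> S.refl_grp False" for f
    using that S.map_group_refl_grp[of True] S.map_group_refl_grp[of False] unfolding map_group_def by blast
  have bT: "bij T \<and> finv T \<in> refl_gen" by (rule map_gen_inv[OF inv_closed T(1)])
  have "M \<in> carrier (GZ n R)" using inv by (simp add: GZ_def)
  then have "M \<otimes>\<^bsub>GZ n R\<^esub> inv\<^bsub>GZ n R\<^esub> M = \<one>\<^bsub>GZ n R\<^esub>" by (rule group.r_inv[OF group_GZ])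
  then have "M ** inv\<^bsub>GZ n R\<^esub> M = mat 1" by (simp add: GZ_def)
  then show ?case using acts_as_inverse[OF T(2)] bT by blast
next
  case (eng M N)
  then obtain S T where "S \<in> refl_gen" "acts_as M S" "T \<in> refl_gen" "acts_as N T" by blast
  then have "acts_as (M ** N) (S \<circ> T)" "S \<circ> T \<in> refl_gen" using acts_as_mult map_gen_mult by blast+
  then show ?case by (auto simp: GZ_def)
qed

text \<open>The norms of \<open>\<tau>\<close>, \<open>\<tau> + 1\<close> and \<open>\<tau> + 2\<close> are values of a monic quadratic polynomial, which has
  at most two roots modulo 3.\<close>

lemma exists_nrm_coprime_3:
  obtains a :: quat and \<nu> :: int where "a \<in> L" "e \<bullet> a = h" "nrm a = of_int \<nu>" "\<not> 3 dvd \<nu>"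
proof -
  have \<tau>R: "\<tau> \<in> R" using \<tau>_L L_R by blast
  obtain N T :: int where NT: "nrm \<tau> = of_int N" "tr \<tau> = of_int T"
    using R_nrm[OF \<tau>R] R_tr[OF \<tau>R] by (auto elim!: Ints_cases)
  have nrm_j: "nrm (\<tau> + of_int j *\<^sub>R 1) = of_int (N + j * T + j * j)" for j :: int
  proof -
    have "nrm (\<tau> + of_int j *\<^sub>R 1) = nrm \<tau> + of_int j * tr \<tau> + of_int j * of_int j"
      by (simp add: nrm_explicit tr_eq_Re quat_ops algebra_simps)
    then show ?thesis by (simp add: NT)
  qed
  have "\<not> (3 dvd N + 0 * T + 0 * 0 \<and> 3 dvd N + 1 * T + 1 * 1 \<and> 3 dvd N + 2 * T + 2 * 2)"
    by presburger
  then obtain j where j: "\<not> 3 dvd N + j * T + j * j" by blast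
  have "\<tau> + of_int j *\<^sub>R 1 \<in> L" by (intro M_add M_scale_int one_L \<tau>_L)
  moreover have "e \<bullet> (\<tau> + of_int j *\<^sub>R 1) = h" by (simp add: inner_add_right e_one h_def)
  ultimately show thesis using that nrm_j j by blast
qed

text \<open>\<open>d\<close> is an integer multiple of the conjugate of \<open>a\<close>. So it
  commutes with \<open>a\<close>, and the product a d = \<nu>^2 is 1 modulo 3, which determines
  \<open>b\<close>; the equations of all three groups follow. The large trace \<open>a + d\<close>
  makes the powers of the matrix expand.\<close>

lemma exists_deep_element:
  obtains a d :: quat and b :: int where "mat2 a (of_int b) 3 d \<in> GZ_set n R" "a * d - 3 * of_int b = 1"
    "e \<bullet> a = h" "4 \<le> norm (a + d)"
proof -
  obtain a \<nu> where a: "a \<in> L" "e \<bullet> a = h" "nrm a = of_int \<nu>" "\<not> 3 dvd \<nu>" by (rule exists_nrm_coprime_3)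
  have aR: "a \<in> R" and aV: "a \<in> V" using a(1) by (auto simp: L_eq)
  have "\<exists>b. \<nu> * \<nu> = 3 * b + 1"
  proof -
    define m where "m = \<nu> div 3"
    have "\<nu> = 3 * m + 1 \<or> \<nu> = 3 * m + 2" using a(4) unfolding m_def by presburger
    then have "\<nu> * \<nu> = 3 * (3 * m * m + 2 * m) + 1 \<or> \<nu> * \<nu> = 3 * (3 * m * m + 4 * m + 1) + 1"
      by (auto simp: algebra_simps)
    then show ?thesis by blast
  qed
  then obtain b where b: "\<nu> * \<nu> = 3 * b + 1" by blast
  define d where "d = of_int \<nu> *\<^sub>R qcnj a"
  have dR: "d \<in> R" unfolding d_def by (intro discrete_group.M_scale_int[OF R_discrete] R_qcnj aR)
  have ad: "a * d = of_int (\<nu> * \<nu>)" "d * a = of_int (\<nu> * \<nu>)"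
    by (simp_all add: d_def qcnj_mult_self a(3) of_int_mult_quat)
  have det: "a * d - 3 * of_int b = 1" unfolding ad b by simp
  have "norm (a + d) \<ge> 4"
  proof -
    have "h \<le> norm a"
      using Cauchy_Schwarz_ineq2[of e a] norm_e a(2) h_pos by simp
    then have na: "10 < norm a" using h_gt_10 by linarith
    have "of_int \<nu> = norm a * norm a" using a(3) by (simp add: nrm_eq_norm power2_eq_square)
    then have \<nu>: "10 * 10 < (of_int \<nu> :: real)" 
      using na by (simp only: \<open>of_int \<nu> = _\<close>) (intro mult_strict_mono, auto)
    have "norm d = of_int \<nu> * norm a"
      unfolding d_def using \<nu> nrm_qcnj[of a] by (simp add: nrm_eq_norm)
    moreover have "10 * 10 * norm a \<le> of_int \<nu> * norm a" using \<nu> by (intro mult_right_mono) auto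
    ultimately have "10 * 10 * norm a \<le> norm d" by simp
    moreover have "norm d - norm a \<le> norm (a + d)" using norm_diff_ineq[of d a] by (simp add: add.commute)
    ultimately show ?thesis using na by linarith
  qed
  moreover have "mat2 a (of_int b) 3 d \<in> GZ_set n R"
  proof -
    have three: "3 \<in> R" "of_int b \<in> R" using R_of_int[of 3] R_of_int[of b] by simp_all
    consider "n = 3" | "n = 4" | "n = 5" using n_cases by blast
    then show ?thesis
    proof cases
      case 1
      have "of_int b * 3 = 3 * (of_int b :: quat)" by (simp add: mult_of_int_commute)
      then show ?thesis unfolding GZ3_iff[OF 1] using aR dR three det by simp
    next
      case 2
      have dd: "ddag a = a" using aV V_iff_ddag[OF 2] by simp
      have real: "ddag (of_int k) = of_int k" for k :: int
        using of_int_mult_quat[of k 1] by (metis ddag_simps(7,9) mult.right_neutral)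
      have d3: "ddag 3 = 3" using real[of 3] by simp
      have dd': "ddag d = d" by (simp add: d_def ddag_simps dd)
      have "ddag_hat (mat2 a (of_int b) 3 d) = mat2 d (- of_int b) (- 3) a"
        by (simp add: ddag_hat_mat2 dd dd' real d3)
      moreover have "of_int b * d = d * of_int b" "of_int b * a = a * of_int b" by (simp_all add: mult_of_int_commute)
      moreover have "3 * d = d * 3" "3 * a = a * 3"
        using mult_of_int_commute[of 3 d] mult_of_int_commute[of 3 a] by simp_all
      moreover have "of_int b * 3 = 3 * (of_int b :: quat)" by (simp add: mult_of_int_commute)
      moreover have "d * a - 3 * of_int b = 1" using det ad by simp
      ultimately show ?thesis
        unfolding GZ4_iff[OF 2] using aR dR three det by (simp add: mat2_mult mat2_one mat_over_iff)
    next
      case 3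
      have three_R: "(3 :: quat) = 3 *\<^sub>R 1" using of_int_mult_quat[of 3 1] by simp
      have b_R: "(of_int b :: quat) = of_int b *\<^sub>R 1" using of_int_mult_quat[of b 1] by simp
      have 1: "nrm a * nrm d = of_int ((\<nu> * \<nu>) * (\<nu> * \<nu>))"
        using nrm_mult[of a d] unfolding ad by (simp add: nrm_scaleR nrm_one of_int_mult_quat[of "\<nu> * \<nu>" 1, simplified] power2_eq_square)
      have 2: "nrm (of_int b) * nrm 3 = of_int (9 * (b * b))"
        unfolding three_R b_R by (simp add: nrm_scaleR nrm_one power2_eq_square)
      have "a * qcnj 3 * d = (3 * of_int (\<nu> * \<nu>)) *\<^sub>R 1"
        unfolding three_R by (simp add: qcnj_simps ad of_int_mult_quat[of "\<nu> * \<nu>" 1, simplified])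
      then have 4: "of_int b \<bullet> (a * qcnj 3 * d) = of_int (3 * b * (\<nu> * \<nu>))"
        unfolding b_R using norm_quat_one by (simp add: norm_eq_1)
      \<comment> \<open>The three terms form the square of \<nu>^2 - 3 b = 1.\<close>
      have "study_det a (of_int b) 3 d = 1"
        unfolding study_det_def 1 2 4 b by (simp add: algebra_simps)
      then show ?thesis unfolding GZ5_iff[OF 3] using aR dR three by simp
    qed
  qed
  ultimately show thesis using that det a(2) by blast
qed

text \<open>The first columns (x, y) of the powers of \<open>g\<close> obey a recursion in which |x
  - c y| stays small against |y|, where c = a / 3 is the image of infinity under \<open>g\<close>.
  So all points x y^-1 remain within 1/9 of \<open>c\<close>, whose height is h / 3.\<close>

theorem EZ_infinite_index: "infinite (rcosets\<^bsub>GZ n R\<^esub> (EZ n R))"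
proof -
  interpret GZ: group "GZ n R" by (rule group_GZ)
  obtain a d b where g: "mat2 a (of_int b) 3 d \<in> GZ_set n R" and det: "a * d - 3 * of_int b = 1"
    and ea: "e \<bullet> a = h" and ad4: "4 \<le> norm (a + d)" by (rule exists_deep_element)
  define g where "g = mat2 a (of_int b) 3 d"
  have gc: "g \<in> carrier (GZ n R)" using g by (simp add: g_def GZ_def)
  define pw where "pw k = g [^]\<^bsub>GZ n R\<^esub> k" for k :: nat
  have pw_c: "pw k \<in> carrier (GZ n R)" for k unfolding pw_def using gc by simp
  define x where "x k = pw k $ 1 $ 1" for k
  define y where "y k = pw k $ 2 $ 1" for k
  define c where "c = (1 / 3 :: real) *\<^sub>R a"
  have pw_Suc: "pw (Suc k) = g ** pw k" for k
    using GZ.nat_pow_Suc2[OF gc, of k] by (simp add: pw_def GZ_def)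
  have xS: "x (Suc k) = a * x k + of_int b * y k" and yS: "y (Suc k) = 3 * x k + d * y k" for k
    by (simp_all add: x_def y_def pw_Suc mat2_mult_nth g_def)
  have three: "3 * z = 3 *\<^sub>R z" for z :: quat using of_int_mult_quat[of 3 z] by simp
  have y_eq: "y (Suc k) = 3 *\<^sub>R (x k - c * y k) + (a + d) * y k" for k
    unfolding yS three by (simp add: c_def scaleR_diff_right distrib_right)
  \<comment> \<open>The determinant relation a d - 3 b = 1 cancels everything but y / 3.\<close>
  have x_eq: "x (Suc k) - c * y (Suc k) = - ((1 / 3) *\<^sub>R y k)" for k
  proof -
    have "3 *\<^sub>R (x (Suc k) - c * y (Suc k)) = 3 *\<^sub>R (a * x k) + (3 * of_int b) * y k - a * (3 *\<^sub>R x k + d * y k)"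
      unfolding xS yS three by (simp add: c_def scaleR_diff_right scaleR_add_right mult.assoc distrib_left)
    also have "\<dots> = - ((a * d - 3 * of_int b) * y k)"
      by (simp add: distrib_left left_diff_distrib mult.assoc)
    also have "\<dots> = - y k" unfolding det by simp
    finally have "(1 / 3 :: real) *\<^sub>R 3 *\<^sub>R (x (Suc k) - c * y (Suc k)) = (1 / 3) *\<^sub>R (- y k)" by simp
    then show ?thesis by simp
  qed
  \<comment> \<open>By the trace bound |y| grows at least by the factor 4 - 1/3 \<ge> 3, and the
    next deviation is |y| / 3, so the ratio 1/9 reproduces itself.\<close>
  have inv: "y (Suc k) \<noteq> 0 \<and> norm (x (Suc k) - c * y (Suc k)) \<le> norm (y (Suc k)) / 9" for k
  proof (induction k)
    case 0
    have "pw 0 = mat 1" by (simp add: pw_def GZ_def)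
    then have "x 0 = 1" "y 0 = 0" by (simp_all add: x_def y_def mat2_one)
    then have "y (Suc 0) = 3 *\<^sub>R 1" "x (Suc 0) - c * y (Suc 0) = 0"
      unfolding x_eq by (simp_all add: y_eq)
    then show ?case by (simp add: norm_quat_one) 
  next
    case (Suc k)
    let ?y = "y (Suc k)"
    have yp: "0 < norm ?y" using Suc by simp
    have "norm ((a + d) * ?y) - norm (3 *\<^sub>R (x (Suc k) - c * ?y)) \<le> norm (y (Suc (Suc k)))"
      unfolding y_eq[of "Suc k"] using norm_diff_ineq[of "(a + d) * ?y" "3 *\<^sub>R (x (Suc k) - c * ?y)"]
      by (simp add: add.commute)
    moreover have "4 * norm ?y \<le> norm ((a + d) * ?y)"
      unfolding norm_quat_mult using ad4 by (intro mult_right_mono) auto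
    moreover have "norm (3 *\<^sub>R (x (Suc k) - c * ?y)) \<le> norm ?y / 3" using Suc by simp
    ultimately have big: "3 * norm ?y \<le> norm (y (Suc (Suc k)))" using yp by linarith
    have "norm (x (Suc (Suc k)) - c * y (Suc (Suc k))) = norm ?y / 3" unfolding x_eq[of "Suc k"] by simp
    then show ?case using big yp by auto
  qed
  have not_E: "pw (Suc k) \<notin> EZ n R" for k
  proof
    assume "pw (Suc k) \<in> EZ n R"
    then obtain T where T: "T \<in> refl_gen" "acts_as (pw (Suc k)) T" using EZ_acts by blast
    let ?x = "x (Suc k)" and ?y = "y (Suc k)"
    have "column_vec ?x ?y = T (column_vec 1 0)"
      using T(2)[unfolded acts_as_def, rule_format, of 1 0] by (simp add: x_def y_def)
    also have "column_vec 1 0 = e_inf" by (simp add: column_vec_def qcnj_simps nrm_one nrm_eq_0)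
    finally have Te: "T e_inf = (nrm ?y, ?x * qcnj ?y, nrm ?x)" by (simp add: column_vec_def)
    have ny: "0 < nrm ?y" using inv[of k] by (simp add: nrm_eq_norm)
    from S.orbit_e_inf_near_planes[OF T(1)] show False
    proof
      assume "T e_inf = e_inf"
      then show False using Te ny by simp
    next
      assume "\<exists>\<mu>>0. \<exists>z. \<exists>k::int. T e_inf = \<mu> *\<^sub>R hat (Some z) \<and> \<bar>e \<bullet> z - of_int k * h\<bar> \<le> 1"
      then obtain \<mu> z and l :: int where z: "T e_inf = \<mu> *\<^sub>R hat (Some z)" "\<bar>e \<bullet> z - of_int l * h\<bar> \<le> 1" by blast
      have \<mu>: "\<mu> = nrm ?y" and xz: "?x * qcnj ?y = nrm ?y *\<^sub>R z" using z(1) Te by simp_all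
      have "c * ?y * qcnj ?y = nrm ?y *\<^sub>R c" by (simp add: mult.assoc qcnj_mult_self of_real_def)
      then have "nrm ?y *\<^sub>R (z - c) = (?x - c * ?y) * qcnj ?y"
        by (simp add: left_diff_distrib xz scaleR_diff_right)
      then have "nrm ?y * norm (z - c) = norm (?x - c * ?y) * norm ?y"
        using ny nrm_qcnj[of ?y] by (metis norm_quat_mult norm_scaleR abs_of_pos nrm_eq_norm norm_ge_zero power2_eq_iff_nonneg)
      also have "\<dots> \<le> norm ?y / 9 * norm ?y" using inv[of k] by (intro mult_right_mono) auto
      also have "\<dots> = nrm ?y * (1 / 9)" by (simp add: nrm_eq_norm power2_eq_square)
      finally have "norm (z - c) \<le> 1 / 9" using ny by (simp only: mult_le_cancel_left_pos)
      moreover have "\<bar>e \<bullet> (z - c)\<bar> \<le> norm e * norm (z - c)" by (rule Cauchy_Schwarz_ineq2)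
      moreover have "e \<bullet> (z - c) = e \<bullet> z - h / 3" by (simp add: inner_diff_right c_def ea)
      ultimately have "\<bar>e \<bullet> z - h / 3\<bar> \<le> 1 / 9" using norm_e by simp
      \<comment> \<open>At most 1 from the orbit theorem plus 1/9 from the recursion, whereas
        \<open>h / 3\<close> keeps a distance of at least \<open>h / 3\<close> from every multiple
        of \<open>h\<close>.\<close>
      then have near: "\<bar>h / 3 - of_int l * h\<bar> \<le> 10 / 9" using z(2) by linarith
      have "h / 3 - of_int l * h = h * (1 / 3 - of_int l)" by (simp add: algebra_simps)
      then have "\<bar>h / 3 - of_int l * h\<bar> = h * \<bar>1 / 3 - of_int l\<bar>" using h_pos by (simp add: abs_mult)
      moreover have "(1 / 3 :: real) \<le> \<bar>1 / 3 - of_int l\<bar>"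
      proof (cases "l \<le> 0")
        case True
        then have "of_int l \<le> (0::real)" by simp
        then show ?thesis by linarith
      next
        case False
        then have "(1::real) \<le> of_int l" by simp
        then show ?thesis by linarith
      qed
      then have "h * (1 / 3) \<le> h * \<bar>1 / 3 - of_int l\<bar>" using h_pos by (intro mult_left_mono) auto
      ultimately show False using near h_gt_10 by linarith
    qed
  qed
  have sg: "subgroup (EZ n R) (GZ n R)" by (rule EZ_subgroup)
  define co where "co k = EZ n R #>\<^bsub>GZ n R\<^esub> pw k" for k
  \<comment> \<open>Equal cosets of two powers would put their quotient, a positive power of
    \<open>g\<close>, into the subgroup.\<close>
  have diff: "co i \<noteq> co (i + Suc k)" for i k
  proof
    assume "co i = co (i + Suc k)"
    then have "pw (i + Suc k) \<in> EZ n R #>\<^bsub>GZ n R\<^esub> pw i"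
      using GZ.rcos_self[OF pw_c sg, of "i + Suc k"] unfolding co_def by simp
    then obtain m where m: "m \<in> EZ n R" "pw (i + Suc k) = m \<otimes>\<^bsub>GZ n R\<^esub> pw i" unfolding r_coset_def by blast
    have "pw (i + Suc k) = pw (Suc k) \<otimes>\<^bsub>GZ n R\<^esub> pw i"
      unfolding pw_def GZ.nat_pow_mult[OF gc] by (simp add: add.commute)
    then have "pw (Suc k) = m"
      using m(2) GZ.right_cancel[OF pw_c[of i] pw_c[of "Suc k"] subgroup.mem_carrier[OF sg m(1)]] by simp
    then show False using m(1) not_E by metis
  qed
  have "inj co"
  proof (rule injI)
    fix i j assume eq: "co i = co j"
    show "i = j"
    proof (rule ccontr)
      assume "i \<noteq> j"
      then consider k where "j = i + Suc k" | k where "i = j + Suc k"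
        by (metis less_imp_Suc_add linorder_neqE_nat add_Suc_right)
      then show False using diff eq by cases metis+
    qed
  qed
  moreover have "range co \<subseteq> rcosets\<^bsub>GZ n R\<^esub> (EZ n R)"
    using pw_c by (auto simp: co_def RCOSETS_def)
  ultimately show ?thesis using finite_subset finite_imageD infinite_UNIV_nat by metis
qed

end

theorem theorem1p7:
  shows "\<exists>D0::real.
    (\<forall>n R u. n \<in> {3,4,5} \<and> is_RZ n R \<and> normalized_covering_vector n R u \<and> \<bar>disc R\<bar> > D0 \<longrightarrow>
       nrm u > 3 \<and>
       (subgroup (EZ n R) (GZ n R) \<and> infinite (rcosets\<^bsub>GZ n R\<^esub> (EZ n R))) \<and>
       (\<exists>\<tau>. packing_shift n R u \<tau>) \<and>
       (\<forall>\<tau>. packing_shift n R u \<tau> \<longrightarrow> packing_density n R u \<tau> < 1)) \<and>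
    (\<forall>\<epsilon>::real. \<epsilon> > 0 \<longrightarrow> (\<exists>D::real. \<forall>n R u \<tau>.
       n \<in> {3,4,5} \<and> is_RZ n R \<and> normalized_covering_vector n R u \<and> \<bar>disc R\<bar> > D0 \<and>
       packing_shift n R u \<tau> \<and> \<bar>disc R\<bar> > D \<longrightarrow> packing_density n R u \<tau> < ennreal \<epsilon>))"
proof -
  \<comment> \<open>The bound of \<open>disc_le\<close> at \<open>h = a\<close>, so a larger
    discriminant forces \<open>h > a\<close>. The thresholds 10 and 1 + 131072 / \<epsilon> are
    those of \<open>slab\<close> and of the density bound; the claims with the constant 1 use
    \<epsilon> = 1.\<close>
  define F where "F a = 24 * (8 * (a + 1)\<^sup>2) ^ 4" for a :: real
  have density: "packing_density n R u \<tau> < ennreal \<epsilon>"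
    if "is_RZ n R" "normalized_covering_vector n R u" "packing_shift n R u \<tau>"
      "\<bar>disc R\<bar> > F (max 10 (1 + 131072 / \<epsilon>))" "0 < \<epsilon>" for n R u \<tau> \<epsilon>
  proof -
    interpret covering_shift n R u \<tau> using that by unfold_locales
    have h: "max 10 (1 + 131072 / \<epsilon>) < h" by (rule h_gt_if_disc[OF that(4)[unfolded F_def]]) simp
    then interpret wide_shift n R u \<tau> by unfold_locales simp
    have "131072 / \<epsilon> < h - 1" using h by simp
    then have "131072 / (h - 1) < \<epsilon>" using that(5) h_gt_10 by (simp add: field_simps)
    then have "ennreal (131072 / (h - 1)) < ennreal \<epsilon>" using that(5) by (intro ennreal_lessI) auto
    then show ?thesis using packing_density_le by (rule le_less_trans[rotated])
  qed
  have main: "nrm u > 3 \<and>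
       (subgroup (EZ n R) (GZ n R) \<and> infinite (rcosets\<^bsub>GZ n R\<^esub> (EZ n R))) \<and>
       (\<exists>\<tau>. packing_shift n R u \<tau>) \<and>
       (\<forall>\<tau>. packing_shift n R u \<tau> \<longrightarrow> packing_density n R u \<tau> < 1)"
    if R: "is_RZ n R" "normalized_covering_vector n R u" "\<bar>disc R\<bar> > F (max 10 (1 + 131072 / 1))" for n R u
  proof -
    interpret covering_ring n R u using R by unfold_locales
    obtain \<tau> where \<tau>: "packing_shift n R u \<tau>" using exists_packing_shift by blast
    interpret covering_shift n R u \<tau> using \<tau> by unfold_locales
    have h: "max 10 (1 + 131072 / 1) < h" by (rule h_gt_if_disc[OF R(3)[unfolded F_def]]) simp
    then interpret wide_shift n R u \<tau> by unfold_locales simp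
    have "10 \<le> norm u" using h_le_norm_u h_gt_10 by linarith
    then have "10\<^sup>2 \<le> nrm u" unfolding nrm_eq_norm by (intro power_mono) auto
    then show ?thesis
      using EZ_subgroup EZ_infinite_index \<tau> density[OF R(1,2) _ R(3)] by auto
  qed
  show ?thesis
    by (rule exI[of _ "F (max 10 (1 + 131072 / 1))"]) (use main density in blast)
qed

end
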